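(* Let $(M,g)$ be a compact Riemannian manifold without boundary. Then the bilinear maps $a_K,a_C: H^1(M)\times H^1(M)\to\mathbb{R}$, $$a_K(u,v)=\tfrac12\int_M g(S_u,S_v)\,\omega_M,\qquad a_C(u,v)=\tfrac12\int_M g(C_u,C_v)\,\omega_M,$$ are both coercive; that is, for each $a\in\{a_K,a_C\}$ there are constants $\alpha>0$ and $\mu\in\mathbb{R}$ such that $$a(v,v)+\mu\|v\|_{L^2}^2\ \ge\ \alpha\|v\|_{H^1}^2\qquad\text{for all } v\in H^1(M).$$
   Context: $M$ is a smooth manifold of dimension $n$ with Riemannian metric $g$; $\omega_M$ is the Riemannian volume form (or Riemannian density if $M$ is not orientable). The Einstein summation convention is used and a semicolon denotes covariant differentiation with respect to the Levi-Civita connection. For a vector field $u=u^k$, $\nabla u=u^k_{;j}$ is regarded as a $(1,1)$ tensor, i.e. pointwise as a linear map $T_pM\to T_pM$, and $\mathrm{div}(u)=\mathrm{tr}(\nabla u)=u^k_{;k}$. For $(1,1)$ tensors $A,B$, the adjoint $B^\ast$ is defined by $g(Bv,w)=g(v,B^\ast w)$ for all vector fields $v,w$, and the inner product is $g(A,B)=\mathrm{tr}(AB^\ast)$. Define $(Su)^{ik}=g^{kj}u^i_{;j}+g^{ij}u^k_{;j}$ and $(Cu)^{ik}=(Su)^{ik}-\tfrac{2}{n}\mathrm{div}(u)g^{ik}$. $S_u$ and $C_u$ denote these tensors regarded as $(1,1)$ tensors by lowering an index with $g$; equivalently $S_u=\nabla u+(\nabla u)^\ast$ and $C_u=S_u-\tfrac{2}{n}\mathrm{div}(u)\,\mathrm{id}$.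 $L^2(M)$ and $H^1(M)$ are the spaces of vector fields on $M$ with norms $\|u\|_{L^2}^2=\int_M g(u,u)\,\omega_M$ and $\|u\|_{H^1}^2=\int_M\big(g(u,u)+g(\nabla u,\nabla u)\big)\omega_M$.
   Formalization: Coercivity of a_C is stated only for dimension n ≥ 2, since for n = 1 one has C_u = 0, so a_C = 0 and the claim fails (e.g. on the circle); a_K is treated for every n ≥ 1. *)

theory Defs
  imports "HOL-Analysis.Analysis"
begin

section \<open>Smooth functions on open subsets of Euclidean space\<close>

definition partial :: "'n \<Rightarrow> (real^'n::finite \<Rightarrow> 'b::real_normed_vector) \<Rightarrow> real^'n \<Rightarrow> 'b" where
  "partial i f x = frechet_derivative f (at x) (axis i 1)"

text \<open>For open \<open>S\<close>, \<open>Ck_on k f S\<close> says that \<open>f\<close> is of class \<open>C^k\<close> on \<open>S\<close>.\<close>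

primrec Ck_on :: "nat \<Rightarrow> (real^'n::finite \<Rightarrow> 'b::real_normed_vector) \<Rightarrow> (real^'n) set \<Rightarrow> bool" where
  "Ck_on 0 f S \<longleftrightarrow> continuous_on S f"
| "Ck_on (Suc k) f S \<longleftrightarrow> (\<forall>x\<in>S. f differentiable at x) \<and> (\<forall>i. Ck_on k (partial i f) S)"

definition smooth_on :: "(real^'n::finite) set \<Rightarrow> (real^'n \<Rightarrow> 'b::real_normed_vector) \<Rightarrow> bool" where
  "smooth_on S f \<longleftrightarrow> (\<forall>k. Ck_on k f S)"

definition test_function :: "(real^'n::finite) set \<Rightarrow> (real^'n \<Rightarrow> real) \<Rightarrow> bool" where
  "test_function S \<phi> \<longleftrightarrow>
     smooth_on UNIV \<phi> \<and> (\<exists>K. compact K \<and> K \<subseteq> S \<and> (\<forall>x. x \<notin> K \<longrightarrow> \<phi> x = 0))"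


section \<open>Smooth and Riemannian manifolds\<close>

text \<open>
  The underlying topological space of the manifold is the type \<open>'a\<close>, its dimension is
  \<open>CARD('n)\<close>. Charts have open images in \<open>real^'n\<close>, so there is no boundary. The atlas need
  not be maximal.
\<close>

type_synonym ('a, 'n) chart = "'a set \<times> ('a \<Rightarrow> real^'n)"

abbreviation chart_dom :: "('a, 'n) chart \<Rightarrow> 'a set" where
  "chart_dom c \<equiv> fst c"

abbreviation chart_map :: "('a, 'n) chart \<Rightarrow> 'a \<Rightarrow> real^'n" where
  "chart_map c \<equiv> snd c"

definition chart_img :: "('a, 'n) chart \<Rightarrow> (real^'n) set" where
  "chart_img c = chart_map c ` chart_dom c"

definition chart_inv :: "('a, 'n) chart \<Rightarrow> real^'n \<Rightarrow> 'a" where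
  "chart_inv c = inv_into (chart_dom c) (chart_map c)"

definition transition :: "('a, 'n) chart \<Rightarrow> ('a, 'n) chart \<Rightarrow> real^'n \<Rightarrow> real^'n" where
  "transition c d = chart_map d \<circ> chart_inv c"

locale smooth_manifold =
  fixes atlas :: "('a::{t2_space,second_countable_topology}, 'n::finite) chart set"
  assumes chart_dom_open: "c \<in> atlas \<Longrightarrow> open (chart_dom c)"
    and chart_img_open: "c \<in> atlas \<Longrightarrow> open (chart_img c)"
    and chart_homeo: "c \<in> atlas \<Longrightarrow>
          homeomorphism (chart_dom c) (chart_img c) (chart_map c) (chart_inv c)"
    and atlas_covers: "(\<Union>c\<in>atlas. chart_dom c) = UNIV"
    and transition_smooth: "c \<in> atlas \<Longrightarrow> d \<in> atlas \<Longrightarrow>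
          smooth_on (chart_map c ` (chart_dom c \<inter> chart_dom d)) (transition c d)"

text \<open>
  A tensor field is given by its components: for each chart \<open>c\<close> of the atlas, a function of the
  coordinates \<open>x \<in> chart_img c\<close>, subject to the transformation law of the type of tensor
  in question. The values outside \<open>chart_img c\<close>, and those for charts not in the atlas, play no
  role.
\<close>

type_synonym ('a, 'n, 'b) components = "('a, 'n) chart \<Rightarrow> real^'n \<Rightarrow> 'b"

text \<open>The entry \<open>g c x $ i $ j\<close> is the component \<open>g\<^sub>i\<^sub>j\<close> of the metric in the chart \<open>c\<close>.\<close>

locale riemannian_manifold = smooth_manifold atlas
  for atlas :: "('a::{t2_space,second_countable_topology}, 'n::finite) chart set" +
  fixes g :: "('a, 'n, real^'n^'n) components"
  assumes metric_smooth: "c \<in> atlas \<Longrightarrow> smooth_on (chart_img c) (g c)"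
    and metric_symmetric: "c \<in> atlas \<Longrightarrow> x \<in> chart_img c \<Longrightarrow> transpose (g c x) = g c x"
    and metric_positive: "c \<in> atlas \<Longrightarrow> x \<in> chart_img c \<Longrightarrow> v \<noteq> 0 \<Longrightarrow> v \<bullet> (g c x *v v) > 0"
    and metric_transforms: "c \<in> atlas \<Longrightarrow> d \<in> atlas \<Longrightarrow> p \<in> chart_dom c \<inter> chart_dom d \<Longrightarrow>
          (let J = jacobian (transition c d) (at (chart_map c p))
           in g c (chart_map c p) = transpose J ** g d (chart_map d p) ** J)"


section \<open>Pointwise linear algebra\<close>

text \<open>In this section \<open>G\<close> is the matrix of the metric at one point.\<close>

definition inner_g :: "real^'n^'n \<Rightarrow> real^'n \<Rightarrow> real^'n \<Rightarrow> real" where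
  "inner_g G v w = v \<bullet> (G *v w)"

definition adjoint_g :: "real^'n^'n \<Rightarrow> real^'n^'n \<Rightarrow> real^'n^'n" where
  "adjoint_g G B = (THE B'. \<forall>v w. inner_g G (B *v v) w = inner_g G v (B' *v w))"

definition tensor_inner_g :: "real^'n^'n \<Rightarrow> real^'n^'n \<Rightarrow> real^'n^'n \<Rightarrow> real" where
  "tensor_inner_g G A B = trace (A ** adjoint_g G B)"


section \<open>Vector fields, covariant derivative and Sobolev spaces\<close>

context
  fixes atlas :: "('a::{t2_space,second_countable_topology}, 'n::finite) chart set"
    and g :: "('a, 'n, real^'n^'n) components"
begin

definition vector_field :: "('a, 'n, real^'n) components \<Rightarrow> bool" where
  "vector_field u \<longleftrightarrow>
     (\<forall>c\<in>atlas. u c \<in> borel_measurable (restrict_space borel (chart_img c))) \<and>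
     (\<forall>c\<in>atlas. \<forall>d\<in>atlas. \<forall>p\<in>chart_dom c \<inter> chart_dom d.
        let J = jacobian (transition c d) (at (chart_map c p))
        in u d (chart_map d p) = J *v u c (chart_map c p))"

text \<open>
  For a (1,1) tensor \<open>T\<close>, the entry \<open>T c x $ k $ j\<close> is the component with upper index \<open>k\<close> and
  lower index \<open>j\<close>, so that \<open>T c x *v v\<close> is \<open>T\<close> applied to the tangent vector \<open>v\<close>.
\<close>

definition tensor11_field :: "('a, 'n, real^'n^'n) components \<Rightarrow> bool" where
  "tensor11_field T \<longleftrightarrow>
     (\<forall>c\<in>atlas. T c \<in> borel_measurable (restrict_space borel (chart_img c))) \<and>
     (\<forall>c\<in>atlas. \<forall>d\<in>atlas. \<forall>p\<in>chart_dom c \<inter> chart_dom d.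
        let J = jacobian (transition c d) (at (chart_map c p))
        in T d (chart_map d p) ** J = J ** T c (chart_map c p))"

text \<open>The Riemannian density: \<open>sqrt (det g)\<close> times Lebesgue measure in every chart.\<close>

definition riemannian_density :: "'a measure" where
  "riemannian_density = (THE \<omega>. sets \<omega> = sets borel \<and>
     (\<forall>c\<in>atlas. \<forall>A\<in>sets borel. A \<subseteq> chart_dom c \<longrightarrow>
        emeasure \<omega> A =
          (\<integral>\<^sup>+x. ennreal (sqrt (det (g c x))) * indicator (chart_map c ` A) x \<partial>lborel)))"

text \<open>
  The function on the manifold given by a scalar expression in components. The choice of the
  chart is immaterial for expressions invariant under change of coordinates.
\<close>

definition scalar :: "('a, 'n, real) components \<Rightarrow> 'a \<Rightarrow> real" where
  "scalar f p = (let c = (SOME c. c \<in> atlas \<and> p \<in> chart_dom c) in f c (chart_map c p))"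

definition inner_vf :: "('a, 'n, real^'n) components \<Rightarrow> ('a, 'n, real^'n) components \<Rightarrow> 'a \<Rightarrow> real"
  where "inner_vf u v = scalar (\<lambda>c x. inner_g (g c x) (u c x) (v c x))"

definition inner_tf ::
    "('a, 'n, real^'n^'n) components \<Rightarrow> ('a, 'n, real^'n^'n) components \<Rightarrow> 'a \<Rightarrow> real"
  where "inner_tf A B = scalar (\<lambda>c x. tensor_inner_g (g c x) (A c x) (B c x))"

text \<open>
  The Christoffel symbols of the Levi-Civita connection,
  \<open>christoffel c k i j = 1/2 g^{kl} (d_i g_{jl} + d_j g_{il} - d_l g_{ij})\<close>.
\<close>

definition christoffel :: "('a, 'n) chart \<Rightarrow> 'n \<Rightarrow> 'n \<Rightarrow> 'n \<Rightarrow> real^'n \<Rightarrow> real" where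
  "christoffel c k i j x = 1 / 2 * (\<Sum>l\<in>UNIV. matrix_inv (g c x) $ k $ l *
     (partial i (\<lambda>y. g c y $ j $ l) x + partial j (\<lambda>y. g c y $ i $ l) x
      - partial l (\<lambda>y. g c y $ i $ j) x))"

text \<open>
  \<open>T\<close> is a weak covariant derivative of \<open>u\<close>: in every chart, both are locally integrable and
  \<open>d_j u^k = T^k_j - christoffel^k_{ij} u^i\<close> holds in the sense of distributions, that is,
  \<open>T^k_j = u^k_{;j}\<close>.
\<close>

definition weak_nabla :: "('a, 'n, real^'n) components \<Rightarrow> ('a, 'n, real^'n^'n) components \<Rightarrow> bool"
  where "weak_nabla u T \<longleftrightarrow> tensor11_field T \<and>
     (\<forall>c\<in>atlas. \<forall>K. compact K \<and> K \<subseteq> chart_img c \<longrightarrow>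
        set_integrable lborel K (u c) \<and> set_integrable lborel K (T c)) \<and>
     (\<forall>c\<in>atlas. \<forall>\<phi>. test_function (chart_img c) \<phi> \<longrightarrow> (\<forall>k j.
        (\<integral>x. u c x $ k * partial j \<phi> x \<partial>lborel) =
        - (\<integral>x. (T c x $ k $ j - (\<Sum>i\<in>UNIV. christoffel c k i j x * u c x $ i)) * \<phi> x \<partial>lborel)))"

definition L2 :: "('a, 'n, real^'n) components set" where
  "L2 = {u. vector_field u \<and> integrable riemannian_density (inner_vf u u)}"

definition H1 :: "('a, 'n, real^'n) components set" where
  "H1 = {u \<in> L2. \<exists>T. weak_nabla u T \<and> integrable riemannian_density (inner_tf T T)}"

text \<open>
  For \<open>u \<in> H1\<close>, \<open>nabla u\<close> is the weak covariant derivative of \<open>u\<close>, which is unique almost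
  everywhere; \<open>SOME\<close> only chooses a representative.
\<close>

definition nabla :: "('a, 'n, real^'n) components \<Rightarrow> ('a, 'n, real^'n^'n) components" where
  "nabla u = (SOME T. weak_nabla u T \<and> integrable riemannian_density (inner_tf T T))"

definition L2_norm :: "('a, 'n, real^'n) components \<Rightarrow> real" where
  "L2_norm u = sqrt (\<integral>p. inner_vf u u p \<partial>riemannian_density)"

definition H1_norm :: "('a, 'n, real^'n) components \<Rightarrow> real" where
  "H1_norm u =
     sqrt (\<integral>p. (inner_vf u u p + inner_tf (nabla u) (nabla u) p) \<partial>riemannian_density)"


section \<open>The Killing and conformal Killing forms\<close>

definition divergence :: "('a, 'n, real^'n) components \<Rightarrow> ('a, 'n, real) components" where
  "divergence u c x = trace (nabla u c x)"

definition S_tensor :: "('a, 'n, real^'n) components \<Rightarrow> ('a, 'n, real^'n^'n) components" where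
  "S_tensor u c x = nabla u c x + adjoint_g (g c x) (nabla u c x)"

definition C_tensor :: "('a, 'n, real^'n) components \<Rightarrow> ('a, 'n, real^'n^'n) components" where
  "C_tensor u c x = S_tensor u c x - (2 / real CARD('n) * divergence u c x) *\<^sub>R mat 1"

definition a_K :: "('a, 'n, real^'n) components \<Rightarrow> ('a, 'n, real^'n) components \<Rightarrow> real" where
  "a_K u v = 1 / 2 * (\<integral>p. inner_tf (S_tensor u) (S_tensor v) p \<partial>riemannian_density)"

definition a_C :: "('a, 'n, real^'n) components \<Rightarrow> ('a, 'n, real^'n) components \<Rightarrow> real" where
  "a_C u v = 1 / 2 * (\<integral>p. inner_tf (C_tensor u) (C_tensor v) p \<partial>riemannian_density)"

definition coercive ::
    "(('a, 'n, real^'n) components \<Rightarrow> ('a, 'n, real^'n) components \<Rightarrow> real) \<Rightarrow> bool" where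
  "coercive a \<longleftrightarrow> (\<exists>\<alpha>>0. \<exists>\<mu>. \<forall>v\<in>H1. a v v + \<mu> * (L2_norm v)\<^sup>2 \<ge> \<alpha> * (H1_norm v)\<^sup>2)"

end

end

(*
  Pointwise, |S_u|^2 / 2 = |T|^2 + tr (T^2) and |C_u|^2 / 2 = |T|^2 + tr (T^2) - (2/n) (tr T)^2, where
  T is the covariant derivative of u. So it is enough to control the integral of
  tr (T^2) - (tr T)^2 by an arbitrarily small multiple of |T|^2 plus a multiple of |u|^2: the leftover
  term (1 - 2/n) (tr T)^2 is nonnegative for n >= 2. In a chart, up to Christoffel terms of lower order,
  tr (T^2) - (tr T)^2 is a sum of null forms d_j u^k d_k u^j - d_k u^k d_j u^j. Integrated against a
  bump function, each of them equals by integration by parts an integral of u times a first derivative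
  of u. Since the integrands |S_u|^2 and |C_u|^2 are nonnegative, finitely many bumps whose sum is
  bounded below replace a partition of unity, and no curvature enters. For weak derivatives the
  integration by parts is justified by mollifying only one of the two factors.
*)
theory Submission
  imports Defs
begin

section \<open>Smooth bump functions\<close>

text \<open>A field in H1 has only first weak derivatives, so the second derivatives that the
  classical integration by parts cancels do not exist. They are put on the mollifier instead: it
  depends on x - y, its second derivatives commute, and after Fubini the unwanted terms cancel
  before any limit is taken. The limit then concerns only the correlation of two square-integrable
  functions at shift 0, which is continuous because translation is continuous in L2. The weights on
  the manifold are bumps divided by sqrt (det g), so that in the chart they become smooth weights
  for Lebesgue measure. Lower-order terms are products of u with u or with its gradient, and Young's
  inequality makes their gradient part as small as the patching demands. The Riemannian density is
  given by a description, so nothing can be integrated before its existence and uniqueness are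
  shown; this is where change of variables between charts enters. For n = 1 the tensor C_u vanishes
  identically, so a_C controls no derivative; this is why the second claim is restricted to n >=
  2.\<close>

definition flat_exp :: "nat \<Rightarrow> real \<Rightarrow> real" where
  "flat_exp m t = (if t > 0 then (1 / t) ^ m * exp (- (1 / t)) else 0)"

lemma flat_exp_tendsto_0: "((\<lambda>t. (1 / t) ^ m * exp (- (1 / t))) \<longlongrightarrow> 0) (at_right (0::real))"
proof -
  have "filterlim (\<lambda>t::real. 1 / t) at_top (at_right 0)"
    using filterlim_inverse_at_top_right by (simp add: inverse_eq_divide)
  moreover have "((\<lambda>s::real. s ^ m * exp (- s)) \<longlongrightarrow> 0) at_top"
    using tendsto_power_div_exp_0[of m] by (simp add: exp_minus field_simps)
  ultimately show ?thesis
    using filterlim_compose[of "\<lambda>s::real. s ^ m * exp (- s)" "nhds 0" at_top "\<lambda>t. 1 / t" "at_right 0"]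
    by simp
qed

text \<open>\<open>flat_exp 0\<close> is the classical function exp(-1/t) that is flat at 0. The
  powers of 1/t are the factors that differentiation produces, so the family is closed under it up
  to linear combinations.\<close>

lemma flat_exp_has_derivative:
  "(flat_exp m has_real_derivative flat_exp (m + 2) t - real m * flat_exp (m + 1) t) (at t)"
proof -
  consider "t > 0" | "t < 0" | "t = 0" by linarith
  then show ?thesis
  proof cases
    case 1
    have "((\<lambda>t. (1 / t) ^ m * exp (- (1 / t))) has_real_derivative
        flat_exp (m + 2) t - real m * flat_exp (m + 1) t) (at t)"
      unfolding flat_exp_def using 1
      by (cases m) (auto intro!: derivative_eq_intros simp: field_simps power2_eq_square,
        metis One_nat_def power_eq_if)
    then show ?thesis
    proof (rule DERIV_cong_ev[OF refl _ refl, THEN iffD1, rotated])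
      have "eventually (\<lambda>s. s > 0) (nhds t)" using 1 by (rule order_tendstoD(1)[OF filterlim_ident])
      then show "\<forall>\<^sub>F x in nhds t. (1 / x) ^ m * exp (- (1 / x)) = flat_exp m x"
        by eventually_elim (simp add: flat_exp_def)
    qed
  next
    case 2
    have "((\<lambda>t. 0) has_real_derivative flat_exp (m + 2) t - real m * flat_exp (m + 1) t) (at t)"
      unfolding flat_exp_def using 2 by auto
    then show ?thesis
    proof (rule DERIV_cong_ev[OF refl _ refl, THEN iffD1, rotated])
      have "eventually (\<lambda>s. s < 0) (nhds t)" using 2 by (rule order_tendstoD(2)[OF filterlim_ident])
      then show "\<forall>\<^sub>F x in nhds t. 0 = flat_exp m x"
        by eventually_elim (simp add: flat_exp_def)
    qed
  next
    case 3
    \<comment> \<open>On the right the difference quotient at 0 is \<open>flat_exp (m + 1)\<close>,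
      which tends to 0; on the left it vanishes.\<close>
    have "((\<lambda>h. flat_exp m h / h) \<longlongrightarrow> 0) (at_right 0)"
    proof (rule Lim_transform_eventually[OF flat_exp_tendsto_0[of "m + 1"]])
      show "\<forall>\<^sub>F x in at_right 0. (1 / x) ^ (m + 1) * exp (- (1 / x)) = flat_exp m x / x"
        using eventually_at_right_less[of "0::real"] by eventually_elim (simp add: flat_exp_def field_simps)
    qed
    moreover have "((\<lambda>h. flat_exp m h / h) \<longlongrightarrow> 0) (at_left 0)"
    proof (rule Lim_transform_eventually[OF tendsto_const])
      show "\<forall>\<^sub>F x in at_left 0. 0 = flat_exp m x / x"
        unfolding eventually_at_filter by (simp add: flat_exp_def)
    qed
    ultimately have "((\<lambda>h. flat_exp m h / h) \<longlongrightarrow> 0) (at 0)"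
      by (simp add: filterlim_split_at)
    then show ?thesis using 3 by (simp add: DERIV_def flat_exp_def)
  qed
qed

text \<open>The squared distance keeps the argument polynomial, so the centre is no exception to
  smoothness. With s = r^2 the support is the closed ball of radius r around a.\<close>

definition bump :: "nat \<Rightarrow> real \<Rightarrow> real^'n::finite \<Rightarrow> real^'n \<Rightarrow> real" where
  "bump m s a x = flat_exp m (s - (x - a) \<bullet> (x - a))"

text \<open>An algebra of functions that is closed under \<open>partial\<close>, so that its members are smooth.\<close>

inductive bump_alg :: "(real^'n::finite \<Rightarrow> real) \<Rightarrow> bool" where
  const: "bump_alg (\<lambda>x. c)"
| coord: "bump_alg (\<lambda>x. x $ i)"
| bump: "bump_alg (bump m s a)"
| add: "bump_alg f \<Longrightarrow> bump_alg h \<Longrightarrow> bump_alg (\<lambda>x. f x + h x)"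
| mult: "bump_alg f \<Longrightarrow> bump_alg h \<Longrightarrow> bump_alg (\<lambda>x. f x * h x)"

lemma bump_has_derivative:
  "(bump m s a has_derivative (\<lambda>v. - 2 * (bump (m + 2) s a x - real m * bump (m + 1) s a x) * ((x - a) \<bullet> v))) (at x)"
proof -
  have "((\<lambda>x. s - (x - a) \<bullet> (x - a)) has_derivative (\<lambda>v. - 2 * ((x - a) \<bullet> v))) (at x)"
    by (auto intro!: derivative_eq_intros simp: inner_commute fun_eq_iff)
  from has_derivative_compose[OF this flat_exp_has_derivative[of m, unfolded has_field_derivative_def]]
  show ?thesis unfolding bump_def by (rule has_derivative_eq_rhs) (simp add: fun_eq_iff algebra_simps)
qed

lemma partial_eqI: "(f has_derivative f') (at x) \<Longrightarrow> partial i f x = f' (axis i 1)"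
  unfolding partial_def using frechet_derivative_at by metis

lemma bump_alg_has_derivative:
  assumes "bump_alg f"
  shows "\<exists>D. (\<forall>x. (f has_derivative (\<lambda>v. \<Sum>i\<in>UNIV. v $ i * D i x)) (at x)) \<and> (\<forall>i. bump_alg (D i))"
  using assms
proof induction
  case (const c)
  show ?case by (rule exI[of _ "\<lambda>i x. 0"]) (auto intro: bump_alg.const)
next
  case (coord k)
  have "((\<lambda>x::real^_. x $ k) has_derivative (\<lambda>v. \<Sum>i\<in>UNIV. v $ i * (if i = k then 1 else 0))) (at x)" for x
    by (rule has_derivative_eq_rhs[OF bounded_linear_imp_has_derivative[OF bounded_linear_vec_nth]])
      (simp add: mult_delta_right)
  then show ?case
    by (intro exI[of _ "\<lambda>i x. if i = k then 1 else 0"]) (auto intro: bump_alg.const)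
next
  case (bump m s a)
  \<comment> \<open>Written with sums, products and constants only, to match the closure rules of
    \<open>bump_alg\<close>.\<close>
  define D where "D i x = (x $ i + (- a $ i)) * (- 2 * (bump (m + 2) s a x + (- real m) * bump (m + 1) s a x))" for i x
  have "bump_alg (D i)" for i
    unfolding D_def by (intro bump_alg.intros)
  moreover have "(bump m s a has_derivative (\<lambda>v. \<Sum>i\<in>UNIV. v $ i * D i x)) (at x)" for x
    using bump_has_derivative[of m s a x]
    by (rule has_derivative_eq_rhs)
      (simp add: fun_eq_iff D_def inner_vec_def sum_distrib_left algebra_simps flip: sum.distrib sum_subtractf)
  ultimately show ?case by blast
next
  case (add f h)
  then obtain D E where D: "\<And>x. (f has_derivative (\<lambda>v. \<Sum>i\<in>UNIV. v $ i * D i x)) (at x)" "\<And>i. bump_alg (D i)"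
    and E: "\<And>x. (h has_derivative (\<lambda>v. \<Sum>i\<in>UNIV. v $ i * E i x)) (at x)" "\<And>i. bump_alg (E i)"
    by blast
  have "((\<lambda>x. f x + h x) has_derivative (\<lambda>v. \<Sum>i\<in>UNIV. v $ i * (D i x + E i x))) (at x)" for x
    using has_derivative_add[OF D(1) E(1)] by (simp add: sum.distrib algebra_simps)
  then show ?case
    by (intro exI[of _ "\<lambda>i x. D i x + E i x"]) (auto intro: bump_alg.add D E)
next
  case (mult f h)
  then obtain D E where D: "\<And>x. (f has_derivative (\<lambda>v. \<Sum>i\<in>UNIV. v $ i * D i x)) (at x)" "\<And>i. bump_alg (D i)"
    and E: "\<And>x. (h has_derivative (\<lambda>v. \<Sum>i\<in>UNIV. v $ i * E i x)) (at x)" "\<And>i. bump_alg (E i)"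
    by blast
  have "((\<lambda>x. f x * h x) has_derivative (\<lambda>v. \<Sum>i\<in>UNIV. v $ i * (f x * E i x + D i x * h x))) (at x)" for x
    by (rule has_derivative_eq_rhs[OF has_derivative_mult[OF D(1) E(1)]])
      (simp add: fun_eq_iff sum.distrib algebra_simps sum_distrib_left sum_distrib_right)
  then show ?case
    by (intro exI[of _ "\<lambda>i x. f x * E i x + D i x * h x"]) (auto intro!: bump_alg.intros D E mult)
qed

lemma bump_alg_differentiable: "bump_alg f \<Longrightarrow> f differentiable (at x)"
  using bump_alg_has_derivative differentiable_def by blast

lemma bump_alg_partial: "bump_alg f \<Longrightarrow> bump_alg (partial i f)"
proof -
  assume "bump_alg f"
  then obtain D where D: "\<And>x. (f has_derivative (\<lambda>v. \<Sum>i\<in>UNIV. v $ i * D i x)) (at x)" "\<And>i. bump_alg (D i)"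
    using bump_alg_has_derivative by blast
  have "partial i f = D i"
    using partial_eqI[OF D(1)] by (auto simp: fun_eq_iff axis_def if_distrib[of "\<lambda>t. t * _"] cong: if_cong)
  then show ?thesis using D by simp
qed

lemma bump_alg_continuous: "bump_alg f \<Longrightarrow> continuous_on S f"
  by (meson bump_alg_differentiable continuous_at_imp_continuous_on differentiable_imp_continuous_within)

lemma bump_alg_smooth:
  assumes "bump_alg f"
  shows "smooth_on S f"
proof -
  have "\<forall>f. bump_alg f \<longrightarrow> Ck_on k f S" for k
    by (induction k) (auto simp: bump_alg_continuous bump_alg_differentiable bump_alg_partial)
  with assms show ?thesis by (simp add: smooth_on_def)
qed

text \<open>Together with reflection this makes \<open>\<phi> (x - y)\<close> a test function in x
  as well as in y.\<close>

lemma bump_alg_shift: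
  assumes "bump_alg f"
  shows "bump_alg (\<lambda>x. f (x - y))"
  using assms
proof induction
  case (coord i)
  show ?case using bump_alg.add[OF bump_alg.coord[of i] bump_alg.const[of "- y $ i"]] by simp
next
  case (bump m s a)
  have "(\<lambda>x. bump m s a (x - y)) = bump m s (y + a)"
    by (simp add: bump_def fun_eq_iff algebra_simps)
  then show ?case by (simp add: bump_alg.bump)
qed (auto intro: bump_alg.intros)

lemma bump_alg_reflect:
  assumes "bump_alg f"
  shows "bump_alg (\<lambda>x. f (- x))"
  using assms
proof induction
  case (coord i)
  show ?case using bump_alg.mult[OF bump_alg.coord[of i] bump_alg.const[of "- 1"]] by simp
next
  case (bump m s a)
  have "(\<lambda>x. bump m s a (- x)) = bump m s (- a)"
    by (simp add: bump_def fun_eq_iff algebra_simps inner_diff_left inner_diff_right)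
  then show ?case by (simp add: bump_alg.bump)
qed (auto intro: bump_alg.intros)

lemma partial_mult:
  assumes "f differentiable (at x)" "h differentiable (at x)"
  shows "partial i (\<lambda>x. f x * h x :: real) x = f x * partial i h x + partial i f x * h x"
  using partial_eqI[OF has_derivative_mult[OF assms[unfolded frechet_derivative_works]], of i]
  by (simp add: partial_def)

lemma partial_shift:
  assumes "\<And>x. f differentiable (at x)"
  shows "partial i (\<lambda>x. f (x - y)) x = partial i f (x - y)"
proof -
  have "((\<lambda>x. x - y) has_derivative (\<lambda>v. v)) (at x)"
    by (auto intro!: derivative_eq_intros)
  from has_derivative_compose[OF this assms[unfolded frechet_derivative_works]]
  show ?thesis by (subst partial_eqI) (auto simp: partial_def)
qed

lemma partial_reflect:
  assumes "\<And>x. f differentiable (at x)"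
  shows "partial i (\<lambda>y. f (x - y)) y = - (partial i f (x - y) :: real)"
proof -
  have "((\<lambda>y. x - y) has_derivative (\<lambda>v. - v)) (at y)"
    by (auto intro!: derivative_eq_intros)
  from has_derivative_compose[OF this assms[unfolded frechet_derivative_works]]
  show ?thesis
    by (subst partial_eqI)
      (auto simp: partial_def linear_frechet_derivative[OF assms] linear_neg)
qed

lemma partial_eq_0_outside:
  assumes "\<And>x. x \<notin> K \<Longrightarrow> f x = 0" "closed K" "x \<notin> K"
  shows "partial i f x = 0"
proof -
  have "((\<lambda>x. 0) has_derivative (\<lambda>v. 0)) (at x)" by simp
  then have "(f has_derivative (\<lambda>v. 0)) (at x)"
    using has_derivative_transform_within_open[of "\<lambda>x. 0" "\<lambda>v. 0" x UNIV "- K" f] assms by auto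
  then show ?thesis by (rule partial_eqI)
qed

lemma bump_nonneg: "bump m s a x \<ge> 0"
  by (simp add: bump_def flat_exp_def)

lemma bump_pos_iff: "r > 0 \<Longrightarrow> bump m (r\<^sup>2) a x > 0 \<longleftrightarrow> dist x a < r"
proof -
  assume r: "r > 0"
  have "0 < r\<^sup>2 - (x - a) \<bullet> (x - a) \<longleftrightarrow> (dist x a)\<^sup>2 < r\<^sup>2"
    by (simp add: dist_norm power2_norm_eq_inner)
  also have "\<dots> \<longleftrightarrow> dist x a < r" using r
    by (meson less_le_not_le linorder_not_le pos2 power2_less_imp_less power_strict_mono zero_le_dist)
  finally show ?thesis by (simp add: bump_def flat_exp_def)
qed

lemma bump_eq_0: "r > 0 \<Longrightarrow> dist x a \<ge> r \<Longrightarrow> bump m (r\<^sup>2) a x = 0"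
  using bump_pos_iff[of r m a x] bump_nonneg[of m "r\<^sup>2" a x] by linarith

lemma partial_bump:
  "partial i (bump m s a) x = - 2 * (bump (m + 2) s a x - real m * bump (m + 1) s a x) * (x $ i - a $ i)"
  by (subst partial_eqI[OF bump_has_derivative]) (simp add: inner_axis)

text \<open>For m = 0 the gradient is -2 (x - a) times \<open>bump 2\<close>, and one further
  product rule gives an expression symmetric in i and j. This symmetry is the cancellation behind
  the integration by parts.\<close>

lemma partial_partial_bump_commute:
  "partial i (partial j (bump 0 s a)) x = partial j (partial i (bump 0 s a)) x"
proof -
  have eq: "partial j (bump 0 s a) = (\<lambda>x. - (2 * bump 2 s a x) * (x $ j - a $ j))" for j
    using partial_bump[of j 0 s a] by (simp add: fun_eq_iff numeral_2_eq_2)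
  have d: "bump_alg (\<lambda>x. x $ j - a $ j)" "bump_alg (\<lambda>x. - (2 * bump 2 s a x))" for j
    using bump_alg.add[OF bump_alg.coord[of j] bump_alg.const[of "- a $ j"]]
      bump_alg.mult[OF bump_alg.const[of "- 2"] bump_alg.bump[of 2 s a]] by auto
  have c: "partial i (\<lambda>x. x $ j - a $ j) x = (if i = j then 1 else 0)" for i j
    by (subst partial_eqI[where f' = "\<lambda>v. v $ j"])
      (auto intro!: derivative_eq_intros bounded_linear_imp_has_derivative bounded_linear_vec_nth simp: axis_def)
  have b: "partial i (\<lambda>x. - (2 * bump 2 s a x)) x = - (2 * partial i (bump 2 s a) x)" for i
    using partial_mult[of "\<lambda>x. - 2" x "bump 2 s a" i]
    by (simp add: bump_alg_differentiable bump_alg.intros partial_eqI[OF has_derivative_const])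
  show ?thesis
    unfolding eq by (subst (1 2) partial_mult) (auto simp: bump_alg_differentiable d c b partial_bump)
qed

lemma test_functionI:
  "bump_alg f \<Longrightarrow> compact K \<Longrightarrow> K \<subseteq> S \<Longrightarrow> (\<And>x. x \<notin> K \<Longrightarrow> f x = 0) \<Longrightarrow> test_function S f"
  unfolding test_function_def using bump_alg_smooth by blast

section \<open>Mollification and weak derivatives\<close>

text \<open>Young's inequality with a free weight d: a product with the gradient may cost as small a
  multiple of the squared gradient as desired.\<close>

lemma abs_mult_le_squares:
  fixes a b d :: real
  assumes "d > 0"
  shows "\<bar>a * b\<bar> \<le> d / 2 * a\<^sup>2 + 1 / (2 * d) * b\<^sup>2"
proof -
  have "0 \<le> (d * \<bar>a\<bar> - \<bar>b\<bar>)\<^sup>2" by simp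
  then have "2 * d * (\<bar>a\<bar> * \<bar>b\<bar>) \<le> d\<^sup>2 * a\<^sup>2 + b\<^sup>2"
    by (simp add: power2_eq_square algebra_simps)
  then show ?thesis using assms
    by (simp add: field_simps power2_eq_square abs_mult)
qed

lemma integrable_mult_L2:
  fixes A B :: "'a \<Rightarrow> real"
  assumes [measurable]: "A \<in> borel_measurable M" "B \<in> borel_measurable M"
    and "integrable M (\<lambda>x. (A x)\<^sup>2)" "integrable M (\<lambda>x. (B x)\<^sup>2)"
  shows "integrable M (\<lambda>x. A x * B x)"
proof (rule Bochner_Integration.integrable_bound)
  show "integrable M (\<lambda>x. 1 / 2 * (A x)\<^sup>2 + 1 / (2 * 1) * (B x)\<^sup>2)"
    using assms by simp
  show "AE x in M. norm (A x * B x) \<le> norm (1 / 2 * (A x)\<^sup>2 + 1 / (2 * 1) * (B x)\<^sup>2)"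
    using abs_mult_le_squares[of 1 "A _" "B _"] by (auto intro!: AE_I2 order_trans[OF _ abs_ge_self])
qed simp

text \<open>A weighted sum in place of the product of norms in Cauchy-Schwarz, which keeps square
  roots of integrals out of the estimates.\<close>

lemma abs_integral_mult_le:
  fixes A B :: "'a \<Rightarrow> real"
  assumes [measurable]: "A \<in> borel_measurable M" "B \<in> borel_measurable M"
    and AB: "integrable M (\<lambda>x. (A x)\<^sup>2)" "integrable M (\<lambda>x. (B x)\<^sup>2)" and "d > 0"
  shows "\<bar>\<integral>x. A x * B x \<partial>M\<bar> \<le> d / 2 * (\<integral>x. (A x)\<^sup>2 \<partial>M) + 1 / (2 * d) * (\<integral>x. (B x)\<^sup>2 \<partial>M)"
proof -
  have "\<bar>\<integral>x. A x * B x \<partial>M\<bar> \<le> (\<integral>x. \<bar>A x * B x\<bar> \<partial>M)"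
    by (rule integral_abs_bound)
  also have "\<dots> \<le> (\<integral>x. d / 2 * (A x)\<^sup>2 + 1 / (2 * d) * (B x)\<^sup>2 \<partial>M)"
    using AB integrable_mult_L2[of A M B] abs_mult_le_squares[OF \<open>d > 0\<close>]
    by (intro integral_mono) auto
  also have "\<dots> = d / 2 * (\<integral>x. (A x)\<^sup>2 \<partial>M) + 1 / (2 * d) * (\<integral>x. (B x)\<^sup>2 \<partial>M)"
    using AB by simp
  finally show ?thesis .
qed

section \<open>Approximation and translation in L2\<close>

lemma
  fixes f :: "'a::euclidean_space \<Rightarrow> real"
  assumes "f \<in> borel_measurable borel"
  shows integrable_lborel_translate: "integrable lborel (\<lambda>x. f (x + z)) \<longleftrightarrow> integrable lborel f"
    and integral_lborel_translate: "(LBINT x. f (x + z)) = (LBINT x. f x)"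
proof -
  have m: "(+) z \<in> borel_measurable lborel" by simp
  show "integrable lborel (\<lambda>x. f (x + z)) \<longleftrightarrow> integrable lborel f"
    using integrable_distr_eq[OF m assms] by (simp add: lborel_distr_plus add.commute)
  show "(LBINT x. f (x + z)) = (LBINT x. f x)"
    using integral_distr[OF m assms] by (simp add: lborel_distr_plus add.commute)
qed

lemma AE_lborel_negligible: "negligible N \<Longrightarrow> AE x in lborel. x \<notin> N"
  by (metis AE_completion_iff AE_not_in negligible_iff_null_sets)

text \<open>Truncation in value and in space gives a bounded function of bounded support, close to B
  by dominated convergence with bound B^2. That function is an almost everywhere limit of continuous
  functions; clamped and cut off, they converge in L2 by dominated convergence again.\<close>

lemma L2_approx_continuous:
  fixes B :: "'a::euclidean_space \<Rightarrow> real"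
  assumes [measurable]: "B \<in> borel_measurable borel" and B2: "integrable lborel (\<lambda>x. (B x)\<^sup>2)" and "e > 0"
  obtains g R where "continuous_on UNIV g" "\<And>x. norm x > R \<Longrightarrow> g x = 0"
    "integrable lborel (\<lambda>x. (B x - g x)\<^sup>2)" "(LBINT x. (B x - g x)\<^sup>2) < e"
proof -
  define cl where "cl n t = max (- real n) (min (real n) t)" for n t
  have cl_cont: "continuous_on S (cl n)" for n S unfolding cl_def by (intro continuous_intros)
  have cl_bd: "\<bar>cl n t\<bar> \<le> real n" "\<bar>cl n t\<bar> \<le> \<bar>t\<bar>" "\<bar>t - cl n t\<bar> \<le> \<bar>t\<bar>" for n t unfolding cl_def by auto
  have cl_m[measurable]: "cl n \<in> borel_measurable borel" for n unfolding cl_def by measurable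
  define T where "T n x = (if norm x \<le> real n then cl n (B x) else 0)" for n x
  have T_m[measurable]: "T n \<in> borel_measurable borel" for n unfolding T_def by measurable
  have "(\<lambda>n. (LBINT x. (B x - T n x)\<^sup>2)) \<longlonglongrightarrow> (\<integral>x. 0 \<partial>(lborel::'a measure))"
  proof (rule integral_dominated_convergence[where w = "\<lambda>x. (B x)\<^sup>2"])
    show "AE x in lborel. (\<lambda>n. (B x - T n x)\<^sup>2) \<longlonglongrightarrow> 0"
    proof (rule AE_I2)
      fix x
      obtain n0 where n0: "norm x + \<bar>B x\<bar> \<le> real n0" using real_arch_simple by blast
      have "T n x = B x" if "n \<ge> n0" for n
      proof -
        have "real n0 \<le> real n" using that by simp
        with n0 norm_ge_zero[of x] have "norm x \<le> n" "\<bar>B x\<bar> \<le> n" by linarith+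
        then show ?thesis unfolding T_def cl_def by (auto simp: abs_le_iff)
      qed
      then have "eventually (\<lambda>n. 0 = (B x - T n x)\<^sup>2) sequentially"
        unfolding eventually_sequentially by (intro exI[of _ n0]) auto
      then show "(\<lambda>n. (B x - T n x)\<^sup>2) \<longlonglongrightarrow> 0"
        by (rule Lim_transform_eventually[OF tendsto_const])
    qed
    show "AE x in lborel. norm ((B x - T n x)\<^sup>2) \<le> (B x)\<^sup>2" for n
      by (rule AE_I2) (auto simp: T_def abs_le_square_iff[symmetric] cl_bd)
  qed (use B2 in auto)
  then have "eventually (\<lambda>n. (LBINT x. (B x - T n x)\<^sup>2) < e / 4) sequentially"
    using \<open>e > 0\<close> by (intro order_tendstoD(2)) auto
  then obtain n where n: "(LBINT x. (B x - T n x)\<^sup>2) < e / 4"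
    by (auto simp: eventually_sequentially)
  have n_int: "integrable lborel (\<lambda>x. (B x - T n x)\<^sup>2)"
    by (rule Bochner_Integration.integrable_bound[OF B2])
      (auto intro!: AE_I2 simp: T_def abs_le_square_iff[symmetric] cl_bd)
  \<comment> \<open>Unfolding \<open>measurable_on\<close> supplies continuous functions
    \<open>G k\<close> that converge off a negligible set.\<close>
  have "T n measurable_on UNIV"
    by (rule lebesgue_measurable_imp_measurable_on) (auto intro: measurable_completion)
  then obtain N G where N: "negligible N" and G: "\<And>k. continuous_on UNIV (G k)"
    "\<And>x. x \<notin> N \<Longrightarrow> (\<lambda>k. G k x) \<longlonglongrightarrow> T n x"
    unfolding measurable_on_def by auto
  \<comment> \<open>A continuous cutoff that is 1 where \<open>T n\<close> may be nonzero and 0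
    outside the ball of radius n + 1; together with the clamp it yields the bound w, independent of
    k.\<close>
  define cut where "cut x = max 0 (min 1 (real n + 1 - norm x))" for x :: 'a
  define H where "H k x = cl n (G k x) * cut x" for k x
  have cut: "0 \<le> cut x" "cut x \<le> 1" "norm x \<le> n \<Longrightarrow> cut x = 1" "norm x > real n + 1 \<Longrightarrow> cut x = 0" for x
    unfolding cut_def by auto
  have H_cont: "continuous_on UNIV (H k)" for k
    unfolding H_def cut_def using G(1)
    by (intro continuous_intros continuous_on_compose2[OF cl_cont[of UNIV]]) auto
  have [measurable]: "H k \<in> borel_measurable borel" for k
    using H_cont by (rule borel_measurable_continuous_onI)
  define w where "w x = (2 * real n)\<^sup>2 * indicator (cball 0 (real n + 1)) x" for x :: 'a
  have w_int: "integrable lborel w"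
    unfolding w_def by (intro integrable_mult_right integrable_real_indicator) (simp_all add: emeasure_lborel_cball_finite[unfolded infinity_ennreal_def])
  have bd: "(T n x - H k x)\<^sup>2 \<le> w x" for k x
  proof (cases "norm x \<le> real n + 1")
    case True
    have "\<bar>T n x\<bar> \<le> real n" unfolding T_def using cl_bd(1)[of n] by auto
    moreover have "\<bar>H k x\<bar> \<le> real n"
      unfolding H_def abs_mult using mult_mono[OF cl_bd(1)[of n "G k x"] cut(2)[of x]] cut(1)[of x] by auto
    ultimately have "\<bar>T n x - H k x\<bar> \<le> \<bar>2 * real n\<bar>" by auto
    then have "(T n x - H k x)\<^sup>2 \<le> (2 * real n)\<^sup>2" by (simp only: abs_le_square_iff)
    then show ?thesis using True unfolding w_def by simp
  next
    case False
    then show ?thesis unfolding T_def H_def w_def using cut(4)[of x] by auto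
  qed
  have Hint: "integrable lborel (\<lambda>x. (T n x - H k x)\<^sup>2)" for k
    by (rule Bochner_Integration.integrable_bound[OF w_int])
      (use bd in \<open>auto intro!: AE_I2 order_trans[OF _ abs_ge_self]\<close>)
  have "(\<lambda>k. (LBINT x. (T n x - H k x)\<^sup>2)) \<longlonglongrightarrow> (\<integral>x. 0 \<partial>(lborel::'a measure))"
  proof (rule integral_dominated_convergence[OF _ _ w_int])
    show "AE x in lborel. norm ((T n x - H k x)\<^sup>2) \<le> w x" for k
      using bd by (auto intro: AE_I2)
    show "AE x in lborel. (\<lambda>k. (T n x - H k x)\<^sup>2) \<longlonglongrightarrow> 0"
      using AE_lborel_negligible[OF N]
    proof eventually_elim
      fix x assume "x \<notin> N"
      have "isCont (cl n) (T n x)" using cl_cont[of UNIV n] continuous_on_eq_continuous_at by blast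
      then have "(\<lambda>k. cl n (G k x)) \<longlonglongrightarrow> cl n (T n x)"
        using G(2)[OF \<open>x \<notin> N\<close>] by (rule isCont_tendsto_compose)
      then have "(\<lambda>k. H k x) \<longlonglongrightarrow> cl n (T n x) * cut x"
        unfolding H_def by (intro tendsto_mult tendsto_const)
      also have "cl n (T n x) * cut x = T n x"
        using cut(3)[of x] by (auto simp: T_def cl_def)
      finally have "(\<lambda>k. (T n x - H k x)\<^sup>2) \<longlonglongrightarrow> (T n x - T n x)\<^sup>2"
        by (intro tendsto_intros)
      then show "(\<lambda>k. (T n x - H k x)\<^sup>2) \<longlonglongrightarrow> 0" by simp
    qed
  qed auto
  then have "eventually (\<lambda>k. (LBINT x. (T n x - H k x)\<^sup>2) < e / 4) sequentially"
    using \<open>e > 0\<close> by (intro order_tendstoD(2)) auto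
  then obtain k where k: "(LBINT x. (T n x - H k x)\<^sup>2) < e / 4"
    by (auto simp: eventually_sequentially)
  \<comment> \<open>Two errors below e / 4 give one below e, since (a + b)^2 \<le> 2 a^2 + 2
    b^2.\<close>
  have le: "(B x - H k x)\<^sup>2 \<le> 2 * (B x - T n x)\<^sup>2 + 2 * (T n x - H k x)\<^sup>2" for x
    using sum_squares_bound[of "B x - T n x" "T n x - H k x"] by (simp add: power2_eq_square algebra_simps)
  have int: "integrable lborel (\<lambda>x. (B x - H k x)\<^sup>2)"
    by (rule Bochner_Integration.integrable_bound[of _ "\<lambda>x. 2 * (B x - T n x)\<^sup>2 + 2 * (T n x - H k x)\<^sup>2"])
      (use n_int Hint[of k] le in \<open>auto intro!: AE_I2 order_trans[OF _ abs_ge_self]\<close>)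
  have "(LBINT x. (B x - H k x)\<^sup>2) \<le> (LBINT x. 2 * (B x - T n x)\<^sup>2 + 2 * (T n x - H k x)\<^sup>2)"
    using int n_int Hint le by (intro integral_mono) auto
  also have "\<dots> = 2 * (LBINT x. (B x - T n x)\<^sup>2) + 2 * (LBINT x. (T n x - H k x)\<^sup>2)"
    using n_int Hint by simp
  also have "\<dots> < e" using n k by simp
  finally show ?thesis
    using that[OF H_cont[of k] _ int, of "real n + 1"] cut(4) by (simp add: H_def)
qed

text \<open>A continuous g of bounded support is uniformly continuous, so it moves little in L2
  under small shifts. The distance from B to g is the same before and after a shift, because
  Lebesgue measure is translation invariant.\<close>

lemma L2_translation_continuous:
  fixes B :: "'a::euclidean_space \<Rightarrow> real"
  assumes [measurable]: "B \<in> borel_measurable borel" and B2: "integrable lborel (\<lambda>x. (B x)\<^sup>2)" and "e > 0"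
  obtains d where "d > 0" "\<And>z. norm z < d \<Longrightarrow> integrable lborel (\<lambda>x. (B (x + z) - B x)\<^sup>2)"
    "\<And>z. norm z < d \<Longrightarrow> (LBINT x. (B (x + z) - B x)\<^sup>2) < e"
proof -
  \<comment> \<open>The 9 accounts for three errors, each tripled by (a + b + c)^2 \<le> 3 (a^2 +
    b^2 + c^2).\<close>
  obtain g R where g: "continuous_on UNIV g" "\<And>x. norm x > R \<Longrightarrow> g x = 0"
    "integrable lborel (\<lambda>x. (B x - g x)\<^sup>2)" "(LBINT x. (B x - g x)\<^sup>2) < e / 9"
    using L2_approx_continuous[OF assms(1) B2, of "e / 9"] \<open>e > 0\<close> by auto
  have [measurable]: "g \<in> borel_measurable borel"
    using g(1) by (rule borel_measurable_continuous_onI)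
  define V where "V = measure lborel (cball (0::'a) (R + 1))"
  \<comment> \<open>Chosen so that 9 t^2 V = e V / (2 (V + 1)) < e; V + 1 avoids a division by
    zero.\<close>
  define t where "t = sqrt (e / (18 * (V + 1)))"
  have "V \<ge> 0" unfolding V_def by simp
  then have t: "t > 0" "9 * (t\<^sup>2 * V) < e"
    using \<open>e > 0\<close> unfolding t_def by (auto simp: field_simps add_strict_increasing)
  \<comment> \<open>Shifts will be shorter than 1, so the difference of g and its shift vanishes
    beyond R + 1, and both points stay within R + 2 otherwise.\<close>
  have "uniformly_continuous_on (cball 0 (R + 2)) g"
    using g(1) by (intro compact_uniformly_continuous continuous_on_subset[OF g(1)]) auto
  then obtain d where d: "d > 0" "\<And>x y. x \<in> cball 0 (R + 2) \<Longrightarrow> y \<in> cball 0 (R + 2) \<Longrightarrow> dist y x < d \<Longrightarrow> dist (g y) (g x) < t"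
    unfolding uniformly_continuous_on_def using t(1) by meson
  have gd: "(g (x + z) - g x)\<^sup>2 \<le> t\<^sup>2 * indicator (cball 0 (R + 1)) x" if z: "norm z < min d 1" for x z
  proof (cases "norm x \<le> R + 1")
    case True
    have "norm (x + z) \<le> R + 2" using norm_triangle_ineq[of x z] True z by linarith
    then have "\<bar>g (x + z) - g x\<bar> \<le> \<bar>t\<bar>"
      using d(2)[of x "x + z"] z True t(1) by (auto simp: dist_norm[of "x + z" x] dist_real_def)
    then show ?thesis using True by (simp add: abs_le_square_iff)
  next
    case False
    have "norm x \<le> norm (x + z) + norm z" using norm_triangle_ineq4[of "x + z" z] by simp
    then have "norm (x + z) > R" using False z by linarith
    then show ?thesis using False g(2)[of x] g(2)[of "x + z"] by simp
  qed
  have ind: "integrable lborel (\<lambda>x. t\<^sup>2 * indicator (cball (0::'a) (R + 1)) x)"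
    by (intro integrable_mult_right integrable_real_indicator) (simp_all add: emeasure_lborel_cball_finite[unfolded infinity_ennreal_def])
  have gi: "integrable lborel (\<lambda>x. (g (x + z) - g x)\<^sup>2)" if z: "norm z < min d 1" for z
    by (rule Bochner_Integration.integrable_bound[OF ind])
      (use gd[OF z] in \<open>auto intro!: AE_I2 order_trans[OF _ abs_ge_self]\<close>)
  have "(LBINT x. (g (x + z) - g x)\<^sup>2) \<le> t\<^sup>2 * V" if z: "norm z < min d 1" for z
    using integral_mono[OF gi[OF z] ind gd[OF z]] unfolding V_def by simp
  then have gb: "9 * (LBINT x. (g (x + z) - g x)\<^sup>2) < e" if z: "norm z < min d 1" for z
    using z t(2) by fastforce
  have tr: "integrable lborel (\<lambda>x. (B (x + z) - g (x + z))\<^sup>2)"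
    "(LBINT x. (B (x + z) - g (x + z))\<^sup>2) = (LBINT x. (B x - g x)\<^sup>2)" for z
    using integrable_lborel_translate[of "\<lambda>x. (B x - g x)\<^sup>2" z]
      integral_lborel_translate[of "\<lambda>x. (B x - g x)\<^sup>2" z] g(3) by auto
  have three: "(a + b + c)\<^sup>2 \<le> 3 * (a\<^sup>2 + b\<^sup>2 + c\<^sup>2)" for a b c :: real
    using sum_squares_bound[of a b] sum_squares_bound[of a c] sum_squares_bound[of b c]
    by (simp add: power2_eq_square algebra_simps)
  define W where "W z x = 3 * ((B (x + z) - g (x + z))\<^sup>2 + (g (x + z) - g x)\<^sup>2 + (B x - g x)\<^sup>2)" for z x
  have le: "(B (x + z) - B x)\<^sup>2 \<le> W z x" for x z
    using three[of "B (x + z) - g (x + z)" "g (x + z) - g x" "- (B x - g x)"] power2_commute[of "B x" "g x"]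
    unfolding W_def by simp
  have Wi: "integrable lborel (W z)" if "norm z < min d 1" for z
    unfolding W_def using tr gi[OF that] g(3) by auto
  have main: "integrable lborel (\<lambda>x. (B (x + z) - B x)\<^sup>2) \<and> (LBINT x. (B (x + z) - B x)\<^sup>2) < e"
    if z: "norm z < min d 1" for z
  proof
    show i: "integrable lborel (\<lambda>x. (B (x + z) - B x)\<^sup>2)"
      by (rule Bochner_Integration.integrable_bound[OF Wi[OF z]])
        (use le in \<open>auto intro!: AE_I2 order_trans[OF _ abs_ge_self]\<close>)
    have "(LBINT x. (B (x + z) - B x)\<^sup>2) \<le> (LBINT x. W z x)"
      by (rule integral_mono[OF i Wi[OF z] le])
    also have "\<dots> = 3 * ((LBINT x. (B x - g x)\<^sup>2) + (LBINT x. (g (x + z) - g x)\<^sup>2) + (LBINT x. (B x - g x)\<^sup>2))"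
      unfolding W_def using tr gi[OF z] g(3) by simp
    also have "\<dots> < e" using gb[OF z] g(4) by simp
    finally show "(LBINT x. (B (x + z) - B x)\<^sup>2) < e" .
  qed
  show ?thesis
    by (rule that[of "min d 1"]) (use d(1) main in auto)
qed

text \<open>The change from shift 0 to shift z is the integral of A against
  \<open>B (x + z) - B x\<close>, which is small in L2.\<close>

lemma isCont_correlation:
  fixes A B :: "'a::euclidean_space \<Rightarrow> real"
  assumes [measurable]: "A \<in> borel_measurable borel" "B \<in> borel_measurable borel"
    and A2: "integrable lborel (\<lambda>x. (A x)\<^sup>2)" and B2: "integrable lborel (\<lambda>x. (B x)\<^sup>2)"
  shows "isCont (\<lambda>z. (LBINT x. A x * B (x + z))) 0"
proof -
  have Bz: "integrable lborel (\<lambda>x. (B (x + z))\<^sup>2)" for z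
    using integrable_lborel_translate[of "\<lambda>x. (B x)\<^sup>2" z] B2 by simp
  have ABz: "integrable lborel (\<lambda>x. A x * B (x + z))" for z
    by (rule integrable_mult_L2) (use A2 Bz in auto)
  show ?thesis
    unfolding isCont_def
  proof (rule LIM_I)
    fix e :: real assume "e > 0"
    define I where "I = (LBINT x. (A x)\<^sup>2)"
    have "I \<ge> 0" unfolding I_def by simp
    \<comment> \<open>With this weight each half of Young's bound stays below e / 2.\<close>
    define d where "d = e / (I + 1)"
    have d: "d > 0" unfolding d_def using \<open>e > 0\<close> \<open>I \<ge> 0\<close> by simp
    have "d * (I + 1) = e" unfolding d_def using \<open>I \<ge> 0\<close> by simp
    then have dI: "d * I < e" using d by (simp add: algebra_simps)
    have "d * e > 0" using d \<open>e > 0\<close> by simp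
    then obtain s where s: "s > 0" "\<And>z. norm z < s \<Longrightarrow> integrable lborel (\<lambda>x. (B (x + z) - B x)\<^sup>2)"
      "\<And>z. norm z < s \<Longrightarrow> (LBINT x. (B (x + z) - B x)\<^sup>2) < d * e"
      by (rule L2_translation_continuous[OF assms(2) B2, of "d * e"]) blast
    show "\<exists>s>0. \<forall>z. z \<noteq> 0 \<and> norm (z - 0) < s \<longrightarrow>
      norm ((LBINT x. A x * B (x + z)) - (LBINT x. A x * B (x + 0))) < e"
    proof (intro exI[of _ s] conjI allI impI s(1))
      fix z :: 'a assume "z \<noteq> 0 \<and> norm (z - 0) < s"
      then have z: "norm z < s" by simp
      have "\<bar>(LBINT x. A x * B (x + z)) - (LBINT x. A x * B (x + 0))\<bar>
          = \<bar>(LBINT x. A x * (B (x + z) - B x))\<bar>"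
        using ABz[of z] ABz[of 0] by (simp add: right_diff_distrib)
      also have "\<dots> \<le> d / 2 * I + 1 / (2 * d) * (LBINT x. (B (x + z) - B x)\<^sup>2)"
        unfolding I_def by (rule abs_integral_mult_le) (use A2 s(2)[OF z] d in auto)
      also have "\<dots> < d / 2 * I + 1 / (2 * d) * (d * e)"
        using s(3)[OF z] d by (intro add_strict_left_mono mult_strict_left_mono) auto
      also have "\<dots> \<le> e" using d dI by simp
      finally show "norm ((LBINT x. A x * B (x + z)) - (LBINT x. A x * B (x + 0))) < e"
        by simp
    qed
  qed
qed

section \<open>Convolution integrals of functions in L1 and L2\<close>

definition L12 :: "('a::euclidean_space \<Rightarrow> real) \<Rightarrow> bool" where
  "L12 A \<longleftrightarrow> A \<in> borel_measurable borel \<and> integrable lborel A \<and> integrable lborel (\<lambda>x. (A x)\<^sup>2)"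

lemma abs_mult_bounded:
  fixes A b m :: real
  assumes "\<bar>b\<bar> \<le> m"
  shows "\<bar>A * b\<bar> \<le> \<bar>m * A\<bar>"
proof -
  have "\<bar>A\<bar> * \<bar>b\<bar> \<le> \<bar>A\<bar> * \<bar>m\<bar>" using assms by (intro mult_left_mono) auto
  then show ?thesis by (simp only: abs_mult mult.commute)
qed

lemma integrable_mult_bounded:
  fixes A b :: "'a \<Rightarrow> real"
  assumes "integrable M A" and b: "b \<in> borel_measurable M" and bd: "\<And>x. \<bar>b x\<bar> \<le> m"
  shows "integrable M (\<lambda>x. A x * b x)"
proof (rule Bochner_Integration.integrable_bound)
  show "integrable M (\<lambda>x. m * A x)" using assms(1) by (rule integrable_mult_right)
  show "(\<lambda>x. A x * b x) \<in> borel_measurable M"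
    by (rule borel_measurable_times[OF borel_measurable_integrable[OF assms(1)] b])
  show "AE x in M. norm (A x * b x) \<le> norm (m * A x)"
    unfolding real_norm_def by (intro AE_I2 abs_mult_bounded bd)
qed

lemma L12_mult_bounded:
  assumes "L12 A" and b: "b \<in> borel_measurable borel" and bd: "\<And>x. \<bar>b x\<bar> \<le> m"
  shows "L12 (\<lambda>x. A x * b x)"
proof -
  have A: "integrable lborel A" "integrable lborel (\<lambda>x. (A x)\<^sup>2)" "A \<in> borel_measurable borel"
    using assms by (auto simp: L12_def)
  have "integrable lborel (\<lambda>x. A x * b x)"
    using integrable_mult_bounded[OF A(1) _ bd] b by simp
  moreover have "integrable lborel (\<lambda>x. (A x)\<^sup>2 * (b x)\<^sup>2)"
  proof (rule integrable_mult_bounded[OF A(2)])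
    show "(\<lambda>x. (b x)\<^sup>2) \<in> borel_measurable lborel" using b by simp
    show "\<bar>(b x)\<^sup>2\<bar> \<le> m\<^sup>2" for x using power_mono[OF bd[of x], of 2] by simp
  qed
  ultimately show ?thesis using A b by (simp add: L12_def power_mult_distrib)
qed

text \<open>The product of two L1 functions in separate variables is integrable on the product
  space, and a bounded kernel preserves this. It justifies Fubini for the derivatives of the
  mollifier.\<close>

lemma integrable_convolution_kernel:
  fixes A B \<kappa> :: "'a::euclidean_space \<Rightarrow> real"
  assumes A: "integrable lborel A" and B: "integrable lborel B"
    and [measurable]: "\<kappa> \<in> borel_measurable borel" and bd: "\<And>x. \<bar>\<kappa> x\<bar> \<le> m"
  shows "integrable (lborel \<Otimes>\<^sub>M lborel) (\<lambda>(x, y). A x * B y * \<kappa> (x - y))"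
proof -
  have [measurable]: "A \<in> borel_measurable borel" "B \<in> borel_measurable borel"
    using A B by auto
  have "integrable (lborel \<Otimes>\<^sub>M lborel) (\<lambda>p. A (fst p) * B (snd p))"
  proof (rule lborel_pair.Fubini_integrable)
    have "integrable lborel (\<lambda>x. \<bar>A x\<bar> * (LBINT y. \<bar>B y\<bar>))"
      using A by (intro integrable_mult_left) simp
    then show "integrable lborel (\<lambda>x. (LBINT y. norm (A (fst (x, y)) * B (snd (x, y)))))"
      using B by (simp add: abs_mult)
  qed (use B in auto)
  from integrable_mult_bounded[OF this, of "\<lambda>p. \<kappa> (fst p - snd p)" m] bd
  show ?thesis by (simp add: case_prod_unfold)
qed

text \<open>The substitution y = x + z and the evenness of \<phi> turn a pairing with a mollified
  function into an average of correlations. The mollification parameter then sits in \<phi> alone,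
  and shrinking the support is governed by continuity of the correlation at 0.\<close>

lemma even_kernel_correlation:
  fixes A B \<phi> :: "'a::euclidean_space \<Rightarrow> real"
  assumes A: "L12 A" and B: "L12 B" and \<phi>: "integrable lborel \<phi>" and even: "\<And>x. \<phi> (- x) = \<phi> x"
  shows "integrable lborel (\<lambda>z. \<phi> z * (LBINT x. A x * B (x + z)))"
    and "(LBINT x. A x * (LBINT y. B y * \<phi> (x - y))) = (LBINT z. \<phi> z * (LBINT x. A x * B (x + z)))"
proof -
  have [measurable]: "A \<in> borel_measurable borel" "B \<in> borel_measurable borel" "\<phi> \<in> borel_measurable borel"
    and A2: "integrable lborel (\<lambda>x. (A x)\<^sup>2)" and B2: "integrable lborel (\<lambda>x. (B x)\<^sup>2)"
    using A B \<phi> by (auto simp: L12_def)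
  have Bz: "integrable lborel (\<lambda>x. (B (x + z))\<^sup>2)" for z
    using integrable_lborel_translate[of "\<lambda>x. (B x)\<^sup>2" z] B2 by simp
  have ABz: "integrable lborel (\<lambda>x. A x * B (x + z))" for z
    by (rule integrable_mult_L2) (use A2 Bz in auto)
  \<comment> \<open>A bound on the inner integrals that is uniform in z, as Fubini requires;
    translation does not change the L2 norm of B.\<close>
  define C where "C = 1 / 2 * (LBINT x. (A x)\<^sup>2) + 1 / (2 * 1) * (LBINT x. (B x)\<^sup>2)"
  have C: "(LBINT x. \<bar>A x * B (x + z)\<bar>) \<le> C" for z
  proof -
    have "(LBINT x. \<bar>A x * B (x + z)\<bar>) = \<bar>(LBINT x. \<bar>A x\<bar> * \<bar>B (x + z)\<bar>)\<bar>"
      by (simp add: abs_mult)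
    also have "\<dots> \<le> 1 / 2 * (LBINT x. \<bar>A x\<bar>\<^sup>2) + 1 / (2 * 1) * (LBINT x. \<bar>B (x + z)\<bar>\<^sup>2)"
      by (rule abs_integral_mult_le) (use A2 Bz in auto)
    also have "\<dots> = C" unfolding C_def using integral_lborel_translate[of "\<lambda>x. (B x)\<^sup>2" z] by simp
    finally show ?thesis .
  qed
  let ?f = "\<lambda>p. \<phi> (fst p) * (A (snd p) * B (snd p + fst p))"
  have int: "integrable (lborel \<Otimes>\<^sub>M lborel) ?f"
  proof (rule lborel_pair.Fubini_integrable)
    have "integrable lborel (\<lambda>z. \<bar>\<phi> z\<bar> * (LBINT x. \<bar>A x * B (x + z)\<bar>))"
      by (rule integrable_mult_bounded[where m = C]) (use \<phi> C in auto)
    then show "integrable lborel (\<lambda>z. (LBINT x. norm (?f (z, x))))"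
      by (simp add: abs_mult)
    show "AE z in lborel. integrable lborel (\<lambda>x. ?f (z, x))"
      using ABz by auto
  qed simp
  show "integrable lborel (\<lambda>z. \<phi> z * (LBINT x. A x * B (x + z)))"
    using lborel_pair.integrable_fst'[OF int] by simp
  have inner: "(LBINT y. B y * \<phi> (x - y)) = (LBINT z. \<phi> z * B (x + z))" for x
    using integral_lborel_translate[of "\<lambda>y. B y * \<phi> (x - y)" x] even by (simp add: add.commute mult.commute)
  have "(LBINT x. A x * (LBINT y. B y * \<phi> (x - y))) = (LBINT x. (LBINT z. \<phi> z * (A x * B (x + z))))"
    unfolding inner mult.left_commute[of "\<phi> _"] by simp
  also have "\<dots> = (LBINT z. (LBINT x. \<phi> z * (A x * B (x + z))))"
    using lborel_pair.Fubini_integral[of "\<lambda>z x. \<phi> z * (A x * B (x + z))"] int by (simp add: case_prod_unfold)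
  finally show "(LBINT x. A x * (LBINT y. B y * \<phi> (x - y))) = (LBINT z. \<phi> z * (LBINT x. A x * B (x + z)))"
    by simp
qed

lemma bump_alg_bounded:
  assumes "bump_alg f" "compact K" "\<And>x. x \<notin> K \<Longrightarrow> f x = 0"
  obtains m where "\<And>x. \<bar>f x\<bar> \<le> m"
proof -
  have "bounded (f ` K)"
    by (intro compact_imp_bounded compact_continuous_image bump_alg_continuous assms)
  then obtain m where "\<And>x. x \<in> K \<Longrightarrow> \<bar>f x\<bar> \<le> m" by (auto simp: bounded_iff)
  then have "\<bar>f x\<bar> \<le> max m 0" for x using assms(3)[of x] by (cases "x \<in> K") fastforce+
  then show ?thesis using that by blast
qed

lemma bump_alg_measurable: "bump_alg f \<Longrightarrow> f \<in> borel_measurable borel"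
  by (intro borel_measurable_continuous_onI bump_alg_continuous)

lemma bump_alg_integrable:
  assumes "bump_alg f" "compact K" "\<And>x. x \<notin> K \<Longrightarrow> f x = 0"
  shows "integrable lborel f"
proof -
  obtain m where m: "\<And>x. \<bar>f x\<bar> \<le> m" using bump_alg_bounded[OF assms] by blast
  have "integrable lborel (indicat_real K)"
    using assms(2) by (intro integrable_real_indicator) (auto simp: emeasure_compact_finite[unfolded infinity_ennreal_def] borel_compact)
  from integrable_mult_bounded[OF this _ m] have "integrable lborel (\<lambda>x. indicat_real K x * f x)"
    using bump_alg_measurable[OF assms(1)] by simp
  moreover have "(\<lambda>x. indicat_real K x * f x) = f" using assms(3) by (auto simp: fun_eq_iff indicator_def)
  ultimately show ?thesis by simp
qed

lemma bump_integral_pos: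
  assumes "r > 0"
  shows "integrable lborel (bump m (r\<^sup>2) (a::real^'n::finite))" and "(LBINT x. bump m (r\<^sup>2) a x) > 0"
proof -
  show int: "integrable lborel (bump m (r\<^sup>2) a)"
    by (rule bump_alg_integrable[where K = "cball a r"])
      (use assms in \<open>auto intro!: bump_alg.bump bump_eq_0 simp: dist_commute\<close>)
  \<comment> \<open>A zero integral would make the bump vanish almost everywhere, hence make an open
    ball negligible.\<close>
  have "(LBINT x. bump m (r\<^sup>2) a x) \<noteq> 0"
  proof
    assume "(LBINT x. bump m (r\<^sup>2) a x) = 0"
    then have "AE x in lborel. bump m (r\<^sup>2) a x = 0"
      using int integral_nonneg_eq_0_iff_AE[OF int] by (simp add: bump_nonneg)
    then have "AE x in lborel. x \<notin> ball a r"
      by eventually_elim (use bump_pos_iff[OF assms, of m a] in \<open>force simp: dist_commute\<close>)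
    then have "emeasure lborel (ball a r) = 0"
      by (subst (asm) AE_iff_measurable[of "ball a r"]) auto
    then have "negligible (ball a r)"
      by (simp add: negligible_iff_emeasure0)
    then show False using open_not_negligible[of "ball a r"] assms by simp
  qed
  moreover have "(LBINT x. bump m (r\<^sup>2) a x) \<ge> 0" by (simp add: bump_nonneg)
  ultimately show "(LBINT x. bump m (r\<^sup>2) a x) > 0" by simp
qed

text \<open>If \<Psi> were positive at 0, continuity would keep it above half of that value on a
  small ball, and the bump of that ball would give a positive integral. It is applied to \<Psi> and
  to -\<Psi>.\<close>

lemma approximate_identity_nonpos:
  fixes \<Psi> :: "real^'n::finite \<Rightarrow> real"
  assumes cont: "isCont \<Psi> 0" and "R > 0"
    and int: "\<And>r. 0 < r \<Longrightarrow> r \<le> R \<Longrightarrow> integrable lborel (\<lambda>z. bump 0 (r\<^sup>2) 0 z * \<Psi> z)"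
    and zero: "\<And>r. 0 < r \<Longrightarrow> r \<le> R \<Longrightarrow> (LBINT z. bump 0 (r\<^sup>2) 0 z * \<Psi> z) = 0"
  shows "\<Psi> 0 \<le> 0"
proof (rule ccontr)
  assume "\<not> \<Psi> 0 \<le> 0"
  then have p: "\<Psi> 0 > 0" by simp
  then obtain d where d: "d > 0" "\<And>z. dist z 0 < d \<Longrightarrow> dist (\<Psi> z) (\<Psi> 0) < \<Psi> 0 / 2"
    using cont unfolding continuous_at_eps_delta by (metis half_gt_zero)
  define r where "r = min d R"
  have r: "r > 0" "r \<le> R" "r \<le> d" using d \<open>R > 0\<close> by (auto simp: r_def)
  have "0 < (LBINT z. bump 0 (r\<^sup>2) (0::real^'n) z) * (\<Psi> 0 / 2)"
    using bump_integral_pos(2)[OF r(1), of 0 "0::real^'n"] p by (intro mult_pos_pos) auto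
  also have "\<dots> = (LBINT z. bump 0 (r\<^sup>2) (0::real^'n) z * (\<Psi> 0 / 2))" by simp
  also have "\<dots> \<le> (LBINT z. bump 0 (r\<^sup>2) 0 z * \<Psi> z)"
  proof (rule integral_mono)
    show "bump 0 (r\<^sup>2) 0 z * (\<Psi> 0 / 2) \<le> bump 0 (r\<^sup>2) 0 z * \<Psi> z" for z
    proof (cases "dist z 0 < r")
      case True
      then have "\<bar>\<Psi> z - \<Psi> 0\<bar> < \<Psi> 0 / 2" using d(2)[of z] r by (simp add: dist_real_def)
      then have "\<Psi> 0 / 2 \<le> \<Psi> z" by (simp only: abs_less_iff) linarith
      then show ?thesis by (intro mult_left_mono bump_nonneg)
    next
      case False
      then show ?thesis using bump_eq_0[OF r(1), of z 0 0] by simp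
    qed
    show "integrable lborel (\<lambda>z. bump 0 (r\<^sup>2) (0::real^'n) z * (\<Psi> 0 / 2))"
      using r(1) by (intro integrable_mult_left bump_integral_pos(1))
    show "integrable lborel (\<lambda>z. bump 0 (r\<^sup>2) 0 z * \<Psi> z)" using int r by simp
  qed
  also have "\<dots> = 0" using zero r by simp
  finally show False by simp
qed

text \<open>
  For smooth \<open>f\<close> and \<open>h\<close> this is integration by parts of \<open>\<partial>\<^sub>j f \<partial>\<^sub>k h - \<partial>\<^sub>k f \<partial>\<^sub>j h\<close>, in which the second
  derivatives of \<open>h\<close> cancel.
\<close>

lemma weak_jacobian_identity:
  fixes f h Fj Fk Hj Hk \<eta> :: "real^'n::finite \<Rightarrow> real" and a :: "real^'n"
  assumes L: "L12 f" "L12 h" "L12 Fj" "L12 Fk" "L12 Hj" "L12 Hk"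
    and \<eta>: "bump_alg \<eta>" "\<And>x. x \<notin> cball a r \<Longrightarrow> \<eta> x = 0" and "r < R"
    and weak: "\<And>\<zeta>. bump_alg \<zeta> \<Longrightarrow> (\<And>x. x \<notin> cball a R \<Longrightarrow> \<zeta> x = 0) \<Longrightarrow>
      (LBINT x. f x * partial j \<zeta> x) = - (LBINT x. Fj x * \<zeta> x) \<and>
      (LBINT x. f x * partial k \<zeta> x) = - (LBINT x. Fk x * \<zeta> x) \<and>
      (LBINT x. h x * partial j \<zeta> x) = - (LBINT x. Hj x * \<zeta> x) \<and>
      (LBINT x. h x * partial k \<zeta> x) = - (LBINT x. Hk x * \<zeta> x)"
  shows "(LBINT x. \<eta> x * (Fj x * Hk x - Fk x * Hj x) + f x * (partial j \<eta> x * Hk x - partial k \<eta> x * Hj x)) = 0"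
proof -
  have out: "partial i \<eta> x = 0" if "x \<notin> cball a r" for i x
    using partial_eq_0_outside[OF \<eta>(2) closed_cball that] .
  obtain m where m: "\<And>x. \<bar>\<eta> x\<bar> \<le> m" using bump_alg_bounded[OF \<eta>(1) compact_cball \<eta>(2)] by blast
  obtain mj where mj: "\<And>x. \<bar>partial j \<eta> x\<bar> \<le> mj"
    using bump_alg_bounded[OF bump_alg_partial[OF \<eta>(1)] compact_cball out] by metis
  obtain mk where mk: "\<And>x. \<bar>partial k \<eta> x\<bar> \<le> mk"
    using bump_alg_bounded[OF bump_alg_partial[OF \<eta>(1)] compact_cball out] by metis
  \<comment> \<open>The factors of the claim that come from f, each supported in the ball of radius
    r. The claim is that A1 Hk - A2 Hj + A3 Hk - A4 Hj has integral 0.\<close>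
  define A1 A2 A3 A4 where "A1 x = f x * partial j \<eta> x" and "A2 x = f x * partial k \<eta> x"
    and "A3 x = Fj x * \<eta> x" and "A4 x = Fk x * \<eta> x" for x
  note meas = bump_alg_measurable[OF \<eta>(1)] bump_alg_measurable[OF bump_alg_partial[OF \<eta>(1)]]
  have A: "L12 A1" "L12 A2" "L12 A3" "L12 A4"
    unfolding A1_def A2_def A3_def A4_def using L12_mult_bounded L meas m mj mk by blast+
  have Aout: "A1 x = 0" "A2 x = 0" "A3 x = 0" "A4 x = 0" if "x \<notin> cball a r" for x
    using out[OF that] \<eta>(2)[OF that] by (auto simp: A1_def A2_def A3_def A4_def)
  have L1: "integrable lborel A" if "L12 A" for A :: "real^'n \<Rightarrow> real" using that by (simp add: L12_def)
  have Lm: "A \<in> borel_measurable borel" if "L12 A" for A :: "real^'n \<Rightarrow> real" using that by (simp add: L12_def)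
  define \<Psi>0 where "\<Psi>0 A B z = (LBINT x. A x * B (x + z))" for A B :: "real^'n \<Rightarrow> real" and z
  \<comment> \<open>The integral of the claim with the derivatives of h shifted by z; its value at z
    = 0 has to vanish.\<close>
  define \<Psi> where "\<Psi> z = \<Psi>0 A1 Hk z - \<Psi>0 A2 Hj z + \<Psi>0 A3 Hk z - \<Psi>0 A4 Hj z" for z
  have "isCont (\<Psi>0 A B) 0" if "L12 A" "L12 B" for A B
    using isCont_correlation[of A B] that unfolding \<Psi>0_def L12_def by auto
  then have cont: "isCont \<Psi> 0"
    unfolding \<Psi>_def using A L by (intro continuous_intros) auto
  \<comment> \<open>The bound e \<le> R - r keeps the kernel around any x in the ball of radius r
    inside the ball of radius R, where the weak derivatives may be tested.\<close>
  have main: "integrable lborel (\<lambda>z. bump 0 (e\<^sup>2) 0 z * \<Psi> z) \<and> (LBINT z. bump 0 (e\<^sup>2) 0 z * \<Psi> z) = 0"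
    if e: "0 < e" "e \<le> R - r" for e
  proof -
    define \<phi> where "\<phi> = bump 0 (e\<^sup>2) (0::real^'n)"
    have \<phi>: "bump_alg \<phi>" unfolding \<phi>_def by (rule bump_alg.bump)
    have \<phi>out: "\<phi> x = 0" if "x \<notin> cball 0 e" for x
      using bump_eq_0[OF e(1), of x 0 0] that unfolding \<phi>_def by simp
    have even: "\<phi> (- x) = \<phi> x" for x by (simp add: \<phi>_def bump_def)
    have \<phi>i: "integrable lborel \<phi>" by (rule bump_alg_integrable[OF \<phi> compact_cball \<phi>out])
    define \<phi>j \<phi>k where "\<phi>j = partial j \<phi>" and "\<phi>k = partial k \<phi>"
    have \<phi>jk: "bump_alg \<phi>j" "bump_alg \<phi>k" unfolding \<phi>j_def \<phi>k_def using \<phi> by (auto intro: bump_alg_partial)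
    have \<phi>jk_out: "\<phi>j x = 0" "\<phi>k x = 0" if "x \<notin> cball 0 e" for x
      unfolding \<phi>j_def \<phi>k_def using partial_eq_0_outside[OF \<phi>out closed_cball that] by auto
    obtain m1 m2 where mm: "\<And>x. \<bar>\<phi>j x\<bar> \<le> m1" "\<And>x. \<bar>\<phi>k x\<bar> \<le> m2"
      using bump_alg_bounded[OF \<phi>jk(1) compact_cball \<phi>jk_out(1)] bump_alg_bounded[OF \<phi>jk(2) compact_cball \<phi>jk_out(2)]
      by metis
    have diff: "b differentiable (at x)" if "bump_alg b" for b :: "real^'n \<Rightarrow> real" and x
      using that by (rule bump_alg_differentiable)

    text \<open>The mollified weak derivatives of \<open>h\<close>: test against \<open>\<lambda>y. \<phi> (x - y)\<close>.\<close>
    have hj: "(LBINT y. Hj y * \<phi> (x - y)) = (LBINT y. h y * \<phi>j (x - y))"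
      and hk: "(LBINT y. Hk y * \<phi> (x - y)) = (LBINT y. h y * \<phi>k (x - y))"
      if x: "x \<in> cball a r" for x
    proof -
      have "bump_alg (\<lambda>y. \<phi> (- y - (- x)))"
        by (rule bump_alg_reflect[OF bump_alg_shift[OF \<phi>, of "- x"]])
      then have b: "bump_alg (\<lambda>y. \<phi> (x - y))" by (simp add: algebra_simps)
      have o: "\<phi> (x - y) = 0" if "y \<notin> cball a R" for y
      proof (rule \<phi>out)
        show "x - y \<notin> cball 0 e"
          using x that e dist_triangle[of a y x] by (auto simp: dist_norm norm_minus_commute)
      qed
      have pj: "partial j (\<lambda>y. \<phi> (x - y)) = (\<lambda>y. - \<phi>j (x - y))"
        and pk: "partial k (\<lambda>y. \<phi> (x - y)) = (\<lambda>y. - \<phi>k (x - y))"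
        unfolding \<phi>j_def \<phi>k_def using partial_reflect[OF diff[OF \<phi>]] by auto
      show "(LBINT y. Hj y * \<phi> (x - y)) = (LBINT y. h y * \<phi>j (x - y))"
        "(LBINT y. Hk y * \<phi> (x - y)) = (LBINT y. h y * \<phi>k (x - y))"
        using weak[OF b o] unfolding pj pk by auto
    qed

    text \<open>
      Test the weak derivatives of \<open>f\<close> against \<open>\<lambda>x. \<eta> x * \<phi>k (x - y)\<close> and \<open>\<lambda>x. \<eta> x * \<phi>j (x - y)\<close>:
      the second derivatives of \<open>\<phi>\<close> cancel by symmetry.
    \<close>
    have int\<kappa>: "integrable lborel (\<lambda>x. A x * \<kappa> (x - y))" if "L12 A" "\<kappa> = \<phi>j \<or> \<kappa> = \<phi>k" for A \<kappa> y
      using that mm \<phi>jk[THEN bump_alg_measurable]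
      by (elim disjE) (auto intro!: integrable_mult_bounded[OF L1, of A] dest: Lm)
    have fy: "(LBINT x. A1 x * \<phi>k (x - y) - A2 x * \<phi>j (x - y) + A3 x * \<phi>k (x - y) - A4 x * \<phi>j (x - y)) = 0" for y
    proof -
      have t: "bump_alg (\<lambda>x. \<eta> x * \<phi>j (x - y))" "bump_alg (\<lambda>x. \<eta> x * \<phi>k (x - y))"
        by (intro bump_alg.mult \<eta>(1) bump_alg_shift \<phi>jk)+
      have o: "\<eta> x * \<phi>j (x - y) = 0" "\<eta> x * \<phi>k (x - y) = 0" if "x \<notin> cball a R" for x
        using \<eta>(2)[of x] that \<open>r < R\<close> by auto
      have p: "partial i (\<lambda>x. \<eta> x * b (x - y)) x = \<eta> x * partial i b (x - y) + partial i \<eta> x * b (x - y)"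
        if "bump_alg b" for b i x
        using partial_mult[OF diff[OF \<eta>(1)] diff[OF bump_alg_shift[OF that]]]
          partial_shift[OF diff[OF that]] by simp
      have c: "partial k \<phi>j = partial j \<phi>k"
        unfolding \<phi>j_def \<phi>k_def \<phi>_def by (rule ext) (rule partial_partial_bump_commute)
      \<comment> \<open>The term with the second derivative of the kernel; it occurs in both tests
        and drops out of their difference.\<close>
      define X where "X = (LBINT x. f x * \<eta> x * partial j \<phi>k (x - y))"
      have o3: "partial j \<phi>k x = 0" if "x \<notin> cball 0 e" for x
        using partial_eq_0_outside[OF \<phi>jk_out(2) closed_cball that] .
      obtain m3 where m3: "\<And>x. \<bar>partial j \<phi>k x\<bar> \<le> m3"
        using bump_alg_bounded[OF bump_alg_partial[OF \<phi>jk(2)] compact_cball o3] by blast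
      have Xi: "integrable lborel (\<lambda>x. f x * \<eta> x * partial j \<phi>k (x - y))"
        using bump_alg_measurable[OF bump_alg_partial[OF \<phi>jk(2)]] m3
        by (intro integrable_mult_bounded[where m = m3] L1[OF L12_mult_bounded[OF L(1) _ m]] meas) auto
      have "f x * partial j (\<lambda>x. \<eta> x * \<phi>k (x - y)) x = f x * \<eta> x * partial j \<phi>k (x - y) + A1 x * \<phi>k (x - y)"
        "f x * partial k (\<lambda>x. \<eta> x * \<phi>j (x - y)) x = f x * \<eta> x * partial j \<phi>k (x - y) + A2 x * \<phi>j (x - y)" for x
        unfolding p[OF \<phi>jk(1)] p[OF \<phi>jk(2)] c A1_def A2_def by (simp_all add: algebra_simps)
      moreover have "(LBINT x. f x * partial j (\<lambda>x. \<eta> x * \<phi>k (x - y)) x) = - (LBINT x. A3 x * \<phi>k (x - y))"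
        using weak[OF t(2) o(2)] by (simp add: A3_def mult.assoc)
      moreover have "(LBINT x. f x * partial k (\<lambda>x. \<eta> x * \<phi>j (x - y)) x) = - (LBINT x. A4 x * \<phi>j (x - y))"
        using weak[OF t(1) o(1)] by (simp add: A4_def mult.assoc)
      ultimately have "X + (LBINT x. A1 x * \<phi>k (x - y)) = - (LBINT x. A3 x * \<phi>k (x - y))"
        "X + (LBINT x. A2 x * \<phi>j (x - y)) = - (LBINT x. A4 x * \<phi>j (x - y))"
        unfolding X_def using Xi int\<kappa> A by simp_all
      then show ?thesis using int\<kappa> A by simp
    qed

    \<comment> \<open>Where A lives, the derivative moves from h to the kernel, and Fubini leaves h
      (y) times an integral over x. With their signs, the four integrals over x add up to the left
      side of \<open>fy\<close>.\<close>
    have P: "(LBINT x. A x * (LBINT y. B y * \<phi> (x - y))) = (LBINT y. h y * (LBINT x. A x * \<kappa> (x - y)))"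
      "integrable lborel (\<lambda>y. h y * (LBINT x. A x * \<kappa> (x - y)))"
      if "L12 A" "\<And>x. x \<notin> cball a r \<Longrightarrow> A x = 0" "\<kappa> = \<phi>j \<and> B = Hj \<or> \<kappa> = \<phi>k \<and> B = Hk" for A B \<kappa>
    proof -
      have int: "integrable (lborel \<Otimes>\<^sub>M lborel) (\<lambda>(x, y). A x * h y * \<kappa> (x - y))"
        using that(3)
          integrable_convolution_kernel[OF L1[OF that(1)] L1[OF L(2)] bump_alg_measurable[OF \<phi>jk(1)] mm(1)]
          integrable_convolution_kernel[OF L1[OF that(1)] L1[OF L(2)] bump_alg_measurable[OF \<phi>jk(2)] mm(2)]
        by blast
      have "A x * (LBINT y. B y * \<phi> (x - y)) = (LBINT y. A x * h y * \<kappa> (x - y))" for x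
      proof (cases "x \<in> cball a r")
        case True
        with that(3) show ?thesis using hj[OF True] hk[OF True] by (auto simp: mult.assoc)
      qed (simp add: that(2))
      then have "(LBINT x. A x * (LBINT y. B y * \<phi> (x - y))) = (LBINT x. (LBINT y. A x * h y * \<kappa> (x - y)))"
        by simp
      also have "\<dots> = (LBINT y. (LBINT x. A x * h y * \<kappa> (x - y)))"
        by (rule lborel_pair.Fubini_integral[OF int, symmetric])
      also have "\<dots> = (LBINT y. h y * (LBINT x. A x * \<kappa> (x - y)))"
        by (simp add: mult.commute[of _ "h _"] mult.assoc)
      finally show "(LBINT x. A x * (LBINT y. B y * \<phi> (x - y))) = (LBINT y. h y * (LBINT x. A x * \<kappa> (x - y)))" .
      show "integrable lborel (\<lambda>y. h y * (LBINT x. A x * \<kappa> (x - y)))"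
        using lborel_pair.integrable_snd[OF int] by (simp add: mult.commute[of _ "h _"] mult.assoc)
    qed
    have C: "integrable lborel (\<lambda>z. \<phi> z * \<Psi>0 A B z)"
      "(LBINT z. \<phi> z * \<Psi>0 A B z) = (LBINT x. A x * (LBINT y. B y * \<phi> (x - y)))"
      if "L12 A" "L12 B" for A B
      using even_kernel_correlation[OF that \<phi>i even] unfolding \<Psi>0_def by auto
    have split: "\<phi> z * \<Psi> z = \<phi> z * \<Psi>0 A1 Hk z - \<phi> z * \<Psi>0 A2 Hj z + \<phi> z * \<Psi>0 A3 Hk z - \<phi> z * \<Psi>0 A4 Hj z" for z
      unfolding \<Psi>_def by (simp add: algebra_simps)
    have "integrable lborel (\<lambda>z. \<phi> z * \<Psi> z)"
      unfolding split using A L C(1) by auto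
    moreover have "(LBINT z. \<phi> z * \<Psi> z) = 0"
    proof -
      have "(LBINT z. \<phi> z * \<Psi> z) =
          (LBINT y. h y * (LBINT x. A1 x * \<phi>k (x - y))) - (LBINT y. h y * (LBINT x. A2 x * \<phi>j (x - y)))
          + (LBINT y. h y * (LBINT x. A3 x * \<phi>k (x - y))) - (LBINT y. h y * (LBINT x. A4 x * \<phi>j (x - y)))"
        unfolding split using A L C P(1)[OF A(1) Aout(1), of \<phi>k Hk] P(1)[OF A(2) Aout(2), of \<phi>j Hj]
          P(1)[OF A(3) Aout(3), of \<phi>k Hk] P(1)[OF A(4) Aout(4), of \<phi>j Hj] by simp
      also have "\<dots> = (LBINT y. h y * (LBINT x. A1 x * \<phi>k (x - y) - A2 x * \<phi>j (x - y) + A3 x * \<phi>k (x - y) - A4 x * \<phi>j (x - y)))"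
        using int\<kappa> A P(2)[OF A(1) Aout(1), of \<phi>k Hk] P(2)[OF A(2) Aout(2), of \<phi>j Hj]
          P(2)[OF A(3) Aout(3), of \<phi>k Hk] P(2)[OF A(4) Aout(4), of \<phi>j Hj]
        by (simp add: right_diff_distrib distrib_left)
      also have "\<dots> = 0" unfolding fy by simp
      finally show ?thesis .
    qed
    ultimately show ?thesis unfolding \<phi>_def by simp
  qed
  have "R - r > 0" using \<open>r < R\<close> by simp
  then have "\<Psi> 0 \<le> 0" "- \<Psi> 0 \<le> 0"
    using approximate_identity_nonpos[OF cont, of "R - r"] main
      approximate_identity_nonpos[of "\<lambda>z. - \<Psi> z" "R - r"] cont by (auto intro!: continuous_intros)
  then have "\<Psi> 0 = 0" by simp
  moreover have "\<Psi> 0 = (LBINT x. \<eta> x * (Fj x * Hk x - Fk x * Hj x) + f x * (partial j \<eta> x * Hk x - partial k \<eta> x * Hj x))"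
  proof -
    have "integrable lborel (\<lambda>x. A x * B x)" if "L12 A" "L12 B" for A B :: "real^'n \<Rightarrow> real"
      by (rule integrable_mult_L2) (use that in \<open>auto simp: L12_def\<close>)
    then have "\<Psi> 0 = (LBINT x. A1 x * Hk x - A2 x * Hj x + A3 x * Hk x - A4 x * Hj x)"
      unfolding \<Psi>_def \<Psi>0_def using A L by simp
    also have "\<dots> = (LBINT x. \<eta> x * (Fj x * Hk x - Fk x * Hj x) + f x * (partial j \<eta> x * Hk x - partial k \<eta> x * Hj x))"
      unfolding A1_def A2_def A3_def A4_def by (intro Bochner_Integration.integral_cong refl) (simp add: algebra_simps)
    finally show ?thesis .
  qed
  ultimately show ?thesis by simp
qed

section \<open>Linear algebra of the metric at a point\<close>

definition spd :: "real^'n::finite^'n \<Rightarrow> bool" where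
  "spd G \<longleftrightarrow> transpose G = G \<and> (\<forall>v. v \<noteq> 0 \<longrightarrow> v \<bullet> (G *v v) > 0)"

lemma inner_matrix_transpose: "v \<bullet> (A *v w) = (transpose A *v v) \<bullet> w"
  for A :: "real^'n::finite^'m::finite"
  by (simp add: dot_lmul_matrix transpose_matrix_vector)

lemma inner_matrix_transpose': "(A *v w) \<bullet> v = w \<bullet> (transpose A *v v)"
  for A :: "real^'n::finite^'m::finite"
  using inner_matrix_transpose[of v A w] by (simp only: inner_commute)

lemma matrix_inv_mult:
  assumes "invertible A"
  shows "A ** matrix_inv A = mat 1" "matrix_inv A ** A = mat 1"
  using someI_ex[OF assms[unfolded invertible_def]] unfolding matrix_inv_def by auto

lemma spd_sym: "spd G \<Longrightarrow> v \<bullet> (G *v w) = w \<bullet> (G *v v)"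
  unfolding inner_matrix_transpose[of v] by (simp add: spd_def inner_commute)

lemma matrix_inner_eq_trace: "A \<bullet> B = trace (A ** transpose B)"
  by (simp add: inner_vec_def trace_def matrix_matrix_mult_def transpose_def)

text \<open>The hypothesis has the shape of the transformation law of a (1,1) tensor, with J the
  Jacobian; hence traces of such tensors are scalars.\<close>

lemma trace_similar:
  fixes X Y J :: "real^'n::finite^'n"
  assumes "X ** J = J ** Y" "invertible J"
  shows "trace X = trace Y"
proof -
  obtain K where K: "J ** K = mat 1" "K ** J = mat 1" using assms(2) by (auto simp: invertible_def)
  have "trace X = trace ((X ** J) ** K)" by (simp only: matrix_mul_assoc[symmetric] K(1) matrix_mul_rid)
  also have "\<dots> = trace (K ** (J ** Y))" unfolding assms(1) by (rule trace_mul_sym)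
  also have "\<dots> = trace Y" by (simp only: matrix_mul_assoc K(2) matrix_mul_lid)
  finally show ?thesis .
qed

text \<open>Gram-Schmidt for the inner product of G, by induction on the index set. Fewer than n
  vectors cannot span, which yields a further vector to orthogonalise.\<close>

lemma spd_partial_frame:
  fixes G :: "real^'n::finite^'n" and S :: "'n set"
  assumes G: "spd G"
  shows "\<exists>b :: 'n \<Rightarrow> real^'n. \<forall>i\<in>S. \<forall>j\<in>S. b i \<bullet> (G *v b j) = (if i = j then 1 else 0)"
proof -
  have "finite S" by simp
  then show ?thesis
  proof induction
    case (insert s S)
    then obtain b :: "'n \<Rightarrow> real^'n" where b: "\<And>i j. i \<in> S \<Longrightarrow> j \<in> S \<Longrightarrow> b i \<bullet> (G *v b j) = (if i = j then 1 else 0)"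
      by blast
    have "dim (b ` S) \<le> card S"
      by (meson card_image_le dim_le_card' finite_imageI insert.hyps(1) le_trans)
    also have "\<dots> < card (insert s S)" using insert.hyps by simp
    also have "\<dots> \<le> CARD('n)" by (rule card_mono) auto
    finally have "dim (b ` S) < DIM(real^'n)" by simp
    then have "dim (span (b ` S)) \<noteq> dim (UNIV :: (real^'n) set)" by simp
    then have "span (b ` S) \<noteq> UNIV" by metis
    then obtain v where v: "v \<notin> span (b ` S)" by blast
    define w where "w = v - (\<Sum>i\<in>S. (b i \<bullet> (G *v v)) *\<^sub>R b i)"
    have "(\<Sum>i\<in>S. (b i \<bullet> (G *v v)) *\<^sub>R b i) \<in> span (b ` S)"
      by (intro span_sum span_scale span_base imageI)
    then have "w \<noteq> 0" using v unfolding w_def by auto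
    then have w: "w \<bullet> (G *v w) > 0" using G by (simp add: spd_def)
    have orth: "b j \<bullet> (G *v w) = 0" if "j \<in> S" for j
      using that insert.hyps(1) b
      by (simp add: w_def matrix_vector_mult_diff_distrib linear_sum[OF matrix_vector_mul_linear]
          matrix_vector_mult_scaleR inner_diff_right inner_sum_right if_distrib[of "\<lambda>t. _ * t"] cong: if_cong)
    have orth': "w \<bullet> (G *v b j) = 0" if "j \<in> S" for j
      using orth[OF that] spd_sym[OF G] by simp
    define c where "c = 1 / sqrt (w \<bullet> (G *v w))"
    have c: "c * (c * (w \<bullet> (G *v w))) = 1" unfolding c_def using w by (simp add: field_simps)
    show ?case
    proof (intro exI[of _ "b(s := c *\<^sub>R w)"] ballI)
      fix i j assume "i \<in> insert s S" "j \<in> insert s S"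
      then show "(b(s := c *\<^sub>R w)) i \<bullet> (G *v (b(s := c *\<^sub>R w)) j) = (if i = j then 1 else 0)"
        using insert.hyps(2) c orth orth' b by (auto simp: matrix_vector_mult_scaleR)
    qed
  qed simp
qed

lemma spd_frame:
  fixes G :: "real^'n::finite^'n"
  assumes "spd G"
  obtains R :: "real^'n^'n" where "transpose R ** G ** R = mat 1"
proof -
  obtain b :: "'n \<Rightarrow> real^'n" where b: "\<And>i j. b i \<bullet> (G *v b j) = (if i = j then 1 else 0)"
    using spd_partial_frame[OF assms, of UNIV] by blast
  define R where "R = (\<chi> r c. b c $ r)"
  have "(transpose R ** G ** R) $ i $ j = b i \<bullet> (G *v b j)" for i j
    by (simp add: R_def transpose_def matrix_matrix_mult_def matrix_vector_mult_def inner_vec_def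
        sum_distrib_left sum_distrib_right mult.assoc) (rule sum.swap)
  then have "transpose R ** G ** R = mat 1"
    unfolding vec_eq_iff b by (simp add: mat_def)
  then show ?thesis by (rule that)
qed

text \<open>An orthonormal frame R gives det G (det R)^2 = 1.\<close>

lemma spd_det_pos:
  fixes G :: "real^'n::finite^'n"
  assumes "spd G"
  shows "det G > 0"
proof -
  obtain R :: "real^'n^'n" where "transpose R ** G ** R = mat 1" using spd_frame[OF assms] .
  then have "det (transpose R ** G ** R) = 1" by simp
  then have "det G * (det R)\<^sup>2 = 1" by (simp add: det_mul det_transpose power2_eq_square mult_ac)
  then show ?thesis using mult_nonpos_nonneg[of "det G" "(det R)\<^sup>2"] by (cases "det G > 0") auto
qed

lemma spd_inverse:
  assumes "spd G"
  shows "G ** matrix_inv G = mat 1" "matrix_inv G ** G = mat 1"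
  using spd_det_pos[OF assms] matrix_inv_mult[of G] invertible_det_nz[of G] by auto

text \<open>Besides solving the defining equation, the formula must be its only solution for the
  description in \<open>adjoint_g\<close> to denote it; this follows from the invertibility of
  G.\<close>

lemma adjoint_g_eq:
  assumes "spd G"
  shows "adjoint_g G B = matrix_inv G ** transpose B ** G"
  unfolding adjoint_g_def
proof (rule the_equality)
  have adj: "inner_g G (B *v v) w = v \<bullet> (transpose B ** G *v w)" for v w
    unfolding inner_g_def inner_matrix_transpose'[of B] matrix_vector_mul_assoc ..
  have G: "G ** (matrix_inv G ** transpose B ** G) = transpose B ** G"
    by (simp add: matrix_mul_assoc spd_inverse[OF assms])
  show "\<forall>v w. inner_g G (B *v v) w = inner_g G v (matrix_inv G ** transpose B ** G *v w)"
    unfolding adj unfolding inner_g_def matrix_vector_mul_assoc G by simp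
  fix B' assume "\<forall>v w. inner_g G (B *v v) w = inner_g G v (B' *v w)"
  then have "v \<bullet> (transpose B ** G *v w) = v \<bullet> (G ** B' *v w)" for v w
    unfolding adj unfolding inner_g_def matrix_vector_mul_assoc by simp
  then have "(transpose B ** G) *v w = (G ** B') *v w" for w
    by (intro vector_eq_ldot[THEN iffD1]) simp
  then have "transpose B ** G = G ** B'" by (simp add: matrix_eq)
  then have "matrix_inv G ** (transpose B ** G) = (matrix_inv G ** G) ** B'" by (simp add: matrix_mul_assoc)
  then show "B' = matrix_inv G ** transpose B ** G"
    by (simp add: spd_inverse(2)[OF assms] matrix_mul_assoc)
qed

lemma tensor_inner_g_eq:
  assumes "spd G"
  shows "tensor_inner_g G A B = trace (A ** matrix_inv G ** transpose B ** G)"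
  by (simp add: tensor_inner_g_def adjoint_g_eq[OF assms] matrix_mul_assoc)

text \<open>The columns of P are an orthonormal frame for G and Q is its inverse. In this frame the
  inner product of tensors is the Frobenius one and the adjoint is the transpose, which reduces the
  pointwise identities to the Euclidean case.\<close>

lemma spd_frame_tensor:
  fixes G :: "real^'n::finite^'n"
  assumes "spd G"
  obtains P Q :: "real^'n^'n" where "Q ** P = mat 1" "P ** Q = mat 1"
    "\<And>A B. tensor_inner_g G A B = (Q ** A ** P) \<bullet> (Q ** B ** P)"
    "\<And>A. Q ** adjoint_g G A ** P = transpose (Q ** A ** P)"
proof -
  obtain P :: "real^'n^'n" where P: "transpose P ** G ** P = mat 1" using spd_frame[OF assms] .
  define Q where "Q = transpose P ** G"
  have QP: "Q ** P = mat 1" using P by (simp add: Q_def)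
  then have PQ: "P ** Q = mat 1" using matrix_left_right_inverse by blast
  have inv: "matrix_inv G = P ** transpose P"
  proof -
    have "matrix_inv G = (P ** Q) ** matrix_inv G" by (simp add: PQ)
    also have "\<dots> = P ** transpose P ** (G ** matrix_inv G)" by (simp add: Q_def matrix_mul_assoc)
    finally show ?thesis by (simp add: spd_inverse[OF assms])
  qed
  have tQ: "transpose Q = G ** P" using assms by (simp add: Q_def matrix_transpose_mul spd_def)
  have GQ: "G = transpose Q ** Q" unfolding tQ using PQ by (simp add: flip: matrix_mul_assoc)
  have "tensor_inner_g G A B = (Q ** A ** P) \<bullet> (Q ** B ** P)" for A B
  proof -
    have "tensor_inner_g G A B = trace (A ** (P ** transpose P) ** transpose B ** (transpose Q ** Q))"
      unfolding tensor_inner_g_eq[OF assms] inv GQ[symmetric] ..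
    also have "\<dots> = trace ((A ** P ** transpose P ** transpose B ** transpose Q) ** Q)"
      by (simp only: matrix_mul_assoc)
    also have "\<dots> = trace (Q ** (A ** P ** transpose P ** transpose B ** transpose Q))"
      by (rule trace_mul_sym)
    finally show ?thesis by (simp add: matrix_inner_eq_trace matrix_transpose_mul matrix_mul_assoc)
  qed
  moreover have "Q ** adjoint_g G A ** P = transpose (Q ** A ** P)" for A
  proof -
    have "Q ** adjoint_g G A ** P = (Q ** P) ** transpose P ** transpose A ** (G ** P)"
      unfolding adjoint_g_eq[OF assms] inv by (simp only: matrix_mul_assoc)
    also have "\<dots> = transpose (Q ** A ** P)"
      unfolding QP tQ[symmetric] by (simp add: matrix_transpose_mul matrix_mul_assoc)
    finally show ?thesis .
  qed
  ultimately show ?thesis using that QP PQ by blast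
qed

lemma trace_frame:
  fixes A P Q :: "real^'n::finite^'n"
  assumes "Q ** P = mat 1" "P ** Q = mat 1"
  shows "trace (Q ** A ** P) = trace A"
proof -
  have "trace (Q ** A ** P) = trace (P ** (Q ** A))" by (rule trace_mul_sym)
  then show ?thesis by (simp add: matrix_mul_assoc assms(2))
qed

lemma matrix_add_rdistrib: "(A + B) ** C = A ** C + B ** C" for A B :: "real^'n::finite^'m::finite"
  by (simp add: matrix_matrix_mult_def vec_eq_iff sum.distrib distrib_right)

lemma inner_transpose: "transpose A \<bullet> transpose B = A \<bullet> B" for A B :: "real^'n::finite^'m::finite"
  unfolding inner_vec_def transpose_def vec_lambda_beta by (rule sum.swap)

lemma trace_eq_inner: "trace A = A \<bullet> mat 1"
  unfolding matrix_inner_eq_trace transpose_mat matrix_mul_rid ..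

text \<open>Everything is read off from D, the matrix of A in an orthonormal frame: the squared norm
  is \<open>D \<bullet> D\<close>, the trace of A^2 is \<open>D \<bullet> transpose D\<close>, and
  the trace is \<open>D \<bullet> mat 1\<close>. The two trace bounds are Cauchy-Schwarz, the second
  because \<open>mat 1\<close> has squared norm n.\<close>

lemma
  fixes G A :: "real^'n::finite^'n"
  assumes "spd G"
  shows tensor_inner_nonneg: "tensor_inner_g G A A \<ge> 0"
    and tensor_inner_pos: "A \<noteq> 0 \<Longrightarrow> tensor_inner_g G A A > 0"
    and trace_square_le: "\<bar>trace (A ** A)\<bar> \<le> tensor_inner_g G A A"
    and square_trace_le: "(trace A)\<^sup>2 \<le> CARD('n) * tensor_inner_g G A A"
    and tensor_inner_symmetrized: "tensor_inner_g G (A + adjoint_g G A) (A + adjoint_g G A)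
      = 2 * tensor_inner_g G A A + 2 * trace (A ** A)"
    and tensor_inner_conformal: "tensor_inner_g G (A + adjoint_g G A - (2 / CARD('n) * trace A) *\<^sub>R mat 1)
        (A + adjoint_g G A - (2 / CARD('n) * trace A) *\<^sub>R mat 1)
      = 2 * tensor_inner_g G A A + 2 * trace (A ** A) - 4 / CARD('n) * (trace A)\<^sup>2"
proof -
  obtain P Q :: "real^'n^'n" where PQ: "Q ** P = mat 1" "P ** Q = mat 1"
    and inner: "\<And>A B. tensor_inner_g G A B = (Q ** A ** P) \<bullet> (Q ** B ** P)"
    and adj: "\<And>A. Q ** adjoint_g G A ** P = transpose (Q ** A ** P)"
    by (rule spd_frame_tensor[OF assms]) (rule that)
  define D where "D = Q ** A ** P"
  have AD: "tensor_inner_g G A A = D \<bullet> D" by (simp only: inner D_def)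
  have "P ** D ** Q = (P ** Q) ** A ** (P ** Q)" unfolding D_def by (simp only: matrix_mul_assoc)
  then have A: "A = P ** D ** Q" by (simp only: PQ matrix_mul_lid matrix_mul_rid)
  show "A \<noteq> 0 \<Longrightarrow> tensor_inner_g G A A > 0"
    unfolding AD using A by (cases "D = 0") (auto simp: matrix_matrix_mult_def vec_eq_iff)
  show "tensor_inner_g G A A \<ge> 0" unfolding AD by simp
  have "D ** D = Q ** A ** (P ** Q) ** A ** P" unfolding D_def by (simp only: matrix_mul_assoc)
  then have DD: "Q ** (A ** A) ** P = D ** D" by (simp only: PQ matrix_mul_assoc matrix_mul_rid)
  have trAA: "trace (A ** A) = D \<bullet> transpose D"
    unfolding trace_frame[OF PQ, of "A ** A", symmetric] DD matrix_inner_eq_trace transpose_transpose ..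
  have trA: "trace A = D \<bullet> mat 1"
    using trace_frame[OF PQ, of A] by (simp only: D_def[symmetric] trace_eq_inner)
  have nT: "norm (transpose D) = norm D" unfolding norm_eq_sqrt_inner inner_transpose ..
  have "\<bar>D \<bullet> transpose D\<bar> \<le> norm D * norm D"
    using Cauchy_Schwarz_ineq2[of D "transpose D"] unfolding nT .
  then show "\<bar>trace (A ** A)\<bar> \<le> tensor_inner_g G A A"
    unfolding trAA AD by (simp add: dot_square_norm power2_eq_square)
  have I: "mat 1 \<bullet> (mat 1 :: real^'n^'n) = CARD('n)"
    unfolding trace_eq_inner[symmetric] by (rule trace_I)
  show "(trace A)\<^sup>2 \<le> CARD('n) * tensor_inner_g G A A"
    using Cauchy_Schwarz_ineq[of D "mat 1"] unfolding trA AD I by (simp only: mult.commute)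
  have DT: "transpose D \<bullet> transpose D = D \<bullet> D" "transpose D \<bullet> D = D \<bullet> transpose D"
    by (rule inner_transpose, rule inner_commute)
  have S: "Q ** (A + adjoint_g G A) ** P = D + transpose D"
    unfolding matrix_add_ldistrib matrix_add_rdistrib adj D_def ..
  show "tensor_inner_g G (A + adjoint_g G A) (A + adjoint_g G A) = 2 * tensor_inner_g G A A + 2 * trace (A ** A)"
    unfolding inner[of "A + _"] S AD trAA inner_add_left inner_add_right DT by simp
  define t where "t = 2 / CARD('n) * trace A"
  have "A + adjoint_g G A - t *\<^sub>R mat 1 = (A + adjoint_g G A) + (- t) *\<^sub>R mat 1" by simp
  then have C: "Q ** (A + adjoint_g G A - t *\<^sub>R mat 1) ** P = D + transpose D + (- t) *\<^sub>R mat 1"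
    by (simp only: matrix_add_ldistrib[of Q "A + _"] matrix_add_rdistrib[of "Q ** (A + _)"] S
        matrix_scalar_ac matrix_mul_rid scalar_matrix_assoc[symmetric] PQ)
  have TI: "transpose D \<bullet> mat 1 = D \<bullet> mat 1"
    unfolding trace_eq_inner[symmetric] trace_def transpose_def by simp
  have TI': "mat 1 \<bullet> D = D \<bullet> mat 1" "mat 1 \<bullet> transpose D = D \<bullet> mat 1"
    unfolding TI[symmetric] by (simp_all only: TI inner_commute[of "mat 1" D] inner_commute[of "mat 1" "transpose D"])
  have t: "t * (t * CARD('n)) = 4 / CARD('n) * (trace A)\<^sup>2" "t * (D \<bullet> mat 1) = 2 / CARD('n) * (trace A)\<^sup>2"
    unfolding trA[symmetric] by (simp_all add: t_def power2_eq_square)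
  \<comment> \<open>With t = 2 tr A / n the last two terms are -8/n and 4/n times the squared trace,
    hence -4/n in total.\<close>
  have "(D + transpose D + (- t) *\<^sub>R mat 1) \<bullet> (D + transpose D + (- t) *\<^sub>R mat 1)
      = 2 * (D \<bullet> D) + 2 * (D \<bullet> transpose D) - 4 * (t * (D \<bullet> mat 1)) + t * (t * CARD('n))"
    unfolding inner_add_left inner_add_right inner_scaleR_left inner_scaleR_right DT TI TI' I
    by (simp add: algebra_simps)
  also have "\<dots> = 2 * (D \<bullet> D) + 2 * (D \<bullet> transpose D) - 4 / CARD('n) * (trace A)\<^sup>2"
    unfolding t by (simp add: field_simps)
  finally show "tensor_inner_g G (A + adjoint_g G A - (2 / CARD('n) * trace A) *\<^sub>R mat 1)
        (A + adjoint_g G A - (2 / CARD('n) * trace A) *\<^sub>R mat 1)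
      = 2 * tensor_inner_g G A A + 2 * trace (A ** A) - 4 / CARD('n) * (trace A)\<^sup>2"
    unfolding t_def[symmetric] inner[of "A + _ - _"] C AD trAA .
qed

section \<open>Continuity of the inverse metric and uniform bounds on compact sets\<close>

lemma matrix_inv_component:
  fixes A :: "real^'n::finite^'n"
  assumes "det A \<noteq> 0"
  shows "matrix_inv A $ k $ l = det (\<chi> i j. if j = k then axis l 1 $ i else A $ i $ j) / det A"
proof -
  have "A *v (matrix_inv A *v axis l 1) = axis l 1"
    using assms by (simp add: matrix_vector_mul_assoc matrix_inv_mult invertible_det_nz)
  then have "matrix_inv A *v axis l 1 = (\<chi> k. det (\<chi> i j. if j = k then axis l 1 $ i else A $ i $ j) / det A)"
    using cramer[OF assms] by blast
  moreover have "(matrix_inv A *v axis l 1) $ k = matrix_inv A $ k $ l"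
    by (simp add: matrix_vector_mult_def axis_def if_distrib[of "\<lambda>t. _ * t"] cong: if_cong)
  ultimately show ?thesis by simp
qed

lemma continuous_on_det:
  fixes G :: "'a::topological_space \<Rightarrow> real^'n::finite^'n"
  assumes "\<And>i j. continuous_on S (\<lambda>x. G x $ i $ j)"
  shows "continuous_on S (\<lambda>x. det (G x))"
  unfolding det_def by (intro continuous_intros assms)

text \<open>By Cramer's rule the entries of the inverse are quotients of determinants in the entries
  of G.\<close>

lemma continuous_on_matrix_inv:
  fixes G :: "'a::topological_space \<Rightarrow> real^'n::finite^'n"
  assumes "continuous_on S G" "\<And>x. x \<in> S \<Longrightarrow> det (G x) \<noteq> 0"
  shows "continuous_on S (\<lambda>x. matrix_inv (G x))"
proof -
  have c: "continuous_on S (\<lambda>x. G x $ i $ j)" for i j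
    using assms(1) by (intro continuous_intros)
  have "continuous_on S (\<lambda>x. matrix_inv (G x) $ k $ l)" for k l
  proof -
    have "continuous_on S (\<lambda>x. det (\<chi> i j. if j = k then axis l 1 $ i else G x $ i $ j) / det (G x))"
    proof (intro continuous_on_divide continuous_on_det)
      show "continuous_on S (\<lambda>x. (\<chi> i j. if j = k then axis l 1 $ i else G x $ i $ j) $ i $ j)" for i j
        by (cases "j = k") (simp_all add: c)
    qed (use c assms(2) in auto)
    then show ?thesis
      by (rule continuous_on_eq) (simp add: matrix_inv_component assms(2))
  qed
  then have "continuous_on S (\<lambda>x. \<chi> k l. matrix_inv (G x) $ k $ l)"
    by (intro continuous_on_vec_lambda)
  then show ?thesis by simp
qed

text \<open>The form attains a positive minimum on the compact product of K and the unit sphere;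
  homogeneity extends the bound to all vectors.\<close>

lemma pd_form_lower_bound:
  fixes q :: "'a::topological_space \<Rightarrow> 'b::euclidean_space \<Rightarrow> real"
  assumes "compact K"
    and cont: "continuous_on (K \<times> UNIV) (\<lambda>(x, v). q x v)"
    and pos: "\<And>x v. x \<in> K \<Longrightarrow> v \<noteq> 0 \<Longrightarrow> q x v > 0"
    and hom: "\<And>x v c. x \<in> K \<Longrightarrow> q x (c *\<^sub>R v) = c\<^sup>2 * q x v"
  obtains m where "m > 0" "\<And>x v. x \<in> K \<Longrightarrow> m * (norm v)\<^sup>2 \<le> q x v"
proof (cases "K \<times> sphere (0::'b) 1 = {}")
  case True
  have "sphere (0::'b) 1 \<noteq> {}" by simp
  with True show ?thesis using that[of 1] by auto
next
  case False
  have "compact (K \<times> sphere (0::'b) 1)" using assms(1) by (intro compact_Times) auto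
  moreover have "continuous_on (K \<times> sphere 0 1) (\<lambda>(x, v). q x v)"
    by (rule continuous_on_subset[OF cont]) auto
  ultimately obtain p where p: "p \<in> K \<times> sphere 0 1" "\<And>p'. p' \<in> K \<times> sphere 0 1 \<Longrightarrow> (\<lambda>(x, v). q x v) p \<le> (\<lambda>(x, v). q x v) p'"
    using continuous_attains_inf[OF _ False] by metis
  define m where "m = (\<lambda>(x, v). q x v) p"
  have "m > 0" unfolding m_def using p(1) by (auto split: prod.splits intro!: pos)
  moreover have "m * (norm v)\<^sup>2 \<le> q x v" if "x \<in> K" for x v
  proof (cases "v = 0")
    case True
    then show ?thesis using hom[OF that, of 0 v] by simp
  next
    case False
    define w where "w = v /\<^sub>R norm v"
    have "m \<le> q x w" using p(2)[of "(x, w)"] that False by (simp add: m_def w_def)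
    moreover have "q x v = (norm v)\<^sup>2 * q x w"
      using hom[OF that, of "norm v" w] False by (simp add: w_def)
    ultimately show ?thesis by (simp add: mult.commute[of m] mult_left_mono)
  qed
  ultimately show ?thesis by (rule that)
qed

text \<open>It compares coordinate norms with intrinsic norms of vectors and (1,1) tensors on a
  closed ball inside a chart.\<close>

lemma spd_uniform_bound:
  fixes G :: "'a::topological_space \<Rightarrow> real^'n::finite^'n"
  assumes K: "compact K" and cont: "continuous_on K G" and spd: "\<And>x. x \<in> K \<Longrightarrow> spd (G x)"
  obtains m where "m > 0" "\<And>x v. x \<in> K \<Longrightarrow> m * (norm v)\<^sup>2 \<le> inner_g (G x) v v"
    "\<And>x A. x \<in> K \<Longrightarrow> m * (norm A)\<^sup>2 \<le> tensor_inner_g (G x) A A"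
proof -
  have cG: "continuous_on (K \<times> T) (\<lambda>p. G (fst p))" for T :: "'c::topological_space set"
    by (rule continuous_on_compose2[OF cont]) (auto intro: continuous_intros)
  have cI: "continuous_on (K \<times> T) (\<lambda>p. matrix_inv (G (fst p)))" for T :: "'c::topological_space set"
    by (rule continuous_on_matrix_inv[OF cG]) (use spd_det_pos[OF spd] in force)
  obtain m1 where m1: "m1 > 0" "\<And>x v. x \<in> K \<Longrightarrow> m1 * (norm v)\<^sup>2 \<le> inner_g (G x) v v"
  proof (rule pd_form_lower_bound[OF K, of "\<lambda>x v. inner_g (G x) v v"])
    show "continuous_on (K \<times> UNIV) (\<lambda>(x, v). inner_g (G x) v v)"
      unfolding case_prod_unfold inner_g_def inner_vec_def matrix_vector_mult_def
      by (simp, intro continuous_intros cG)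
    show "x \<in> K \<Longrightarrow> v \<noteq> 0 \<Longrightarrow> 0 < inner_g (G x) v v" for x v
      using spd[of x] by (simp add: spd_def inner_g_def)
    show "inner_g (G x) (c *\<^sub>R v) (c *\<^sub>R v) = c\<^sup>2 * inner_g (G x) v v" for x c v
      by (simp add: inner_g_def matrix_vector_mult_scaleR power2_eq_square)
  qed (rule that)
  obtain m2 where m2: "m2 > 0" "\<And>x A. x \<in> K \<Longrightarrow> m2 * (norm A)\<^sup>2 \<le> tensor_inner_g (G x) A A"
  proof (rule pd_form_lower_bound[OF K, of "\<lambda>x A. tensor_inner_g (G x) A A"])
    have "continuous_on (K \<times> UNIV) (\<lambda>p. trace (snd p ** matrix_inv (G (fst p)) ** transpose (snd p) ** G (fst p)))"
      unfolding trace_def matrix_matrix_mult_def transpose_def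
      by (simp, intro continuous_intros cG cI)
    then show "continuous_on (K \<times> UNIV) (\<lambda>(x, A). tensor_inner_g (G x) A A)"
      by (rule continuous_on_eq) (auto simp: tensor_inner_g_eq[OF spd])
    show "x \<in> K \<Longrightarrow> A \<noteq> 0 \<Longrightarrow> 0 < tensor_inner_g (G x) A A" for x A
      using tensor_inner_pos[OF spd] .
    show "tensor_inner_g (G x) (c *\<^sub>R A) (c *\<^sub>R A) = c\<^sup>2 * tensor_inner_g (G x) A A" if "x \<in> K" for x c A
      unfolding tensor_inner_g_eq[OF spd[OF that]] trace_def matrix_matrix_mult_def transpose_def
      by (simp add: sum_distrib_left sum_distrib_right power2_eq_square mult_ac)
  qed (rule that)
  show ?thesis
  proof (rule that[of "min m1 m2"])
    show "min m1 m2 > 0" using m1 m2 by simp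
    show "min m1 m2 * (norm v)\<^sup>2 \<le> inner_g (G x) v v" if "x \<in> K" for x v
      using m1(2)[OF that, of v] by (rule order_trans[rotated]) (simp add: mult_right_mono)
    show "min m1 m2 * (norm A)\<^sup>2 \<le> tensor_inner_g (G x) A A" if "x \<in> K" for x A
      using m2(2)[OF that, of A] by (rule order_trans[rotated]) (simp add: mult_right_mono)
  qed
qed

section \<open>Change of coordinates at one point\<close>

lemma spd_congruence_invertible:
  fixes G H J :: "real^'n::finite^'n"
  assumes "spd G" "G = transpose J ** H ** J"
  shows "invertible J"
proof -
  have "det G \<noteq> 0" using spd_det_pos[OF assms(1)] by simp
  then show ?thesis using assms(2) by (auto simp: det_mul invertible_det_nz)
qed

lemma inner_g_congruence:
  assumes "G = transpose J ** H ** J"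
  shows "inner_g G v w = inner_g H (J *v v) (J *v w)"
  unfolding inner_g_def assms inner_matrix_transpose'[of J] matrix_vector_mul_assoc matrix_mul_assoc ..

text \<open>The adjoint of a (1,1) tensor is again a (1,1) tensor: multiplied by the invertible
  \<open>transpose J ** H\<close>, both sides become \<open>transpose A ** G\<close>, and that
  factor can be cancelled.\<close>

lemma adjoint_g_congruence:
  fixes G H J A B :: "real^'n::finite^'n"
  assumes "spd G" "spd H" and G: "G = transpose J ** H ** J" and AB: "B ** J = J ** A"
  shows "adjoint_g H B ** J = J ** adjoint_g G A"
proof -
  have adj: "X ** adjoint_g X Y = transpose Y ** X" if "spd X" for X Y :: "real^'n^'n"
    unfolding adjoint_g_eq[OF that] by (simp add: matrix_mul_assoc spd_inverse[OF that])
  have "invertible (transpose J ** H)"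
    using spd_det_pos[OF assms(1)] unfolding G invertible_det_nz by (auto simp: det_mul)
  then obtain K where K: "K ** (transpose J ** H) = mat 1" by (auto simp: invertible_def)
  have "transpose J ** H ** (adjoint_g H B ** J) = transpose J ** (H ** adjoint_g H B) ** J"
    by (simp only: matrix_mul_assoc)
  also have "\<dots> = transpose (B ** J) ** H ** J"
    unfolding adj[OF assms(2)] by (simp add: matrix_transpose_mul matrix_mul_assoc)
  also have "\<dots> = transpose A ** G"
    unfolding AB G by (simp add: matrix_transpose_mul matrix_mul_assoc)
  also have "\<dots> = G ** adjoint_g G A" by (simp add: adj[OF assms(1)])
  also have "\<dots> = transpose J ** H ** (J ** adjoint_g G A)"
    unfolding G by (simp only: matrix_mul_assoc)
  finally have "K ** (transpose J ** H ** (adjoint_g H B ** J)) = K ** (transpose J ** H ** (J ** adjoint_g G A))"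
    by simp
  then have "K ** (transpose J ** H) ** (adjoint_g H B ** J) = K ** (transpose J ** H) ** (J ** adjoint_g G A)"
    by (simp only: matrix_mul_assoc)
  then show ?thesis by (simp only: K matrix_mul_lid)
qed

lemma tensor_inner_g_congruence:
  fixes G H J A B A' B' :: "real^'n::finite^'n"
  assumes "spd G" "spd H" and G: "G = transpose J ** H ** J" and AB: "A' ** J = J ** A" "B' ** J = J ** B"
  shows "tensor_inner_g H A' B' = tensor_inner_g G A B"
  unfolding tensor_inner_g_def
proof (rule trace_similar[where J = J])
  show "A' ** adjoint_g H B' ** J = J ** (A ** adjoint_g G B)"
    by (simp add: adjoint_g_congruence[OF assms(1-3) AB(2)] matrix_mul_assoc AB(1) flip: matrix_mul_assoc[of A'])
  show "invertible J" by (rule spd_congruence_invertible[OF assms(1) G])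
qed

section \<open>Change of variables and the Riemannian density\<close>

text \<open>
  A well-ordered copy of \<open>'n\<close>: the change of variables theorem of the library is stated for
  coordinates indexed by a well-ordered type.
\<close>

typedef 'n::finite index = "{..<CARD('n)}"
  by (intro exI[of _ 0]) simp

instantiation index :: (finite) wellorder
begin

definition less_eq_index :: "'a index \<Rightarrow> 'a index \<Rightarrow> bool" where
  "less_eq_index i j \<longleftrightarrow> Rep_index i \<le> Rep_index j"

definition less_index :: "'a index \<Rightarrow> 'a index \<Rightarrow> bool" where
  "less_index i j \<longleftrightarrow> Rep_index i < Rep_index j"

instance
proof
  fix P :: "'a index \<Rightarrow> bool" and i
  assume step: "\<And>i. (\<And>j. j < i \<Longrightarrow> P j) \<Longrightarrow> P i"
  show "P i"
  proof (induction "Rep_index i" arbitrary: i rule: less_induct)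
    case less
    show ?case by (rule step) (rule less, simp only: less_index_def)
  qed
qed (auto simp: less_eq_index_def less_index_def Rep_index_inject)

end

instance index :: (finite) finite
proof
  have "(UNIV :: 'a index set) = Abs_index ` {..<CARD('a)}"
    using type_definition.univ[OF type_definition_index] .
  then show "finite (UNIV :: 'a index set)" by (metis finite_imageI finite_lessThan)
qed

lemma ex_bij_index: "\<exists>b :: 'n::finite index \<Rightarrow> 'n. bij b"
proof -
  have "bij_betw (Rep_index :: 'n index \<Rightarrow> nat) UNIV {..<CARD('n)}"
    using type_definition.Rep_range[OF type_definition_index] Rep_index_inject
    by (auto simp: bij_betw_def inj_on_def)
  moreover obtain h :: "nat \<Rightarrow> 'n" where "bij_betw h {..<CARD('n)} UNIV"
    using ex_bij_betw_nat_finite[of "UNIV :: 'n set"] by (auto simp: atLeast0LessThan)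
  ultimately show ?thesis using bij_betw_trans by blast
qed

text \<open>Conjugation by b carries the permutations of one index type to those of the other and
  preserves signs, so the two Leibniz sums agree term by term.\<close>

lemma det_reindex:
  fixes A :: "real^'n::finite^'n" and b :: "'m::finite \<Rightarrow> 'n"
  assumes b: "bij b"
  shows "det (\<chi> i j. A $ b i $ b j) = det A"
proof -
  have inv: "inv b (b x) = x" "b (inv b y) = y" for x y
    using assms(1) by (simp_all add: bij_is_inj bij_is_surj surj_f_inv_f)
  let ?c = "\<lambda>p x. if x \<in> UNIV then b (p (inv b x)) else x"
  have sgn: "sign (?c p) = sign p" if "p permutes UNIV" for p
    using sign_map_permutation[of b UNIV p] that b
    by (simp add: map_permutation_def restrict_id_def o_def bij_is_inj bij_is_surj)
  have "bij_betw ?c {p. p permutes UNIV} {p. p permutes UNIV}"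
    by (rule bij_betw_permutations) (rule b)
  then have "det A = (\<Sum>p\<in>{p. p permutes UNIV}. of_int (sign (?c p)) * (\<Prod>i\<in>UNIV. A $ i $ ?c p i))"
    unfolding det_def by (rule sum.reindex_bij_betw[symmetric])
  also have "\<dots> = (\<Sum>p\<in>{p. p permutes UNIV}. of_int (sign p) * (\<Prod>i\<in>UNIV. A $ b i $ b (p i)))"
  proof (intro sum.cong refl)
    fix p :: "'m \<Rightarrow> 'm" assume p: "p \<in> {p. p permutes UNIV}"
    have "(\<Prod>i\<in>UNIV. A $ i $ ?c p i) = (\<Prod>i\<in>UNIV. A $ b i $ ?c p (b i))"
      by (rule prod.reindex_bij_betw[OF b, symmetric])
    then show "of_int (sign (?c p)) * (\<Prod>i\<in>UNIV. A $ i $ ?c p i)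
        = of_int (sign p) * (\<Prod>i\<in>UNIV. A $ b i $ b (p i))"
      using p sgn by (simp add: inv)
  qed
  also have "\<dots> = det (\<chi> i j. A $ b i $ b j)" unfolding det_def by simp
  finally show ?thesis ..
qed

section \<open>Lebesgue measure under renaming of coordinates\<close>

definition reindex :: "('m \<Rightarrow> 'n) \<Rightarrow> real^'n::finite \<Rightarrow> real^'m::finite" where
  "reindex b x = (\<chi> i. x $ b i)"

lemma linear_reindex: "linear (reindex b)"
  by (rule linearI) (simp_all add: reindex_def vec_eq_iff)

lemma reindex_inverse: "bij b \<Longrightarrow> reindex b (reindex (inv b) y) = y" "bij b \<Longrightarrow> reindex (inv b) (reindex b x) = x"
  by (simp_all add: reindex_def vec_eq_iff bij_is_inj bij_is_surj surj_f_inv_f)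

lemma reindex_measurable[measurable]: "reindex b \<in> borel_measurable borel"
  by (intro borel_measurable_continuous_onI linear_continuous_on linear_conv_bounded_linear[THEN iffD1] linear_reindex)

lemma prod_Basis_cart: "(\<Prod>e\<in>Basis. (x::real^'n::finite) \<bullet> e) = (\<Prod>i\<in>UNIV. x $ i)"
proof -
  have "bij_betw (\<lambda>i::'n. axis i (1::real)) UNIV Basis"
    unfolding bij_betw_def by (auto simp: inj_on_def axis_eq_axis Basis_vec_def)
  from prod.reindex_bij_betw[OF this, of "\<lambda>e. x \<bullet> e"] show ?thesis by (simp add: inner_axis)
qed

text \<open>Preimages of boxes are boxes with the same side lengths, and Lebesgue measure is
  determined by its values on boxes.\<close>

lemma lborel_distr_reindex:
  fixes b :: "'m::finite \<Rightarrow> 'n::finite"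
  assumes b: "bij b"
  shows "distr lborel borel (reindex b) = (lborel :: (real^'m) measure)"
proof (rule lborel_eqI[symmetric])
  fix l u :: "real^'m"
  assume le: "\<And>e. e \<in> Basis \<Longrightarrow> l \<bullet> e \<le> u \<bullet> e"
  have le': "l $ i \<le> u $ i" for i using le[of "axis i 1"] by (simp add: inner_axis Basis_vec_def) blast
  have inv: "inv b (b x) = x" "b (inv b y) = y" for x y
    using assms(1) by (simp_all add: bij_is_inj bij_is_surj surj_f_inv_f)
  have pre: "reindex b -` box l u = box (reindex (inv b) l) (reindex (inv b) u)"
  proof (intro set_eqI iffI)
    fix x assume "x \<in> reindex b -` box l u"
    then have "l $ i < x $ b i" "x $ b i < u $ i" for i by (auto simp: mem_box_cart reindex_def)
    from this[of "inv b _"] show "x \<in> box (reindex (inv b) l) (reindex (inv b) u)"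
      by (auto simp: mem_box_cart reindex_def inv)
  next
    fix x assume "x \<in> box (reindex (inv b) l) (reindex (inv b) u)"
    then have "l $ inv b j < x $ j" "x $ j < u $ inv b j" for j by (auto simp: mem_box_cart reindex_def)
    from this[of "b _"] show "x \<in> reindex b -` box l u"
      by (auto simp: mem_box_cart reindex_def inv)
  qed
  have "emeasure (distr lborel borel (reindex b)) (box l u) = emeasure lborel (box (reindex (inv b) l) (reindex (inv b) u))"
    by (subst emeasure_distr) (auto simp: pre)
  also have "\<dots> = (\<Prod>e\<in>Basis. (reindex (inv b) u - reindex (inv b) l) \<bullet> e)"
  proof (rule emeasure_lborel_box)
    fix e :: "real^'n" assume "e \<in> Basis"
    then obtain i where "e = axis i 1" by (auto simp: Basis_vec_def)
    then show "reindex (inv b) l \<bullet> e \<le> reindex (inv b) u \<bullet> e" using le' by (simp add: inner_axis reindex_def)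
  qed
  also have "(\<Prod>e\<in>Basis. (reindex (inv b) u - reindex (inv b) l) \<bullet> e) = (\<Prod>j\<in>UNIV. u $ inv b j - l $ inv b j)"
    unfolding prod_Basis_cart by (simp add: reindex_def)
  also have "\<dots> = (\<Prod>i\<in>UNIV. u $ i - l $ i)"
    by (rule prod.reindex_bij_betw) (use b in \<open>simp add: bij_imp_bij_inv\<close>)
  also have "\<dots> = (\<Prod>e\<in>Basis. (u - l) \<bullet> e)" unfolding prod_Basis_cart by simp
  finally show "emeasure (distr lborel borel (reindex b)) (box l u) = (\<Prod>e\<in>Basis. (u - l) \<bullet> e)" .
qed simp

text \<open>Finiteness of volumes is not known where this is applied, so infinite integrals must be
  covered: the formula for absolutely integrable functions gives equality if one side is integrable,
  and otherwise both sides are infinite. Values in \<open>real^1\<close> fit real functions into its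
  vector-valued form.\<close>

lemma nn_integral_change_of_variables_wellorder:
  fixes \<tau> :: "real^'m::{finite,wellorder} \<Rightarrow> real^'m::{finite,wellorder}" and f p :: "real^'m::_ \<Rightarrow> real"
  assumes [measurable]: "B \<in> sets borel" "\<tau> ` B \<in> sets borel"
    and pm: "(\<lambda>x. indicator B x * p x) \<in> borel_measurable borel"
    and fm: "(\<lambda>x. indicator (\<tau> ` B) x * f x) \<in> borel_measurable borel"
    and nonneg: "\<And>x. x \<in> B \<Longrightarrow> p x \<ge> 0" "\<And>x. x \<in> \<tau> ` B \<Longrightarrow> f x \<ge> 0"
    and der: "\<And>x. x \<in> B \<Longrightarrow> (\<tau> has_derivative \<tau>' x) (at x)" and inj: "inj_on \<tau> B"
    and p: "\<And>x. x \<in> B \<Longrightarrow> p x = \<bar>det (matrix (\<tau>' x))\<bar> * f (\<tau> x)"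
  shows "(\<integral>\<^sup>+x. ennreal (indicator B x * p x) \<partial>lborel) = (\<integral>\<^sup>+x. ennreal (indicator (\<tau> ` B) x * f x) \<partial>lborel)"
proof -
  let ?v = "\<lambda>h x. vec (h x) :: real^1"
  have bl: "bounded_linear (\<lambda>t::real. vec t :: real^1)"
    by (intro linear_conv_bounded_linear[THEN iffD1] linearI) (simp_all add: vec_eq_iff)
  have abs: "?v h absolutely_integrable_on S \<longleftrightarrow> integrable lborel (\<lambda>x. indicator S x * h x)"
    and intg: "?v h absolutely_integrable_on S \<Longrightarrow> integral S (?v h) = vec (LBINT x. indicator S x * h x)"
    if hm: "(\<lambda>x. indicator S x * h x) \<in> borel_measurable borel" for S and h :: "real^'m::{finite,wellorder} \<Rightarrow> real"
  proof -
    have e: "indicator S x *\<^sub>R ?v h x = vec (indicator S x * h x)" for x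
      by (simp add: vec_eq_iff)
    have "?v h absolutely_integrable_on S \<longleftrightarrow> integrable lebesgue (\<lambda>x. vec (indicator S x * h x) :: real^1)"
      unfolding set_integrable_def e ..
    also have "\<dots> \<longleftrightarrow> integrable lebesgue (\<lambda>x. indicator S x * h x)"
      using integrable_bounded_linear[OF bl, of lebesgue "\<lambda>x. indicator S x * h x"]
        integrable_bounded_linear[OF bounded_linear_vec_nth[of 1], of lebesgue "\<lambda>x. vec (indicator S x * h x) :: real^1"]
      by auto
    also have "\<dots> \<longleftrightarrow> integrable lborel (\<lambda>x. indicator S x * h x)"
      by (rule integrable_completion) (use hm in simp)
    finally show 1: "?v h absolutely_integrable_on S \<longleftrightarrow> integrable lborel (\<lambda>x. indicator S x * h x)" .
    assume a: "?v h absolutely_integrable_on S"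
    have "integral S (?v h) = (\<integral>x. vec (indicator S x * h x) \<partial>lebesgue)"
      using set_lebesgue_integral_eq_integral(2)[OF a] unfolding set_lebesgue_integral_def e by simp
    also have "\<dots> = (LBINT x. vec (indicator S x * h x))"
      by (rule integral_completion)
        (use hm in \<open>auto intro!: measurable_compose[OF _ borel_measurable_continuous_onI[OF bounded_linear.continuous_on[OF bl]]]\<close>)
    also have "\<dots> = vec (LBINT x. indicator S x * h x)"
      using integral_bounded_linear[OF bl] a 1 by blast
    finally show "integral S (?v h) = vec (LBINT x. indicator S x * h x)" .
  qed
  have cov: "(\<lambda>x. \<bar>det (matrix (\<tau>' x))\<bar> *\<^sub>R ?v f (\<tau> x)) absolutely_integrable_on B \<and>
      integral B (\<lambda>x. \<bar>det (matrix (\<tau>' x))\<bar> *\<^sub>R ?v f (\<tau> x)) = c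
      \<longleftrightarrow> ?v f absolutely_integrable_on (\<tau> ` B) \<and> integral (\<tau> ` B) (?v f) = c" for c
    by (rule has_absolute_integral_change_of_variables)
      (use der inj in \<open>auto intro: has_derivative_at_withinI\<close>)
  have "(\<lambda>x. \<bar>det (matrix (\<tau>' x))\<bar> *\<^sub>R ?v f (\<tau> x)) absolutely_integrable_on B \<longleftrightarrow> ?v p absolutely_integrable_on B"
    by (rule set_integrable_cong) (auto simp: p vec_eq_iff)
  moreover have "integral B (\<lambda>x. \<bar>det (matrix (\<tau>' x))\<bar> *\<^sub>R ?v f (\<tau> x)) = integral B (?v p)"
    by (rule Henstock_Kurzweil_Integration.integral_cong) (auto simp: p vec_eq_iff)
  ultimately have cov': "?v p absolutely_integrable_on B \<and> integral B (?v p) = c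
      \<longleftrightarrow> ?v f absolutely_integrable_on (\<tau> ` B) \<and> integral (\<tau> ` B) (?v f) = c" for c
    using cov by simp
  show ?thesis
  proof (cases "?v p absolutely_integrable_on B")
    case True
    then have f: "?v f absolutely_integrable_on (\<tau> ` B)" "integral (\<tau> ` B) (?v f) = integral B (?v p)"
      using cov' by auto
    have "(LBINT x. indicator (\<tau> ` B) x * f x) = (LBINT x. indicator B x * p x)"
      using f(2) intg[OF pm True] intg[OF fm f(1)] by (simp add: vec_eq_iff)
    then show ?thesis
      using True f(1) abs[OF pm] abs[OF fm] nonneg
      by (subst (1 2) nn_integral_eq_integral) (auto simp: indicator_def)
  next
    case False
    then have "\<not> ?v f absolutely_integrable_on (\<tau> ` B)" using cov' by blast
    have top: "(\<integral>\<^sup>+x. ennreal (h x) \<partial>lborel) = \<infinity>"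
      if "\<not> integrable lborel h" "h \<in> borel_measurable borel" "\<And>x. h x \<ge> 0" for h :: "real^'m::{finite,wellorder} \<Rightarrow> real"
    proof (rule ccontr)
      assume "(\<integral>\<^sup>+x. ennreal (h x) \<partial>lborel) \<noteq> \<infinity>"
      then have "(\<integral>\<^sup>+x. ennreal (h x) \<partial>lborel) < \<infinity>" by (simp add: less_top)
      with that(2,3) have "integrable lborel h" by (intro integrableI_nonneg) simp_all
      with that(1) show False ..
    qed
    have "(\<integral>\<^sup>+x. ennreal (indicator B x * p x) \<partial>lborel) = \<infinity>"
      using False abs[OF pm] nonneg(1) pm by (intro top) (auto simp: indicator_def)
    moreover have "(\<integral>\<^sup>+x. ennreal (indicator (\<tau> ` B) x * f x) \<partial>lborel) = \<infinity>"
      using \<open>\<not> ?v f absolutely_integrable_on (\<tau> ` B)\<close> abs[OF fm] nonneg(2) fm by (intro top) (auto simp: indicator_def)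
    ultimately show ?thesis by simp
  qed
qed

text \<open>Conjugation with the renaming P and its inverse Q moves the problem to a well-ordered
  index type; neither Lebesgue measure nor the determinant of the derivative changes.\<close>

lemma nn_integral_change_of_variables:
  fixes \<tau> :: "real^'n::finite \<Rightarrow> real^'n" and f p :: "real^'n \<Rightarrow> real"
  assumes B: "B \<in> sets borel" "\<tau> ` B \<in> sets borel"
    and pm: "(\<lambda>x. indicator B x * p x) \<in> borel_measurable borel"
    and fm: "(\<lambda>x. indicator (\<tau> ` B) x * f x) \<in> borel_measurable borel"
    and nonneg: "\<And>x. x \<in> B \<Longrightarrow> p x \<ge> 0" "\<And>x. x \<in> \<tau> ` B \<Longrightarrow> f x \<ge> 0"
    and der: "\<And>x. x \<in> B \<Longrightarrow> (\<tau> has_derivative \<tau>' x) (at x)" and inj: "inj_on \<tau> B"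
    and p: "\<And>x. x \<in> B \<Longrightarrow> p x = \<bar>det (matrix (\<tau>' x))\<bar> * f (\<tau> x)"
  shows "(\<integral>\<^sup>+x. ennreal (indicator B x * p x) \<partial>lborel) = (\<integral>\<^sup>+x. ennreal (indicator (\<tau> ` B) x * f x) \<partial>lborel)"
proof -
  obtain b :: "'n index \<Rightarrow> 'n" where b: "bij b" using ex_bij_index by blast
  define P where "P = (reindex b :: real^'n \<Rightarrow> real^'n index)"
  define Q where "Q = (reindex (inv b) :: real^'n index \<Rightarrow> real^'n)"
  have PQ: "P (Q y) = y" "Q (P x) = x" for x y
    unfolding P_def Q_def using reindex_inverse[OF b] by auto
  have [measurable]: "P \<in> borel_measurable borel" "Q \<in> borel_measurable borel"
    unfolding P_def Q_def by auto
  have lin: "linear P" "linear Q" unfolding P_def Q_def by (simp_all add: linear_reindex)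
  have QL: "distr lborel borel Q = lborel"
    unfolding Q_def by (rule lborel_distr_reindex) (simp add: b bij_imp_bij_inv)
  define B' where "B' = Q -` B"
  define \<tau>2 where "\<tau>2 y = P (\<tau> (Q y))" for y
  have im: "\<tau>2 ` B' = Q -` (\<tau> ` B)"
  proof -
    have "Q (\<tau>2 y) \<in> \<tau> ` B" if "y \<in> B'" for y
      using that by (simp add: \<tau>2_def B'_def PQ)
    moreover have "y \<in> \<tau>2 ` B'" if "Q y = \<tau> x" "x \<in> B" for x y
    proof -
      have "\<tau>2 (P x) = P (Q y)" unfolding \<tau>2_def PQ(2) that(1) ..
      then have "y = \<tau>2 (P x)" by (simp add: PQ)
      moreover have "P x \<in> B'" using that(2) by (simp add: B'_def PQ)
      ultimately show ?thesis by blast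
    qed
    ultimately show ?thesis by blast
  qed
  have ind: "indicator B' y = (indicator B (Q y) :: real)" "indicator (\<tau>2 ` B') y = (indicator (\<tau> ` B) (Q y) :: real)" for y
    unfolding im unfolding B'_def by (auto simp: indicator_def)
  have "(\<integral>\<^sup>+y. ennreal (indicator B' y * p (Q y)) \<partial>lborel) = (\<integral>\<^sup>+y. ennreal (indicator (\<tau>2 ` B') y * f (Q y)) \<partial>lborel)"
  proof (rule nn_integral_change_of_variables_wellorder[where \<tau>' = "\<lambda>y v. P (\<tau>' (Q y) (Q v))"])
    show "B' \<in> sets borel" "\<tau>2 ` B' \<in> sets borel"
      unfolding im unfolding B'_def using B measurable_sets[of Q borel borel] by auto
    show "(\<lambda>x. indicator B' x * p (Q x)) \<in> borel_measurable borel"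
      unfolding ind by (rule measurable_compose[OF _ pm]) simp
    show "(\<lambda>x. indicator (\<tau>2 ` B') x * f (Q x)) \<in> borel_measurable borel"
      unfolding ind by (rule measurable_compose[OF _ fm]) simp
    show "0 \<le> p (Q x)" if "x \<in> B'" for x using that nonneg(1) by (auto simp: B'_def)
    show "0 \<le> f (Q x)" if "x \<in> \<tau>2 ` B'" for x using that nonneg(2) unfolding im by auto
    show "inj_on \<tau>2 B'"
      using inj unfolding inj_on_def \<tau>2_def B'_def by (metis PQ vimage_eq)
    fix y assume y: "y \<in> B'"
    then have d: "(\<tau> has_derivative \<tau>' (Q y)) (at (Q y))" using der by (simp add: B'_def)
    have "((\<lambda>y. \<tau> (Q y)) has_derivative (\<lambda>v. \<tau>' (Q y) (Q v))) (at y)"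
      by (rule has_derivative_compose[OF linear_imp_has_derivative[OF lin(2)] d])
    then show "(\<tau>2 has_derivative (\<lambda>v. P (\<tau>' (Q y) (Q v)))) (at y)"
      unfolding \<tau>2_def by (rule has_derivative_compose[OF _ linear_imp_has_derivative[OF lin(1)]])
    have "linear (\<tau>' (Q y))" using d by (rule has_derivative_linear)
    have "matrix (\<lambda>v. P (\<tau>' (Q y) (Q v))) = (\<chi> i j. matrix (\<tau>' (Q y)) $ b i $ b j)"
    proof -
      have "Q (axis j 1) = axis (b j) 1" for j
        using b by (auto simp: Q_def reindex_def axis_def vec_eq_iff bij_is_inj bij_is_surj surj_f_inv_f inv_f_f)
      then show ?thesis unfolding matrix_def P_def reindex_def by simp
    qed
    then have "det (matrix (\<lambda>v. P (\<tau>' (Q y) (Q v)))) = det (matrix (\<tau>' (Q y)))"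
      by (simp add: det_reindex[OF b])
    then show "p (Q y) = \<bar>det (matrix (\<lambda>v. P (\<tau>' (Q y) (Q v))))\<bar> * f (Q (\<tau>2 y))"
      using p[of "Q y"] y by (simp add: B'_def \<tau>2_def PQ)
  qed
  then show ?thesis
    unfolding ind using nn_integral_distr[of Q lborel borel "\<lambda>x. ennreal (indicator B x * p x)"]
      nn_integral_distr[of Q lborel borel "\<lambda>x. ennreal (indicator (\<tau> ` B) x * f x)"] pm fm
    by (simp add: QL)
qed

context smooth_manifold
begin

section \<open>Charts, Borel sets and scalars\<close>

lemma chart_inv_map: "c \<in> atlas \<Longrightarrow> p \<in> chart_dom c \<Longrightarrow> chart_inv c (chart_map c p) = p"
  and chart_map_inv: "c \<in> atlas \<Longrightarrow> x \<in> chart_img c \<Longrightarrow> chart_map c (chart_inv c x) = x"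
  by (rule homeomorphism_apply1[OF chart_homeo], assumption+)
    (rule homeomorphism_apply2[OF chart_homeo], assumption+)

lemma chart_map_in: "p \<in> chart_dom c \<Longrightarrow> chart_map c p \<in> chart_img c"
  by (simp add: chart_img_def)

lemma chart_inv_in: "c \<in> atlas \<Longrightarrow> x \<in> chart_img c \<Longrightarrow> chart_inv c x \<in> chart_dom c"
  using homeomorphism_image2[OF chart_homeo, of c] by blast

lemma chart_map_continuous: "c \<in> atlas \<Longrightarrow> continuous_on (chart_dom c) (chart_map c)"
  and chart_inv_continuous: "c \<in> atlas \<Longrightarrow> continuous_on (chart_img c) (chart_inv c)"
  by (rule homeomorphism_cont1[OF chart_homeo], assumption)
    (rule homeomorphism_cont2[OF chart_homeo], assumption)

text \<open>Seen as a preimage under the continuous inverse chart, the image of a Borel set is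
  Borel.\<close>

lemma chart_image_eq:
  assumes "c \<in> atlas" "A \<subseteq> chart_dom c"
  shows "chart_map c ` A = chart_img c \<inter> chart_inv c -` A"
proof (intro set_eqI iffI)
  fix x assume "x \<in> chart_map c ` A"
  then show "x \<in> chart_img c \<inter> chart_inv c -` A"
    using assms(2) chart_inv_map[OF assms(1)] chart_map_in[of _ c] by (auto simp: subset_iff)
next
  fix x assume "x \<in> chart_img c \<inter> chart_inv c -` A"
  then show "x \<in> chart_map c ` A" using chart_map_inv[OF assms(1)] by (metis IntD1 IntD2 image_eqI vimage_eq)
qed

lemma chart_inv_measurable:
  "c \<in> atlas \<Longrightarrow> chart_inv c \<in> measurable (restrict_space borel (chart_img c)) borel"
  by (intro borel_measurable_continuous_on_restrict chart_inv_continuous)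

lemma chart_map_measurable:
  "c \<in> atlas \<Longrightarrow> chart_map c \<in> measurable (restrict_space borel (chart_dom c)) (restrict_space borel (chart_img c))"
  by (intro measurable_restrict_space2 borel_measurable_continuous_on_restrict chart_map_continuous)
    (auto simp: space_restrict_space chart_map_in)

lemma chart_image_borel:
  assumes "c \<in> atlas" "A \<in> sets borel" "A \<subseteq> chart_dom c"
  shows "chart_map c ` A \<in> sets borel"
proof -
  have "chart_inv c -` A \<inter> space (restrict_space borel (chart_img c)) \<in> sets (restrict_space borel (chart_img c))"
    by (rule measurable_sets[OF chart_inv_measurable]) (use assms in auto)
  then have "chart_inv c -` A \<inter> chart_img c \<in> sets borel"
    using chart_img_open[OF assms(1)] by (auto simp: space_restrict_space sets_restrict_space_iff)
  then show ?thesis unfolding chart_image_eq[OF assms(1,3)] by (simp add: Int_commute)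
qed

lemma transition_has_derivative:
  assumes "c \<in> atlas" "d \<in> atlas" "p \<in> chart_dom c \<inter> chart_dom d"
  shows "(transition c d has_derivative frechet_derivative (transition c d) (at (chart_map c p))) (at (chart_map c p))"
proof -
  have "Ck_on (Suc 0) (transition c d) (chart_map c ` (chart_dom c \<inter> chart_dom d))"
    using transition_smooth[OF assms(1,2)] unfolding smooth_on_def by blast
  then have "transition c d differentiable (at (chart_map c p))"
    using assms(3) by auto
  then show ?thesis by (simp add: frechet_derivative_works)
qed

lemma transition_map: "c \<in> atlas \<Longrightarrow> p \<in> chart_dom c \<Longrightarrow> transition c d (chart_map c p) = chart_map d p"
  by (simp add: transition_def chart_inv_map)

text \<open>Replaces the arbitrary chart picked by \<open>scalar\<close> by a chart of choice, once
  the expression is known to be independent of the chart at p.\<close>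

lemma scalar_eq:
  assumes "c \<in> atlas" "p \<in> chart_dom c"
    and "\<And>d. d \<in> atlas \<Longrightarrow> p \<in> chart_dom d \<Longrightarrow> F d (chart_map d p) = F c (chart_map c p)"
  shows "scalar atlas F p = F c (chart_map c p)"
proof -
  have "(SOME c. c \<in> atlas \<and> p \<in> chart_dom c) \<in> atlas \<and> p \<in> chart_dom (SOME c. c \<in> atlas \<and> p \<in> chart_dom c)"
    by (rule someI[of _ c]) (use assms in blast)
  then show ?thesis unfolding scalar_def Let_def using assms(3) by blast
qed

lemma obtain_chart:
  obtains c where "c \<in> atlas" "p \<in> chart_dom c"
  using atlas_covers by blast

text \<open>The enumeration lets overlapping domains be made disjoint by removing the earlier
  ones.\<close>

lemma finite_subatlas:
  assumes "compact (UNIV :: 'a set)"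
  obtains f :: "nat \<Rightarrow> ('a, 'n) chart" and n where "\<And>i. i < n \<Longrightarrow> f i \<in> atlas" "(\<Union>i<n. chart_dom (f i)) = UNIV"
proof -
  obtain C where C: "C \<subseteq> atlas" "finite C" "UNIV \<subseteq> (\<Union>c\<in>C. chart_dom c)"
    using compactE_image[OF assms, of atlas chart_dom] chart_dom_open atlas_covers by (metis subset_refl)
  obtain f n where "C = f ` {i::nat. i < n}"
    using C(2) finite_imp_nat_seg_image_inj_on by metis
  then show ?thesis using that[of n f] C by blast
qed

end

context riemannian_manifold
begin

section \<open>Volume in charts and the Riemannian density\<close>

lemma spd_metric: "c \<in> atlas \<Longrightarrow> x \<in> chart_img c \<Longrightarrow> spd (g c x)"
  using metric_symmetric metric_positive by (simp add: spd_def)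

lemma metric_continuous: "c \<in> atlas \<Longrightarrow> continuous_on (chart_img c) (g c)"
  using metric_smooth[of c] unfolding smooth_on_def by (metis Ck_on.simps(1))

definition vol :: "('a, 'n) chart \<Rightarrow> real^'n \<Rightarrow> real" where
  "vol c x = sqrt (det (g c x))"

lemma vol_pos: "c \<in> atlas \<Longrightarrow> x \<in> chart_img c \<Longrightarrow> vol c x > 0"
  unfolding vol_def using spd_det_pos[OF spd_metric] by simp

lemma vol_continuous: "c \<in> atlas \<Longrightarrow> continuous_on (chart_img c) (vol c)"
  unfolding vol_def using metric_continuous by (intro continuous_intros continuous_on_det) auto

lemma vol_measurable: "c \<in> atlas \<Longrightarrow> vol c \<in> borel_measurable (restrict_space borel (chart_img c))"
  by (intro borel_measurable_continuous_on_restrict vol_continuous)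

lemma indicator_vol_measurable:
  assumes "c \<in> atlas" "B \<in> sets borel" "B \<subseteq> chart_img c"
  shows "(\<lambda>x. indicator B x * vol c x) \<in> borel_measurable borel"
proof -
  have "(\<lambda>x. indicator (chart_img c) x *\<^sub>R vol c x) \<in> borel_measurable borel"
    using chart_img_open[OF assms(1)]
    by (intro borel_measurable_continuous_on_indicator vol_continuous assms) auto
  from borel_measurable_times[OF borel_measurable_indicator[OF assms(2)] this]
  show ?thesis by (rule measurable_cong[THEN iffD1, rotated]) (use assms(3) in \<open>auto simp: indicator_def\<close>)
qed

text \<open>Determinants in the transformation law of the metric show that \<open>vol c\<close> is
  \<open>vol d\<close> times the absolute Jacobian determinant of the transition map, which is the
  factor in the change of variables.\<close>

lemma overlap_density:
  assumes c: "c \<in> atlas" and d: "d \<in> atlas" and A: "A \<in> sets borel" "A \<subseteq> chart_dom c \<inter> chart_dom d"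
  shows "(\<integral>\<^sup>+x. ennreal (vol c x) * indicator (chart_map c ` A) x \<partial>lborel) =
    (\<integral>\<^sup>+x. ennreal (vol d x) * indicator (chart_map d ` A) x \<partial>lborel)"
proof -
  have im: "transition c d ` (chart_map c ` A) = chart_map d ` A"
    unfolding image_image using A(2) by (intro image_cong refl) (auto simp: transition_map[OF c])
  have sub: "chart_map c ` A \<subseteq> chart_img c" "chart_map d ` A \<subseteq> chart_img d"
    using A(2) by (auto simp: chart_img_def)
  have bor: "chart_map c ` A \<in> sets borel" "chart_map d ` A \<in> sets borel"
    using A c d by (auto intro!: chart_image_borel)
  have "(\<integral>\<^sup>+x. ennreal (indicator (chart_map c ` A) x * vol c x) \<partial>lborel)
      = (\<integral>\<^sup>+x. ennreal (indicator (transition c d ` (chart_map c ` A)) x * vol d x) \<partial>lborel)"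
  proof (rule nn_integral_change_of_variables[where \<tau>' = "\<lambda>x. frechet_derivative (transition c d) (at x)"])
    show "inj_on (transition c d) (chart_map c ` A)"
    proof (rule inj_onI)
      fix x y assume "x \<in> chart_map c ` A" "y \<in> chart_map c ` A" and eq: "transition c d x = transition c d y"
      then obtain p q where pq: "p \<in> A" "q \<in> A" "x = chart_map c p" "y = chart_map c q" by blast
      have dom: "p \<in> chart_dom c" "q \<in> chart_dom c" "p \<in> chart_dom d" "q \<in> chart_dom d"
        using subsetD[OF A(2) pq(1)] subsetD[OF A(2) pq(2)] by simp_all
      have "chart_map d p = chart_map d q"
        using eq unfolding pq(3,4) transition_map[OF c dom(1)] transition_map[OF c dom(2)] .
      then have "p = q" using chart_inv_map[OF d dom(3)] chart_inv_map[OF d dom(4)] by metis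
      then show "x = y" using pq by simp
    qed
    fix x assume "x \<in> chart_map c ` A"
    then obtain p where p: "p \<in> A" "x = chart_map c p" by blast
    have p': "p \<in> chart_dom c \<inter> chart_dom d" by (rule subsetD[OF A(2) p(1)])
    show "(transition c d has_derivative frechet_derivative (transition c d) (at x)) (at x)"
      unfolding p(2) by (rule transition_has_derivative[OF c d p'])
    define J where "J = matrix (frechet_derivative (transition c d) (at x))"
    have "g c x = transpose J ** g d (chart_map d p) ** J"
      using metric_transforms[OF c d p'] unfolding J_def p(2) by (simp add: Let_def jacobian_def)
    then have "det (g c x) = (det J)\<^sup>2 * det (g d (chart_map d p))"
      by (simp add: det_mul det_transpose power2_eq_square)
    then show "vol c x = \<bar>det (matrix (frechet_derivative (transition c d) (at x)))\<bar> * vol d (transition c d x)"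
      using transition_map[OF c, of p d] p' unfolding J_def[symmetric] by (simp add: vol_def p(2) real_sqrt_mult)
  qed (use bor sub c d indicator_vol_measurable[OF c bor(1) sub(1)] indicator_vol_measurable[OF d bor(2) sub(2)]
      in \<open>auto simp: im intro!: less_imp_le[OF vol_pos]\<close>)
  moreover have "ennreal (indicator B x * v) = ennreal v * indicator B x" for B and x :: "real^'n" and v
    by (cases "x \<in> B") simp_all
  ultimately show ?thesis by (simp only: im)
qed

text \<open>The Riemannian density restricted to one chart domain, as a measure on the whole
  manifold that gives no mass to the rest.\<close>

definition chart_measure :: "('a, 'n) chart \<Rightarrow> 'a measure" where
  "chart_measure c = distr (density (restrict_space lborel (chart_img c)) (\<lambda>x. ennreal (vol c x))) borel (chart_inv c)"

lemma measurable_restrict_lborel: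
  assumes "f \<in> measurable (restrict_space borel S) N"
  shows "f \<in> measurable (restrict_space lborel S) N"
  using assms by (subst measurable_cong_sets[OF sets_restrict_space_cong[OF sets_lborel] refl])

lemma emeasure_chart_measure:
  assumes c: "c \<in> atlas" and A: "A \<in> sets borel"
  shows "emeasure (chart_measure c) A =
    (\<integral>\<^sup>+x. ennreal (vol c x) * indicator (chart_map c ` (A \<inter> chart_dom c)) x \<partial>lborel)"
proof -
  let ?R = "restrict_space lborel (chart_img c)"
  have S: "chart_img c \<in> sets lborel" using chart_img_open[OF c] by simp
  have m: "chart_inv c \<in> measurable ?R borel" "vol c \<in> borel_measurable ?R"
    by (rule measurable_restrict_lborel[OF chart_inv_measurable[OF c]], rule measurable_restrict_lborel[OF vol_measurable[OF c]])
  have "emeasure (chart_measure c) A = emeasure (density ?R (\<lambda>x. ennreal (vol c x))) (chart_inv c -` A \<inter> chart_img c)"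
    unfolding chart_measure_def using m A by (subst emeasure_distr) (auto simp: space_restrict_space)
  also have "\<dots> = (\<integral>\<^sup>+x. ennreal (vol c x) * indicator (chart_inv c -` A \<inter> chart_img c) x \<partial>?R)"
    using measurable_sets[OF m(1) A] m(2) by (intro emeasure_density) (auto simp: space_restrict_space)
  also have "\<dots> = (\<integral>\<^sup>+x. ennreal (vol c x) * indicator (chart_inv c -` A \<inter> chart_img c) x * indicator (chart_img c) x \<partial>lborel)"
    by (rule nn_integral_restrict_space) (use S in simp)
  also have "\<dots> = (\<integral>\<^sup>+x. ennreal (vol c x) * indicator (chart_map c ` (A \<inter> chart_dom c)) x \<partial>lborel)"
    using chart_image_eq[OF c, of "A \<inter> chart_dom c"] chart_inv_in[OF c]
    by (intro nn_integral_cong) (auto simp: indicator_def)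
  finally show ?thesis .
qed

text \<open>The property inside the description that defines \<open>riemannian_density\<close>,
  named so that existence and uniqueness can be stated.\<close>

definition is_density :: "'a measure \<Rightarrow> bool" where
  "is_density \<omega> \<longleftrightarrow> sets \<omega> = sets borel \<and>
     (\<forall>c\<in>atlas. \<forall>A\<in>sets borel. A \<subseteq> chart_dom c \<longrightarrow>
        emeasure \<omega> A = (\<integral>\<^sup>+x. ennreal (sqrt (det (g c x))) * indicator (chart_map c ` A) x \<partial>lborel))"

lemma is_density_eq: "is_density \<omega> \<longleftrightarrow> sets \<omega> = sets borel \<and>
     (\<forall>c\<in>atlas. \<forall>A\<in>sets borel. A \<subseteq> chart_dom c \<longrightarrow> emeasure \<omega> A = emeasure (chart_measure c) A)"
  unfolding is_density_def by (auto simp: emeasure_chart_measure vol_def Int_absorb2)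

lemma chart_measure_overlap:
  assumes "c \<in> atlas" "d \<in> atlas" "A \<in> sets borel" "A \<subseteq> chart_dom c \<inter> chart_dom d"
  shows "emeasure (chart_measure c) A = emeasure (chart_measure d) A"
proof -
  have "A \<inter> chart_dom c = A" "A \<inter> chart_dom d = A" using assms(4) by auto
  then show ?thesis using overlap_density[OF assms] assms by (simp add: emeasure_chart_measure)
qed

text \<open>A finite cover by charts is cut into disjoint Borel pieces \<open>B i\<close>. Summing
  the chart measures over the pieces gives a measure that has the right values in every chart
  because chart measures agree on overlaps; conversely, its values on subsets of the pieces
  determine a density.\<close>

lemma density_exists_unique:
  assumes "compact (UNIV :: 'a set)"
  shows "\<exists>!\<omega>. is_density \<omega>"
proof -
  obtain f :: "nat \<Rightarrow> ('a, 'n) chart" and n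
    where f: "\<And>i. i < n \<Longrightarrow> f i \<in> atlas" and cover: "(\<Union>i<n. chart_dom (f i)) = UNIV"
    by (rule finite_subatlas[OF assms]) (rule that)
  define B where "B i = chart_dom (f i) - (\<Union>j<i. chart_dom (f j))" for i
  have B_borel: "B i \<in> sets borel" if "i < n" for i
    unfolding B_def using that by (intro sets.Diff sets.finite_UN borel_open chart_dom_open f) auto
  have B_sub: "B i \<subseteq> chart_dom (f i)" for i by (auto simp: B_def)
  have B_disj: "disjoint_family_on B {..<n}"
    unfolding disjoint_family_on_def B_def by (metis (no_types, lifting) DiffE UN_iff disjoint_iff lessThan_iff linorder_neqE_nat)
  have B_cover: "(\<Union>i<n. B i) = UNIV"
  proof -
    have "p \<in> (\<Union>i<n. B i)" for p
    proof -
      have ex: "\<exists>i. i < n \<and> p \<in> chart_dom (f i)" using cover by blast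
      define k where "k = (LEAST i. i < n \<and> p \<in> chart_dom (f i))"
      have k: "k < n" "p \<in> chart_dom (f k)" using LeastI_ex[OF ex] unfolding k_def by auto
      have "p \<notin> chart_dom (f j)" if "j < k" for j
        using not_less_Least[of j "\<lambda>i. i < n \<and> p \<in> chart_dom (f i)"] that k(1) unfolding k_def by auto
      then show ?thesis using k unfolding B_def by blast
    qed
    then show ?thesis by blast
  qed
  have split: "(\<Sum>i<n. emeasure \<mu> (A \<inter> B i)) = emeasure \<mu> A" if "sets \<mu> = sets borel" "A \<in> sets borel" for \<mu> :: "'a measure" and A
  proof -
    have "(\<Sum>i<n. emeasure \<mu> (A \<inter> B i)) = emeasure \<mu> (\<Union>i<n. A \<inter> B i)"
    proof (rule sum_emeasure)
      show "disjoint_family_on (\<lambda>i. A \<inter> B i) {..<n}"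
        using B_disj unfolding disjoint_family_on_def by blast
    qed (use that B_borel in auto)
    also have "(\<Union>i<n. A \<inter> B i) = A" using B_cover by blast
    finally show ?thesis .
  qed
  define \<mu> where "\<mu> A = (\<Sum>i<n. emeasure (chart_measure (f i)) (A \<inter> B i))" for A
  have cm[simp]: "sets (chart_measure c) = sets borel" for c by (simp add: chart_measure_def)
  define \<omega> where "\<omega> = measure_of UNIV (sets borel) \<mu>"
  have sets\<omega>: "sets \<omega> = sets borel" unfolding \<omega>_def
    by (metis sets.sigma_sets_eq sets_measure_of space_borel subset_UNIV Pow_UNIV)
  have em: "emeasure \<omega> A = \<mu> A" if "A \<in> sets borel" for A
  proof (rule emeasure_measure_of[OF \<omega>_def])
    show "positive (sets \<omega>) \<mu>" by (simp add: positive_def \<mu>_def)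
    show "countably_additive (sets \<omega>) \<mu>"
    proof (rule countably_additiveI)
      fix A :: "nat \<Rightarrow> 'a set"
      assume A: "range A \<subseteq> sets \<omega>" "disjoint_family A"
      have "(\<Sum>k. \<mu> (A k)) = (\<Sum>i<n. \<Sum>k. emeasure (chart_measure (f i)) (A k \<inter> B i))"
        unfolding \<mu>_def by (rule suminf_sum) simp
      also have "\<dots> = (\<Sum>i<n. emeasure (chart_measure (f i)) (\<Union>k. A k \<inter> B i))"
        by (intro sum.cong refl suminf_emeasure) (use A sets\<omega> B_borel in \<open>auto simp: disjoint_family_on_def\<close>)
      finally show "(\<Sum>k. \<mu> (A k)) = \<mu> (\<Union>k. A k)" by (simp add: \<mu>_def)
    qed
  qed (use that sets\<omega> in auto)
  have "is_density \<omega>"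
    unfolding is_density_eq
  proof (intro conjI sets\<omega> ballI impI)
    fix c A assume c: "c \<in> atlas" and A: "A \<in> sets borel" "A \<subseteq> chart_dom c"
    have "emeasure \<omega> A = (\<Sum>i<n. emeasure (chart_measure c) (A \<inter> B i))"
      unfolding em[OF A(1)] \<mu>_def
      by (intro sum.cong refl chart_measure_overlap) (use f c A B_borel B_sub[THEN subsetD] in auto)
    also have "\<dots> = emeasure (chart_measure c) A" by (rule split) (use A in auto)
    finally show "emeasure \<omega> A = emeasure (chart_measure c) A" .
  qed
  moreover have "\<omega>1 = \<omega>2" if "is_density \<omega>1" "is_density \<omega>2" for \<omega>1 \<omega>2
  proof (rule measure_eqI)
    show s: "sets \<omega>1 = sets \<omega>2" using that by (simp add: is_density_eq)
    fix A assume "A \<in> sets \<omega>1"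
    then have A: "A \<in> sets borel" using that by (simp add: is_density_eq)
    have "emeasure \<omega>1 (A \<inter> B i) = emeasure \<omega>2 (A \<inter> B i)" if "i < n" for i
    proof -
      have "A \<inter> B i \<in> sets borel" "A \<inter> B i \<subseteq> chart_dom (f i)" using A B_borel[OF that] B_sub by auto
      then show ?thesis using \<open>is_density \<omega>1\<close> \<open>is_density \<omega>2\<close> f[OF that] by (simp add: is_density_eq)
    qed
    then show "emeasure \<omega>1 A = emeasure \<omega>2 A"
      using split[of \<omega>1 A] split[of \<omega>2 A] that A by (simp add: is_density_eq)
  qed
  ultimately show ?thesis by blast
qed

lemma is_density_riemannian_density:
  assumes "compact (UNIV :: 'a set)"
  shows "is_density (riemannian_density atlas g)"
  unfolding riemannian_density_def
  using theI'[OF density_exists_unique[OF assms]] unfolding is_density_def .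

lemma sets_riemannian_density:
  "compact (UNIV :: 'a set) \<Longrightarrow> sets (riemannian_density atlas g) = sets borel"
  using is_density_riemannian_density by (simp add: is_density_def)

lemma density_indicator_chart:
  assumes "compact (UNIV :: 'a set)" and c: "c \<in> atlas"
  shows "density (riemannian_density atlas g) (\<lambda>p. ennreal (indicator (chart_dom c) p)) = chart_measure c"
proof (rule measure_eqI)
  let ?\<omega> = "riemannian_density atlas g"
  note S = sets_riemannian_density[OF assms(1)]
  show "sets (density ?\<omega> (\<lambda>p. ennreal (indicator (chart_dom c) p))) = sets (chart_measure c)"
    using S by (simp add: chart_measure_def)
  fix A assume "A \<in> sets (density ?\<omega> (\<lambda>p. ennreal (indicator (chart_dom c) p)))"
  then have A: "A \<in> sets borel" using S by simp
  have D: "chart_dom c \<in> sets borel" using chart_dom_open[OF c] by simp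
  have Dm: "(\<lambda>p. ennreal (indicator (chart_dom c) p)) \<in> borel_measurable ?\<omega>"
    using D S by (intro measurable_compose[OF _ measurable_ennreal] borel_measurable_indicator) simp
  have "emeasure (density ?\<omega> (\<lambda>p. ennreal (indicator (chart_dom c) p))) A
      = (\<integral>\<^sup>+p. ennreal (indicator (chart_dom c) p) * indicator A p \<partial>?\<omega>)"
    by (rule emeasure_density[OF Dm]) (use A S in simp)
  also have "\<dots> = (\<integral>\<^sup>+p. indicator (A \<inter> chart_dom c) p \<partial>?\<omega>)"
    by (intro nn_integral_cong) (auto simp: indicator_def)
  also have "\<dots> = emeasure ?\<omega> (A \<inter> chart_dom c)" using A D S by simp
  also have "\<dots> = emeasure (chart_measure c) (A \<inter> chart_dom c)"
    using is_density_riemannian_density[OF assms(1)] c A D by (simp add: is_density_eq)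
  also have "\<dots> = emeasure (chart_measure c) A"
    using emeasure_chart_measure[OF c, of "A \<inter> chart_dom c"] emeasure_chart_measure[OF c A] A D by (simp add: Int_assoc)
  finally show "emeasure (density ?\<omega> (\<lambda>p. ennreal (indicator (chart_dom c) p))) A = emeasure (chart_measure c) A" .
qed

text \<open>Functions that vanish outside one chart domain are integrated in coordinates; the
  indicator discards the arbitrary values of \<open>chart_inv c\<close> outside the chart
  image.\<close>

lemma
  fixes f :: "'a \<Rightarrow> real"
  assumes "compact (UNIV :: 'a set)" and c: "c \<in> atlas" and f: "f \<in> borel_measurable borel"
    and out: "\<And>p. p \<notin> chart_dom c \<Longrightarrow> f p = 0"
  shows integrable_chart: "integrable (riemannian_density atlas g) f \<longleftrightarrow>
      integrable lborel (\<lambda>x. indicator (chart_img c) x * (vol c x * f (chart_inv c x)))"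
    and integral_chart: "(\<integral>p. f p \<partial>riemannian_density atlas g) =
      (LBINT x. indicator (chart_img c) x * (vol c x * f (chart_inv c x)))"
proof -
  let ?\<omega> = "riemannian_density atlas g" and ?R = "restrict_space lborel (chart_img c)"
  note S = sets_riemannian_density[OF assms(1)]
  have f\<omega>: "f \<in> borel_measurable ?\<omega>" using f by (subst measurable_cong_sets[OF S refl])
  have D: "(\<lambda>p. indicator (chart_dom c) p :: real) \<in> borel_measurable ?\<omega>"
    using chart_dom_open[OF c] S by (intro borel_measurable_indicator) simp
  have I: "chart_img c \<inter> space lborel \<in> sets lborel" using chart_img_open[OF c] by simp
  have m: "chart_inv c \<in> measurable ?R borel" "vol c \<in> borel_measurable ?R"
    by (rule measurable_restrict_lborel[OF chart_inv_measurable[OF c]], rule measurable_restrict_lborel[OF vol_measurable[OF c]])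
  have fi: "(\<lambda>x. f (chart_inv c x)) \<in> borel_measurable ?R" by (rule measurable_compose[OF m(1) f])
  have v: "AE x in ?R. 0 \<le> vol c x"
    by (rule AE_I2) (auto simp: space_restrict_space intro!: less_imp_le[OF vol_pos[OF c]])
  have fd: "(\<lambda>p. indicator (chart_dom c) p * f p) = f" using out by (auto simp: indicator_def fun_eq_iff)
  have md: "chart_inv c \<in> measurable (density ?R (\<lambda>x. ennreal (vol c x))) borel" using m(1) by simp
  have "integrable ?\<omega> f \<longleftrightarrow> integrable (chart_measure c) f"
    unfolding density_indicator_chart[OF assms(1) c, symmetric]
    by (subst integrable_density[OF f\<omega> D]) (auto simp: fd)
  also have "\<dots> \<longleftrightarrow> integrable ?R (\<lambda>x. vol c x *\<^sub>R f (chart_inv c x))"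
    unfolding chart_measure_def integrable_distr_eq[OF md f] by (rule integrable_density[OF fi m(2) v])
  also have "\<dots> \<longleftrightarrow> integrable lborel (\<lambda>x. indicator (chart_img c) x * (vol c x * f (chart_inv c x)))"
    by (subst integrable_restrict_space[OF I]) simp
  finally show "integrable ?\<omega> f \<longleftrightarrow>
      integrable lborel (\<lambda>x. indicator (chart_img c) x * (vol c x * f (chart_inv c x)))" .
  have "(\<integral>p. f p \<partial>?\<omega>) = (\<integral>p. f p \<partial>chart_measure c)"
    unfolding density_indicator_chart[OF assms(1) c, symmetric]
    by (subst integral_density[OF f\<omega> D]) (auto simp: fd)
  also have "\<dots> = (\<integral>x. vol c x *\<^sub>R f (chart_inv c x) \<partial>?R)"
    unfolding chart_measure_def integral_distr[OF md f] by (rule integral_density[OF fi m(2) v])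
  also have "\<dots> = (LBINT x. indicator (chart_img c) x * (vol c x * f (chart_inv c x)))"
    by (subst integral_restrict_space[OF I]) simp
  finally show "(\<integral>p. f p \<partial>?\<omega>) = (LBINT x. indicator (chart_img c) x * (vol c x * f (chart_inv c x)))" .
qed

end

section \<open>Estimates in a chart\<close>

lemma L12_diff:
  assumes "L12 A" "L12 B"
  shows "L12 (\<lambda>x. A x - B x)"
proof -
  have [measurable]: "A \<in> borel_measurable borel" "B \<in> borel_measurable borel"
    and A: "integrable lborel A" "integrable lborel (\<lambda>x. (A x)\<^sup>2)"
    and B: "integrable lborel B" "integrable lborel (\<lambda>x. (B x)\<^sup>2)"
    using assms by (auto simp: L12_def)
  have "integrable lborel (\<lambda>x. A x * B x)" by (rule integrable_mult_L2) (use A B in auto)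
  then have "integrable lborel (\<lambda>x. (A x)\<^sup>2 + (B x)\<^sup>2 - 2 * (A x * B x))" using A B by simp
  then show ?thesis using A B by (simp add: L12_def power2_diff mult.assoc)
qed

lemma L12_sum: "finite I \<Longrightarrow> (\<And>i. i \<in> I \<Longrightarrow> L12 (A i)) \<Longrightarrow> L12 (\<lambda>x. \<Sum>i\<in>I. A i x)"
proof (induction rule: finite_induct)
  case empty
  show ?case by (simp add: L12_def)
next
  case (insert i I)
  \<comment> \<open>The sum is written as a difference, so that \<open>L12_diff\<close> and
    multiplication by the bounded constant -1 suffice.\<close>
  have "L12 (\<lambda>x. A i x - (\<Sum>i\<in>I. A i x) * (- 1))"
    by (intro L12_diff L12_mult_bounded[where m = 1]) (use insert in auto)
  then show ?case using insert by simp
qed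

text \<open>Later B is a closed ball in a chart and l a coordinate functional; the indicator makes a
  component that is controlled on B only into a function on the whole space.\<close>

lemma L12_component:
  fixes h :: "'a::euclidean_space \<Rightarrow> 'b::{banach, second_countable_topology}"
  assumes h: "set_integrable lborel B h" "integrable lborel (\<lambda>x. indicator B x * (norm (h x))\<^sup>2)"
    and l: "bounded_linear l" and le: "\<And>v. \<bar>l v\<bar> \<le> norm v"
  shows "L12 (\<lambda>x. indicator B x * l (h x))"
proof -
  have "integrable lborel (\<lambda>x. l (indicator B x *\<^sub>R h x))"
    using integrable_bounded_linear[OF l] h(1) unfolding set_integrable_def by blast
  then have i: "integrable lborel (\<lambda>x. indicator B x * l (h x))"
    by (simp add: linear_simps(5)[OF l])
  have "(indicator B x * l (h x))\<^sup>2 \<le> indicator B x * (norm (h x))\<^sup>2" for x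
    using power_mono[OF le[of "h x"], of 2] by (simp add: indicator_def)
  then have "integrable lborel (\<lambda>x. (indicator B x * l (h x))\<^sup>2)"
    using borel_measurable_power[OF borel_measurable_integrable[OF i], of 2]
    by (intro Bochner_Integration.integrable_bound[OF h(2)] AE_I2) (auto intro: order_trans[OF _ abs_ge_self])
  then show ?thesis using i borel_measurable_integrable[OF i] by (simp add: L12_def)
qed

text \<open>
  The \<open>t\<close>s stand for components of the covariant derivative, the \<open>s\<close>s for the Christoffel terms, so
  that \<open>t - s\<close> is a partial derivative.
\<close>

lemma jacobian_defect_bound:
  fixes M m w t :: real
  assumes t: "\<bar>t1\<bar> \<le> t" "\<bar>t2\<bar> \<le> t" "\<bar>t3\<bar> \<le> t" "\<bar>t4\<bar> \<le> t"
    and s: "\<bar>s1\<bar> \<le> M * w" "\<bar>s2\<bar> \<le> M * w" "\<bar>s3\<bar> \<le> M * w" "\<bar>s4\<bar> \<le> M * w"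
    and y: "\<bar>y\<bar> \<le> w" and e: "\<bar>e\<bar> \<le> m" "\<bar>e1\<bar> \<le> m" "\<bar>e2\<bar> \<le> m" and "M \<ge> 0" "d > 0"
  shows "\<bar>e * (t1 * t2 - t3 * t4) - (e * ((t1 - s1) * (t2 - s2) - (t3 - s3) * (t4 - s4))
      + y * (e1 * (t2 - s2) - e2 * (t4 - s4)))\<bar>
    \<le> d * t\<^sup>2 + ((m * (4 * M + 2))\<^sup>2 / d + m * (2 * M\<^sup>2 + 2 * M)) * w\<^sup>2"
proof -
  have mm: "\<bar>a * b\<bar> \<le> A * B" if "\<bar>a\<bar> \<le> A" "\<bar>b\<bar> \<le> B" for a b A B :: real
    unfolding abs_mult using that by (intro mult_mono) auto
  \<comment> \<open>What subtracting the s terms changes in the quadratic part: only products with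
    at least one factor s remain.\<close>
  define X where "X = (t1 * s2 + s1 * t2 - s1 * s2) - (t3 * s4 + s3 * t4 - s3 * s4)"
  have X: "\<bar>X\<bar> \<le> 4 * (t * (M * w)) + 2 * ((M * w) * (M * w))"
    unfolding X_def using mm[OF t(1) s(2)] mm[OF s(1) t(2)] mm[OF s(1) s(2)] mm[OF t(3) s(4)] mm[OF s(3) t(4)] mm[OF s(3) s(4)]
    by (simp add: mult.commute[of "M * w" t])
  define Y where "Y = e1 * (t2 - s2) - e2 * (t4 - s4)"
  have "\<bar>t2 - s2\<bar> \<le> t + M * w" "\<bar>t4 - s4\<bar> \<le> t + M * w" using t s by linarith+
  then have Y: "\<bar>Y\<bar> \<le> 2 * (m * (t + M * w))"
    unfolding Y_def using mm[OF e(2), of "t2 - s2" "t + M * w"] mm[OF e(3), of "t4 - s4" "t + M * w"] by linarith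
  have "e * (t1 * t2 - t3 * t4) - (e * ((t1 - s1) * (t2 - s2) - (t3 - s3) * (t4 - s4))
      + y * (e1 * (t2 - s2) - e2 * (t4 - s4))) = e * X - y * Y"
    unfolding X_def Y_def by (simp add: algebra_simps)
  moreover have "\<bar>e * X - y * Y\<bar> \<le> m * (4 * (t * (M * w)) + 2 * ((M * w) * (M * w))) + w * (2 * (m * (t + M * w)))"
    using mm[OF e(1) X] mm[OF y Y] by linarith
  \<comment> \<open>Four mixed products in X and two t terms in Y give 4 M + 2; two products of s
    terms in X and two s terms in Y give 2 M^2 + 2 M.\<close>
  also have "\<dots> = t * (m * (4 * M + 2) * w) + m * (2 * M\<^sup>2 + 2 * M) * w\<^sup>2"
    by (simp add: algebra_simps power2_eq_square)
  also have "t * (m * (4 * M + 2) * w) \<le> d / 2 * t\<^sup>2 + 1 / (2 * d) * (m * (4 * M + 2) * w)\<^sup>2"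
    using abs_mult_le_squares[OF \<open>d > 0\<close>, of t "m * (4 * M + 2) * w"] by linarith
  also have "d / 2 * t\<^sup>2 \<le> d * t\<^sup>2" using \<open>d > 0\<close> by (intro mult_right_mono) auto
  also have "1 / (2 * d) * (m * (4 * M + 2) * w)\<^sup>2 \<le> (m * (4 * M + 2))\<^sup>2 / d * w\<^sup>2"
  proof -
    define z where "z = (m * (4 * M + 2))\<^sup>2 / d * w\<^sup>2"
    have "1 / (2 * d) * (m * (4 * M + 2) * w)\<^sup>2 = z / 2"
      by (simp add: power_mult_distrib z_def)
    moreover have "0 \<le> z" using \<open>d > 0\<close> by (simp add: z_def)
    ultimately show ?thesis unfolding z_def[symmetric] by simp
  qed
  finally show ?thesis by (simp add: algebra_simps)
qed

lemma compact_positive_bounds: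
  fixes f :: "'a::topological_space \<Rightarrow> real"
  assumes "compact K" "continuous_on K f" "\<And>x. x \<in> K \<Longrightarrow> f x > 0"
  obtains l u where "l > 0" "u > 0" "\<And>x. x \<in> K \<Longrightarrow> l \<le> f x \<and> f x \<le> u"
proof (cases "K = {}")
  case True
  then show ?thesis using that[of 1 1] by simp
next
  case False
  obtain x where x: "x \<in> K" "\<And>y. y \<in> K \<Longrightarrow> f x \<le> f y"
    using continuous_attains_inf[OF assms(1) False assms(2)] by blast
  obtain z where z: "z \<in> K" "\<And>y. y \<in> K \<Longrightarrow> f y \<le> f z"
    using continuous_attains_sup[OF assms(1) False assms(2)] by blast
  show ?thesis by (rule that[of "f x" "f z"]) (use x z assms(3) in auto)
qed

context riemannian_manifold
begin

section \<open>Pointwise quantities in different charts\<close>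

abbreviation density_M :: "'a measure" where "density_M \<equiv> riemannian_density atlas g"
abbreviation "vf_sq u \<equiv> inner_vf atlas g u u"
abbreviation "tf_sq T \<equiv> inner_tf atlas g T T"
abbreviation "vf_energy u \<equiv> (\<integral>p. vf_sq u p \<partial>density_M)"
abbreviation "tf_energy T \<equiv> (\<integral>p. tf_sq T p \<partial>density_M)"
abbreviation "grad v \<equiv> nabla atlas g v"

definition jac :: "('a, 'n) chart \<Rightarrow> ('a, 'n) chart \<Rightarrow> 'a \<Rightarrow> real^'n^'n" where
  "jac c d p = jacobian (transition c d) (at (chart_map c p))"

lemma metric_jac:
  "c \<in> atlas \<Longrightarrow> d \<in> atlas \<Longrightarrow> p \<in> chart_dom c \<Longrightarrow> p \<in> chart_dom d \<Longrightarrow>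
    g c (chart_map c p) = transpose (jac c d p) ** g d (chart_map d p) ** jac c d p"
  using metric_transforms[of c d p] by (simp add: Let_def jac_def)

lemma vector_field_jac:
  "vector_field atlas u \<Longrightarrow> c \<in> atlas \<Longrightarrow> d \<in> atlas \<Longrightarrow> p \<in> chart_dom c \<Longrightarrow> p \<in> chart_dom d \<Longrightarrow>
    u d (chart_map d p) = jac c d p *v u c (chart_map c p)"
  unfolding vector_field_def Let_def jac_def by blast

lemma tensor_field_jac:
  "tensor11_field atlas T \<Longrightarrow> c \<in> atlas \<Longrightarrow> d \<in> atlas \<Longrightarrow> p \<in> chart_dom c \<Longrightarrow> p \<in> chart_dom d \<Longrightarrow>
    T d (chart_map d p) ** jac c d p = jac c d p ** T c (chart_map c p)"
  unfolding tensor11_field_def Let_def jac_def by blast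

lemma spd_at: "c \<in> atlas \<Longrightarrow> p \<in> chart_dom c \<Longrightarrow> spd (g c (chart_map c p))"
  by (intro spd_metric chart_map_in)

lemma jac_invertible:
  assumes "c \<in> atlas" "d \<in> atlas" "p \<in> chart_dom c" "p \<in> chart_dom d"
  shows "invertible (jac c d p)"
  by (rule spd_congruence_invertible[OF spd_at[OF assms(1,3)] metric_jac[OF assms]])

lemma inner_vf_chart:
  assumes u: "vector_field atlas u" and c: "c \<in> atlas" "p \<in> chart_dom c"
  shows "vf_sq u p = inner_g (g c (chart_map c p)) (u c (chart_map c p)) (u c (chart_map c p))"
  unfolding inner_vf_def
proof (rule scalar_eq[OF c])
  fix d assume d: "d \<in> atlas" "p \<in> chart_dom d"
  show "inner_g (g d (chart_map d p)) (u d (chart_map d p)) (u d (chart_map d p))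
      = inner_g (g c (chart_map c p)) (u c (chart_map c p)) (u c (chart_map c p))"
    unfolding inner_g_congruence[OF metric_jac[OF c(1) d(1) c(2) d(2)]] vector_field_jac[OF u c(1) d(1) c(2) d(2)] ..
qed

lemma inner_vf_nonneg:
  assumes "vector_field atlas u"
  shows "vf_sq u p \<ge> 0"
proof -
  obtain c where c: "c \<in> atlas" "p \<in> chart_dom c" by (rule obtain_chart)
  have "inner_g G v v \<ge> 0" if "spd G" for G :: "real^'n^'n" and v
    using that by (cases "v = 0") (auto simp: spd_def inner_g_def less_imp_le)
  then show ?thesis unfolding inner_vf_chart[OF assms c] using spd_at[OF c] by blast
qed

lemma scalar_trace_chart:
  assumes T: "tensor11_field atlas T" and c: "c \<in> atlas" "p \<in> chart_dom c"
  shows "scalar atlas (\<lambda>c x. trace (T c x ** T c x)) p = trace (T c (chart_map c p) ** T c (chart_map c p))"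
    and "scalar atlas (\<lambda>c x. (trace (T c x))\<^sup>2) p = (trace (T c (chart_map c p)))\<^sup>2"
proof -
  have tr: "trace (T d (chart_map d p) ** T d (chart_map d p)) = trace (T c (chart_map c p) ** T c (chart_map c p))"
    "trace (T d (chart_map d p)) = trace (T c (chart_map c p))"
    if d: "d \<in> atlas" "p \<in> chart_dom d" for d
  proof -
    note J = jac_invertible[OF c(1) d(1) c(2) d(2)] and TJ = tensor_field_jac[OF T c(1) d(1) c(2) d(2)]
    show "trace (T d (chart_map d p)) = trace (T c (chart_map c p))"
      by (rule trace_similar[OF TJ J])
    have "T d (chart_map d p) ** T d (chart_map d p) ** jac c d p = jac c d p ** (T c (chart_map c p) ** T c (chart_map c p))"
      unfolding matrix_mul_assoc[symmetric, of "T d (chart_map d p)"] TJ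
      unfolding matrix_mul_assoc TJ ..
    then show "trace (T d (chart_map d p) ** T d (chart_map d p)) = trace (T c (chart_map c p) ** T c (chart_map c p))"
      by (rule trace_similar[OF _ J])
  qed
  show "scalar atlas (\<lambda>c x. trace (T c x ** T c x)) p = trace (T c (chart_map c p) ** T c (chart_map c p))"
    by (rule scalar_eq[OF c]) (rule tr)
  show "scalar atlas (\<lambda>c x. (trace (T c x))\<^sup>2) p = (trace (T c (chart_map c p)))\<^sup>2"
    by (rule scalar_eq[OF c]) (simp only: tr)
qed

lemma inner_tf_chart:
  assumes c: "c \<in> atlas" "p \<in> chart_dom c"
    and A: "\<And>d. d \<in> atlas \<Longrightarrow> p \<in> chart_dom d \<Longrightarrow> A d (chart_map d p) ** jac c d p = jac c d p ** A c (chart_map c p)"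
  shows "inner_tf atlas g A A p = tensor_inner_g (g c (chart_map c p)) (A c (chart_map c p)) (A c (chart_map c p))"
  unfolding inner_tf_def
proof (rule scalar_eq[OF c])
  fix d assume d: "d \<in> atlas" "p \<in> chart_dom d"
  show "tensor_inner_g (g d (chart_map d p)) (A d (chart_map d p)) (A d (chart_map d p))
      = tensor_inner_g (g c (chart_map c p)) (A c (chart_map c p)) (A c (chart_map c p))"
    by (rule tensor_inner_g_congruence[OF spd_at[OF c] spd_at[OF d] metric_jac[OF c(1) d(1) c(2) d(2)] A[OF d] A[OF d]])
qed

text \<open>With t = 0 this is the transformation law of \<open>S_tensor\<close>. With t = 2/n times
  the trace, which has the same value in all charts, it is that of \<open>C_tensor\<close>.\<close>

lemma symmetrized_jac:
  assumes T: "tensor11_field atlas T" and c: "c \<in> atlas" "p \<in> chart_dom c" and d: "d \<in> atlas" "p \<in> chart_dom d"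
  shows "(T d (chart_map d p) + adjoint_g (g d (chart_map d p)) (T d (chart_map d p)) - t *\<^sub>R mat 1) ** jac c d p
    = jac c d p ** (T c (chart_map c p) + adjoint_g (g c (chart_map c p)) (T c (chart_map c p)) - t *\<^sub>R mat 1)"
proof -
  note TJ = tensor_field_jac[OF T c(1) d(1) c(2) d(2)]
  note aJ = adjoint_g_congruence[OF spd_at[OF c] spd_at[OF d] metric_jac[OF c(1) d(1) c(2) d(2)] TJ]
  have "(t *\<^sub>R mat 1) ** jac c d p = jac c d p ** (t *\<^sub>R mat 1)"
    by (simp only: scalar_matrix_assoc[symmetric] matrix_scalar_ac matrix_mul_lid matrix_mul_rid)
  then have "(- t *\<^sub>R mat 1) ** jac c d p = jac c d p ** (- t *\<^sub>R mat 1)"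
    by (simp only: scalar_matrix_assoc[symmetric] matrix_scalar_ac matrix_mul_lid matrix_mul_rid)
  with TJ aJ show ?thesis
    unfolding diff_conv_add_uminus scaleR_minus_left[symmetric] matrix_add_ldistrib matrix_add_rdistrib by simp
qed

definition tr_sq :: "('a, 'n, real^'n^'n) components \<Rightarrow> 'a \<Rightarrow> real" where
  "tr_sq T = scalar atlas (\<lambda>c x. trace (T c x ** T c x))"

definition sq_tr :: "('a, 'n, real^'n^'n) components \<Rightarrow> 'a \<Rightarrow> real" where
  "sq_tr T = scalar atlas (\<lambda>c x. (trace (T c x))\<^sup>2)"

text \<open>All quantities are scalars, so each claim may be checked at p in one chart, where it
  concerns a single matrix.\<close>

lemma inner_tf_trace:
  assumes T: "tensor11_field atlas T"
  shows "inner_tf atlas g (\<lambda>c x. T c x + adjoint_g (g c x) (T c x)) (\<lambda>c x. T c x + adjoint_g (g c x) (T c x)) p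
      = 2 * tf_sq T p + 2 * tr_sq T p" (is ?S)
    and "inner_tf atlas g (\<lambda>c x. T c x + adjoint_g (g c x) (T c x) - (2 / CARD('n) * trace (T c x)) *\<^sub>R mat 1)
        (\<lambda>c x. T c x + adjoint_g (g c x) (T c x) - (2 / CARD('n) * trace (T c x)) *\<^sub>R mat 1) p
      = 2 * tf_sq T p + 2 * tr_sq T p - 4 / CARD('n) * sq_tr T p" (is ?C)
    and "tf_sq T p \<ge> 0"
    and "\<bar>tr_sq T p\<bar> \<le> tf_sq T p"
    and "0 \<le> sq_tr T p" "sq_tr T p \<le> CARD('n) * tf_sq T p"
proof -
  obtain c where c: "c \<in> atlas" "p \<in> chart_dom c" by (rule obtain_chart)
  note TJ = tensor_field_jac[OF T c(1) _ c(2)]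
  have N: "tf_sq T p = tensor_inner_g (g c (chart_map c p)) (T c (chart_map c p)) (T c (chart_map c p))"
    by (rule inner_tf_chart[where A = T, OF c TJ])
  note tr = scalar_trace_chart[OF T c, folded tr_sq_def sq_tr_def]
  note spd = spd_at[OF c]
  show ?S
    unfolding N tr tensor_inner_symmetrized[OF spd, symmetric]
    by (rule inner_tf_chart[OF c]) (use symmetrized_jac[OF T c, of _ 0] in simp)
  have t: "trace (T d (chart_map d p)) = trace (T c (chart_map c p))" if "d \<in> atlas" "p \<in> chart_dom d" for d
    by (rule trace_similar[OF TJ[OF that] jac_invertible[OF c(1) that(1) c(2) that(2)]])
  show ?C
    unfolding N tr tensor_inner_conformal[OF spd, symmetric]
    by (rule inner_tf_chart[OF c]) (simp only: t symmetrized_jac[OF T c])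
  show "tf_sq T p \<ge> 0" unfolding N by (rule tensor_inner_nonneg[OF spd])
  show "\<bar>tr_sq T p\<bar> \<le> tf_sq T p" unfolding N tr by (rule trace_square_le[OF spd])
  show "0 \<le> sq_tr T p" unfolding tr by simp
  show "sq_tr T p \<le> CARD('n) * tf_sq T p" unfolding N tr by (rule square_trace_le[OF spd])
qed

text \<open>\<open>scalar\<close> chooses its chart separately at every point, so measurability
  cannot be read off from its definition; it is checked on each of finitely many chart domains that
  cover the manifold.\<close>

lemma measurable_by_charts:
  assumes "compact (UNIV :: 'a set)"
    and F: "\<And>c. c \<in> atlas \<Longrightarrow> F c \<in> borel_measurable (restrict_space borel (chart_img c))"
    and eq: "\<And>c p. c \<in> atlas \<Longrightarrow> p \<in> chart_dom c \<Longrightarrow> s p = F c (chart_map c p)"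
  shows "(s :: 'a \<Rightarrow> real) \<in> borel_measurable borel"
proof -
  obtain f :: "nat \<Rightarrow> ('a, 'n) chart" and n
    where f: "\<And>i. i < n \<Longrightarrow> f i \<in> atlas" and cover: "(\<Union>i<n. chart_dom (f i)) = UNIV"
    by (rule finite_subatlas[OF assms(1)]) (rule that)
  show ?thesis
  proof (rule measurable_piecewise_restrict[where C = "(\<lambda>i. chart_dom (f i)) ` {..<n}"])
    fix \<Omega> assume "\<Omega> \<in> (\<lambda>i. chart_dom (f i)) ` {..<n}"
    then obtain i where i: "i < n" "\<Omega> = chart_dom (f i)" by blast
    show "\<Omega> \<inter> space borel \<in> sets borel" using chart_dom_open[OF f[OF i(1)]] i(2) by simp
    have "(\<lambda>p. F (f i) (chart_map (f i) p)) \<in> borel_measurable (restrict_space borel \<Omega>)"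
      unfolding i(2) by (rule measurable_compose[OF chart_map_measurable[OF f[OF i(1)]] F[OF f[OF i(1)]]])
    then show "s \<in> borel_measurable (restrict_space borel \<Omega>)"
      by (rule measurable_cong[THEN iffD1, rotated])
        (use eq[OF f[OF i(1)]] in \<open>simp add: space_restrict_space i(2)\<close>)
  qed (use cover in auto)
qed

lemma trace_measurable:
  assumes "compact (UNIV :: 'a set)" and T: "tensor11_field atlas T"
  shows "tr_sq T \<in> borel_measurable borel" "sq_tr T \<in> borel_measurable borel"
proof -
  have m: "T c \<in> borel_measurable (restrict_space borel (chart_img c))" if "c \<in> atlas" for c
    using T that unfolding tensor11_field_def by blast
  have "continuous_on UNIV (\<lambda>A::real^'n^'n. trace (A ** A))" "continuous_on UNIV (\<lambda>A::real^'n^'n. (trace A)\<^sup>2)"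
    unfolding trace_def matrix_matrix_mult_def by (intro continuous_intros | simp)+
  note b = this[THEN borel_measurable_continuous_onI]
  show "tr_sq T \<in> borel_measurable borel"
    unfolding tr_sq_def
    by (rule measurable_by_charts[OF assms(1) measurable_compose[OF m b(1)]], assumption) (rule scalar_trace_chart(1)[OF T])
  show "sq_tr T \<in> borel_measurable borel"
    unfolding sq_tr_def
    by (rule measurable_by_charts[OF assms(1) measurable_compose[OF m b(2)]], assumption) (rule scalar_trace_chart(2)[OF T])
qed

text \<open>First derivatives of the metric and the inverse metric are continuous. This bounds the
  lower-order terms on a closed ball in the chart.\<close>

lemma christoffel_continuous:
  assumes c: "c \<in> atlas"
  shows "continuous_on (chart_img c) (christoffel g c k i j)"
proof -
  have "Ck_on (Suc 0) (g c) (chart_img c)" using metric_smooth[OF c] unfolding smooth_on_def by blast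
  then have diff: "\<And>x. x \<in> chart_img c \<Longrightarrow> g c differentiable (at x)"
    and cont: "\<And>i. continuous_on (chart_img c) (partial i (g c))" by auto
  have comp: "partial i (\<lambda>y. g c y $ j $ l) x = partial i (g c) x $ j $ l" if "x \<in> chart_img c" for i j l x
  proof -
    have "((\<lambda>y. g c y $ j $ l) has_derivative (\<lambda>v. frechet_derivative (g c) (at x) v $ j $ l)) (at x)"
      using diff[OF that] unfolding frechet_derivative_works
      by (intro bounded_linear.has_derivative[OF bounded_linear_vec_nth])
    from partial_eqI[OF this] show ?thesis by (simp add: partial_def)
  qed
  have inv: "continuous_on (chart_img c) (\<lambda>x. matrix_inv (g c x))"
    by (rule continuous_on_matrix_inv[OF metric_continuous[OF c]]) (use spd_det_pos[OF spd_metric[OF c]] in force)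
  have "continuous_on (chart_img c) (\<lambda>x. 1 / 2 * (\<Sum>l\<in>UNIV. matrix_inv (g c x) $ k $ l *
     (partial i (g c) x $ j $ l + partial j (g c) x $ i $ l - partial l (g c) x $ i $ j)))"
    by (intro continuous_intros inv cont)
  then show ?thesis
    by (rule continuous_on_eq) (simp add: christoffel_def comp)
qed

text \<open>\<open>nabla\<close> merely selects a weak derivative, so the estimates are stated for
  every square-integrable weak derivative T of u, and the selected one is inserted at the
  end.\<close>

definition admissible :: "('a, 'n, real^'n) components \<Rightarrow> ('a, 'n, real^'n^'n) components \<Rightarrow> bool" where
  "admissible u T \<longleftrightarrow> vector_field atlas u \<and> integrable density_M (vf_sq u) \<and>
     weak_nabla atlas g u T \<and> integrable density_M (tf_sq T)"

text \<open>H stands for the squared intrinsic norm of u or of T. On B the factor 1/m passes from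
  coordinate norms to H, and 1/v passes from Lebesgue measure to the Riemannian density.\<close>

lemma local_square_integrable:
  fixes h :: "real^'n \<Rightarrow> 'b::{banach, second_countable_topology}"
  assumes cpt: "compact (UNIV :: 'a set)" and c: "c \<in> atlas" and B: "compact B" "B \<subseteq> chart_img c"
    and H: "integrable density_M H" "\<And>p. H p \<ge> 0"
    and m: "m > 0" "\<And>x. x \<in> B \<Longrightarrow> m * (norm (h x))\<^sup>2 \<le> H (chart_inv c x)"
    and v: "v > 0" "\<And>x. x \<in> B \<Longrightarrow> v \<le> vol c x"
    and h: "set_integrable lborel B h"
  shows "integrable lborel (\<lambda>x. indicator B x * (norm (h x))\<^sup>2)"
    and "(LBINT x. indicator B x * (norm (h x))\<^sup>2) \<le> 1 / (m * v) * (\<integral>p. H p \<partial>density_M)"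
proof -
  let ?k = "\<lambda>x. indicator B x * (vol c x * H (chart_inv c x))"
  \<comment> \<open>The part of the manifold that corresponds to B; restricting H to it makes the
    chart formula applicable.\<close>
  define BM where "BM = chart_dom c \<inter> chart_map c -` B"
  have Bb: "B \<in> sets borel" using B(1) by (simp add: borel_compact)
  have "chart_map c -` B \<inter> space (restrict_space borel (chart_dom c)) \<in> sets (restrict_space borel (chart_dom c))"
    by (rule measurable_sets[OF borel_measurable_continuous_on_restrict[OF chart_map_continuous[OF c]]]) (use Bb in simp)
  then have BM: "BM \<in> sets borel"
    using chart_dom_open[OF c] unfolding BM_def by (auto simp: space_restrict_space sets_restrict_space_iff Int_commute)
  note S = sets_riemannian_density[OF cpt]
  have Hm: "H \<in> borel_measurable borel" using borel_measurable_integrable[OF H(1)] measurable_cong_sets[OF S refl] by blast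
  have BMH: "integrable density_M (\<lambda>p. indicator BM p * H p)"
    using integrable_mult_indicator[OF _ H(1), of BM] BM S by simp
  have BMHm: "(\<lambda>p. indicator BM p * H p) \<in> borel_measurable borel" using BM Hm by simp
  have out: "indicator BM p * H p = 0" if "p \<notin> chart_dom c" for p using that by (simp add: BM_def)
  have eq: "indicator (chart_img c) x * (vol c x * (indicator BM (chart_inv c x) * H (chart_inv c x)))
      = ?k x" for x
  proof (cases "x \<in> chart_img c")
    case True
    then have "chart_inv c x \<in> BM \<longleftrightarrow> x \<in> B"
      unfolding BM_def using chart_inv_in[OF c True] chart_map_inv[OF c True] by simp
    then show ?thesis using True by (simp add: indicator_def)
  next
    case False
    then show ?thesis using B(2) by (auto simp: indicator_def)
  qed
  have int: "integrable lborel (\<lambda>x. ?k x)"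
  proof -
    have "integrable density_M (\<lambda>p. indicator BM p * H p) \<longleftrightarrow> integrable lborel (\<lambda>x. indicator (chart_img c) x
        * (vol c x * (indicator BM (chart_inv c x) * H (chart_inv c x))))"
      by (rule integrable_chart[OF cpt c BMHm out])
    with BMH show ?thesis by (simp only: eq)
  qed
  have "(LBINT x. ?k x) = (\<integral>p. indicator BM p * H p \<partial>density_M)"
  proof -
    have "(\<integral>p. indicator BM p * H p \<partial>density_M) = (LBINT x. indicator (chart_img c) x
        * (vol c x * (indicator BM (chart_inv c x) * H (chart_inv c x))))"
      by (rule integral_chart[OF cpt c BMHm out])
    then show ?thesis by (simp only: eq)
  qed
  also have "\<dots> \<le> (\<integral>p. H p \<partial>density_M)"
    by (rule integral_mono[OF BMH H(1)]) (use H(2) in \<open>auto simp: indicator_def\<close>)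
  finally have le: "(LBINT x. ?k x) \<le> (\<integral>p. H p \<partial>density_M)" .
  have bd: "indicator B x * (norm (h x))\<^sup>2 \<le> 1 / (m * v) * ?k x" for x
  proof (cases "x \<in> B")
    case True
    have "v * (m * (norm (h x))\<^sup>2) \<le> vol c x * H (chart_inv c x)"
      using m v True by (intro mult_mono) (auto intro: order_trans[OF less_imp_le v(2)])
    then show ?thesis using True m(1) v(1) by (simp add: field_simps)
  qed simp
  have "(\<lambda>x. norm (indicator B x *\<^sub>R h x)) \<in> borel_measurable borel"
    using measurable_compose[OF borel_measurable_integrable[OF h[unfolded set_integrable_def]]
        borel_measurable_continuous_onI[OF continuous_on_norm_id]] by simp
  then have "(\<lambda>x. (norm (indicator B x *\<^sub>R h x))\<^sup>2) \<in> borel_measurable borel" by (intro borel_measurable_power)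
  moreover have "(norm (indicator B x *\<^sub>R h x))\<^sup>2 = indicator B x * (norm (h x))\<^sup>2" for x
    by (simp add: indicator_def)
  ultimately have meas: "(\<lambda>x. indicator B x * (norm (h x))\<^sup>2) \<in> borel_measurable lborel" by simp
  show i: "integrable lborel (\<lambda>x. indicator B x * (norm (h x))\<^sup>2)"
  proof (rule Bochner_Integration.integrable_bound[OF _ meas])
    show "integrable lborel (\<lambda>x. 1 / (m * v) * ?k x)"
      using int by (rule integrable_mult_right)
    show "AE x in lborel. norm (indicator B x * (norm (h x))\<^sup>2) \<le> norm (1 / (m * v) * ?k x)"
    proof (rule AE_I2)
      fix x
      have "norm (indicator B x * (norm (h x))\<^sup>2) = indicator B x * (norm (h x))\<^sup>2" by (simp add: indicator_def)
      with bd[of x] show "norm (indicator B x * (norm (h x))\<^sup>2) \<le> norm (1 / (m * v) * ?k x)"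
        unfolding real_norm_def by linarith
    qed
  qed
  have "(LBINT x. indicator B x * (norm (h x))\<^sup>2) \<le> (LBINT x. 1 / (m * v) * ?k x)"
    by (rule integral_mono[OF i integrable_mult_right[OF int] bd])
  also have "\<dots> = 1 / (m * v) * (LBINT x. ?k x)" by simp
  also have "\<dots> \<le> 1 / (m * v) * (\<integral>p. H p \<partial>density_M)" using le m(1) v(1) by (intro mult_left_mono) auto
  finally show "(LBINT x. indicator B x * (norm (h x))\<^sup>2) \<le> 1 / (m * v) * (\<integral>p. H p \<partial>density_M)" .
qed

section \<open>Estimate of the null form near a point\<close>

abbreviation "null_form w T \<equiv> (\<integral>p. w p * (tr_sq T p - sq_tr T p) \<partial>density_M)"

text \<open>The constants m and M will bound a finite sum of weights from below and above. The
  constant K may depend on \<delta>, but not on u and T.\<close>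

definition local_weight :: "'a \<Rightarrow> 'a set \<Rightarrow> ('a \<Rightarrow> real) \<Rightarrow> real \<Rightarrow> real \<Rightarrow> bool" where
  "local_weight p0 W \<theta> m M \<longleftrightarrow> open W \<and> p0 \<in> W \<and> 0 < m \<and> \<theta> \<in> borel_measurable borel \<and>
    (\<forall>p. 0 \<le> \<theta> p \<and> \<theta> p \<le> M) \<and> (\<forall>p\<in>W. m \<le> \<theta> p) \<and>
    (\<forall>\<delta>>0. \<exists>K. \<forall>u T. admissible u T \<longrightarrow>
      \<bar>null_form \<theta> T\<bar>
        \<le> \<delta> * tf_energy T + K * vf_energy u)"

text \<open>The weak Jacobian identity is applied to each pair of components of u in a chart. It
  concerns coordinate derivatives; passing to covariant ones costs terms with a factor u, which
  Young's inequality absorbs.\<close>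

lemma local_estimate:
  assumes cpt: "compact (UNIV :: 'a set)"
  shows "\<exists>W \<theta> m M. local_weight p0 W \<theta> m M"
proof -
  obtain c where c: "c \<in> atlas" "p0 \<in> chart_dom c" by (rule obtain_chart)
  define a where "a = chart_map c p0"
  have "a \<in> chart_img c" unfolding a_def by (rule chart_map_in[OF c(2)])
  then obtain R where R: "R > 0" "cball a R \<subseteq> chart_img c"
    using chart_img_open[OF c(1)] open_contains_cball by metis
  \<comment> \<open>The smaller radius leaves room for the mollifier between the support of \<eta>
    and the boundary of B.\<close>
  define r where "r = R / 2"
  have r: "r > 0" "r < R" using R(1) by (auto simp: r_def)
  define B where "B = cball a R"
  have B: "compact B" "B \<subseteq> chart_img c" using R(2) by (auto simp: B_def)
  have Bb: "B \<in> sets borel" unfolding B_def by simp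
  define \<eta> where "\<eta> = bump 0 (r\<^sup>2) a"
  have \<eta>: "bump_alg \<eta>" unfolding \<eta>_def by (rule bump_alg.bump)
  have \<eta>_out: "\<eta> x = 0" if "x \<notin> cball a r" for x
    using bump_eq_0[OF r(1), of x a 0] that by (simp add: \<eta>_def dist_commute)
  have \<eta>_outB: "\<eta> x = 0" if "x \<notin> B" for x using \<eta>_out[of x] that r by (auto simp: B_def)
  have \<eta>_nonneg: "\<eta> x \<ge> 0" for x by (simp add: \<eta>_def bump_nonneg)
  obtain m\<eta> where m\<eta>: "\<And>x. \<bar>\<eta> x\<bar> \<le> m\<eta>" using bump_alg_bounded[OF \<eta> compact_cball \<eta>_out] by blast
  have d\<eta>_out: "partial i \<eta> x = 0" if "x \<notin> B" for i x
    by (rule partial_eq_0_outside[where K = B]) (use that \<eta>_outB B(1) in \<open>auto intro: compact_imp_closed\<close>)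
  have "\<exists>m. \<forall>x. \<bar>partial i \<eta> x\<bar> \<le> m" for i
    using bump_alg_bounded[OF bump_alg_partial[OF \<eta>] B(1) d\<eta>_out] by metis
  then obtain md where md: "\<And>i x. \<bar>partial i \<eta> x\<bar> \<le> md i" by metis
  define mm where "mm = max m\<eta> (Max (range md))"
  have mm: "\<bar>\<eta> x\<bar> \<le> mm" "\<bar>partial i \<eta> x\<bar> \<le> mm" for i x
  proof -
    show "\<bar>\<eta> x\<bar> \<le> mm" using m\<eta>[of x] unfolding mm_def by simp
    have "md i \<le> Max (range md)" by simp
    also have "\<dots> \<le> mm" unfolding mm_def by simp
    finally show "\<bar>partial i \<eta> x\<bar> \<le> mm" using md[of i x] by simp
  qed
  obtain v0 v1 where v: "v0 > 0" "v1 > 0" "\<And>x. x \<in> B \<Longrightarrow> v0 \<le> vol c x \<and> vol c x \<le> v1"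
  proof (rule compact_positive_bounds[OF B(1), of "vol c"])
    show "continuous_on B (vol c)" using vol_continuous[OF c(1)] B(2) by (rule continuous_on_subset)
    show "0 < vol c x" if "x \<in> B" for x using vol_pos[OF c(1)] B(2) that by blast
  qed (rule that)
  obtain e0 where e0: "e0 > 0" "\<And>x. x \<in> cball a (r / 2) \<Longrightarrow> e0 \<le> \<eta> x"
  proof (rule compact_positive_bounds[of "cball a (r / 2)" \<eta>])
    show "continuous_on (cball a (r / 2)) \<eta>" by (rule bump_alg_continuous[OF \<eta>])
    show "0 < \<eta> x" if "x \<in> cball a (r / 2)" for x
      using that r(1) bump_pos_iff[OF r(1), of 0 a x] by (simp add: \<eta>_def dist_commute)
    show thesis if "0 < l" "0 < u" "\<And>x. x \<in> cball a (r / 2) \<Longrightarrow> l \<le> \<eta> x \<and> \<eta> x \<le> u" for l u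
      by (rule \<open>\<And>e0. 0 < e0 \<Longrightarrow> (\<And>x. x \<in> cball a (r / 2) \<Longrightarrow> e0 \<le> \<eta> x) \<Longrightarrow> thesis\<close>[OF that(1)]) (use that(3) in blast)
  qed simp
  obtain m0 where m0: "m0 > 0" "\<And>x v. x \<in> B \<Longrightarrow> m0 * (norm v)\<^sup>2 \<le> inner_g (g c x) v v"
    "\<And>x A. x \<in> B \<Longrightarrow> m0 * (norm A)\<^sup>2 \<le> tensor_inner_g (g c x) A A"
  proof (rule spd_uniform_bound[OF B(1), of "g c"])
    show "continuous_on B (g c)" using metric_continuous[OF c(1)] B(2) by (rule continuous_on_subset)
    show "spd (g c x)" if "x \<in> B" for x using spd_metric[OF c(1)] B(2) that by blast
  qed (rule that)
  have "\<exists>m. \<forall>x\<in>B. \<bar>christoffel g c k i j x\<bar> \<le> m" for k i j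
  proof -
    have "bounded (christoffel g c k i j ` B)"
      by (intro compact_imp_bounded compact_continuous_image B(1) continuous_on_subset[OF christoffel_continuous[OF c(1)] B(2)])
    then show ?thesis by (auto simp: bounded_iff)
  qed
  then obtain mg where mg: "\<And>k i j x. x \<in> B \<Longrightarrow> \<bar>christoffel g c k i j x\<bar> \<le> mg k i j" by metis
  \<comment> \<open>Taking the maximum with 0 lets the bound also hold outside B, where the cut-off
    symbols are 0.\<close>
  define G where "G = max 0 (Max (range (\<lambda>(k, i, j). mg k i j)))"
  have "mg k i j \<le> G" for k i j
  proof -
    have "mg k i j \<in> range (\<lambda>(k, i, j). mg k i j)" by (metis (mono_tags, lifting) case_prod_conv rangeI)
    then show ?thesis unfolding G_def by (simp add: le_max_iff_disj)
  qed
  then have G: "\<bar>indicator B x * christoffel g c k i j x\<bar> \<le> G" for k i j x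
    using mg[of x k i j] by (cases "x \<in> B") (auto simp: G_def intro: order_trans)
  have "G \<ge> 0" by (simp add: G_def)
  have Gm: "(\<lambda>x. indicator B x * christoffel g c k i j x) \<in> borel_measurable borel" for k i j
    using borel_measurable_continuous_on_indicator[OF Bb continuous_on_subset[OF christoffel_continuous[OF c(1)] B(2)]]
    by simp
  \<comment> \<open>A Christoffel term is a sum of n products, each at most G times the norm of
    u.\<close>
  define M where "M = real CARD('n) * G"
  have "M \<ge> 0" unfolding M_def using \<open>G \<ge> 0\<close> by simp

  text \<open>Dividing by \<open>vol\<close> turns integrals against the density into Lebesgue integrals with weight \<open>\<eta>\<close>.\<close>
  define \<theta> where "\<theta> p = (if p \<in> chart_dom c then \<eta> (chart_map c p) / vol c (chart_map c p) else 0)" for p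
  have \<theta>_nonneg: "0 \<le> \<theta> p" for p
    unfolding \<theta>_def using \<eta>_nonneg vol_pos[OF c(1) chart_map_in] by (simp add: less_imp_le)
  have \<theta>_le: "\<theta> p \<le> mm / v0" for p
  proof (cases "p \<in> chart_dom c \<and> chart_map c p \<in> B")
    case True
    have "\<eta> (chart_map c p) / vol c (chart_map c p) \<le> mm / v0"
      using True v(1) v(3)[of "chart_map c p"] mm(1)[of "chart_map c p"] \<eta>_nonneg[of "chart_map c p"]
      by (intro frac_le) auto
    then show ?thesis using True by (simp add: \<theta>_def)
  next
    case False
    then have "\<theta> p = 0" using \<eta>_outB by (auto simp: \<theta>_def)
    moreover have "0 \<le> mm / v0"
    proof (rule divide_nonneg_pos[OF _ v(1)])
      show "0 \<le> mm" using mm(1)[of a] by linarith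
    qed
    ultimately show ?thesis by simp
  qed
  define W where "W = chart_dom c \<inter> chart_map c -` ball a (r / 2)"
  have W: "open W" "p0 \<in> W"
  proof -
    show "open W" unfolding W_def
      by (intro continuous_open_preimage chart_map_continuous chart_dom_open c open_ball)
    show "p0 \<in> W" using c(2) r(1) by (simp add: W_def a_def)
  qed
  have \<theta>_W: "e0 / v1 \<le> \<theta> p" if "p \<in> W" for p
  proof -
    have x: "chart_map c p \<in> cball a (r / 2)" "p \<in> chart_dom c" using that by (auto simp: W_def)
    then have "chart_map c p \<in> B" using r by (auto simp: B_def)
    then show ?thesis
      unfolding \<theta>_def using x e0 v(1) v(3)[of "chart_map c p"] \<eta>_nonneg[of "chart_map c p"]
      by (auto intro!: frac_le)
  qed
  have \<theta>_m: "\<theta> \<in> borel_measurable borel"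
  proof -
    have "(\<lambda>p. indicator (chart_dom c) p *\<^sub>R (\<eta> (chart_map c p) / vol c (chart_map c p))) \<in> borel_measurable borel"
    proof (rule borel_measurable_continuous_on_indicator)
      show "chart_dom c \<in> sets borel" using chart_dom_open[OF c(1)] by simp
      have "continuous_on (chart_dom c) (\<lambda>p. \<eta> (chart_map c p))"
        by (rule continuous_on_compose2[OF bump_alg_continuous[OF \<eta>, of UNIV] chart_map_continuous[OF c(1)]]) simp
      moreover have "continuous_on (chart_dom c) (\<lambda>p. vol c (chart_map c p))"
        by (rule continuous_on_compose2[OF vol_continuous[OF c(1)] chart_map_continuous[OF c(1)]]) (auto simp: chart_map_in)
      ultimately show "continuous_on (chart_dom c) (\<lambda>p. \<eta> (chart_map c p) / vol c (chart_map c p))"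
        by (rule continuous_on_divide) (use vol_pos[OF c(1) chart_map_in] in force)
    qed
    then show ?thesis by (rule measurable_cong[THEN iffD1, rotated]) (simp add: \<theta>_def indicator_def)
  qed

  have estimate: "\<exists>K. \<forall>u T. admissible u T \<longrightarrow>
      \<bar>null_form \<theta> T\<bar>
        \<le> \<delta> * tf_energy T + K * vf_energy u"
    if \<delta>: "\<delta> > 0" for \<delta>
  proof -
    \<comment> \<open>The number of index pairs (k, j), each of which contributes one error
      term.\<close>
    define N where "N = real CARD('n) * real CARD('n)"
    have "N > 0" unfolding N_def by simp
    \<comment> \<open>Makes the total gradient error N d / (m0 v0) equal to \<delta>.\<close>
    define d where "d = \<delta> * (m0 * v0) / N"
    have d: "d > 0" unfolding d_def using \<delta> m0(1) v(1) \<open>N > 0\<close> by simp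
    define C where "C = (mm * (4 * M + 2))\<^sup>2 / d + mm * (2 * M\<^sup>2 + 2 * M)"
    have "mm \<ge> 0" using mm(1)[of a] by linarith
    then have C: "C \<ge> 0" unfolding C_def using d \<open>M \<ge> 0\<close> by simp
    have "\<bar>null_form \<theta> T\<bar>
        \<le> \<delta> * tf_energy T + N * C / (m0 * v0) * vf_energy u"
      if adm: "admissible u T" for u T
    proof -
      have vf: "vector_field atlas u" and Ui: "integrable density_M (vf_sq u)"
        and wn: "weak_nabla atlas g u T" and Ti: "integrable density_M (tf_sq T)"
        using adm by (auto simp: admissible_def)
      have tf: "tensor11_field atlas T" using wn by (simp add: weak_nabla_def)
      have ui: "set_integrable lborel B (u c)" and ti: "set_integrable lborel B (T c)"
        using wn c(1) B unfolding weak_nabla_def by blast+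
      have inv: "chart_inv c x \<in> chart_dom c" "chart_map c (chart_inv c x) = x" if "x \<in> B" for x
        using that B(2) chart_inv_in[OF c(1)] chart_map_inv[OF c(1)] by blast+
      have U_chart: "vf_sq u (chart_inv c x) = inner_g (g c x) (u c x) (u c x)" if "x \<in> B" for x
        using inner_vf_chart[OF vf c(1) inv(1)[OF that]] inv(2)[OF that] by simp
      have T_chart: "tf_sq T (chart_inv c x) = tensor_inner_g (g c x) (T c x) (T c x)" if "x \<in> B" for x
        using inner_tf_chart[where A = T, OF c(1) inv(1)[OF that] tensor_field_jac[OF tf c(1) _ inv(1)[OF that]]] inv(2)[OF that]
        by simp
      note U_nonneg = inner_vf_nonneg[OF vf]
      note T_nonneg = inner_tf_trace(3)[OF tf]
      have u2: "integrable lborel (\<lambda>x. indicator B x * (norm (u c x))\<^sup>2)"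
        "(LBINT x. indicator B x * (norm (u c x))\<^sup>2) \<le> 1 / (m0 * v0) * vf_energy u"
        by (rule local_square_integrable[OF cpt c(1) B Ui U_nonneg m0(1) _ v(1) _ ui]; use U_chart m0(2) v(3) in simp)+
      have t2: "integrable lborel (\<lambda>x. indicator B x * (norm (T c x))\<^sup>2)"
        "(LBINT x. indicator B x * (norm (T c x))\<^sup>2) \<le> 1 / (m0 * v0) * tf_energy T"
        by (rule local_square_integrable[OF cpt c(1) B Ti T_nonneg m0(1) _ v(1) _ ti]; use T_chart m0(3) v(3) in simp)+
      \<comment> \<open>Components are cut off to B, so that they lie in \<open>L12\<close> on the
        whole space.\<close>
      define ub where "ub k x = indicator B x * u c x $ k" for k x
      define tb where "tb k j x = indicator B x * T c x $ k $ j" for k j x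
      define sb where "sb k j x = (\<Sum>i\<in>UNIV. ub i x * (indicator B x * christoffel g c k i j x))" for k j x
      \<comment> \<open>On B this is the weak coordinate derivative of u^k in direction j: the
        covariant derivative minus the Christoffel term.\<close>
      define db where "db k j x = tb k j x - sb k j x" for k j x
      have L_ub: "L12 (ub k)" for k
        using L12_component[OF ui u2(1) bounded_linear_vec_nth component_le_norm_cart] by (simp add: ub_def[abs_def])
      have t_le: "\<bar>T c x $ k $ j\<bar> \<le> norm (T c x)" for k j x
        by (rule order_trans[OF component_le_norm_cart[of "T c x $ k" j] Finite_Cartesian_Product.norm_nth_le])
      have L_tb: "L12 (tb k j)" for k j
        using L12_component[OF ti t2(1) bounded_linear_compose[OF bounded_linear_vec_nth[of j] bounded_linear_vec_nth[of k]]
            order_trans[OF component_le_norm_cart Finite_Cartesian_Product.norm_nth_le]]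
        by (simp add: tb_def[abs_def])
      have L_sb: "L12 (sb k j)" for k j
        unfolding sb_def by (intro L12_sum L12_mult_bounded[OF L_ub Gm G]) simp
      have L_db: "L12 (db k j)" for k j
        unfolding db_def by (rule L12_diff[OF L_tb L_sb])
      have weak: "(LBINT x. ub k x * partial j \<zeta> x) = - (LBINT x. db k j x * \<zeta> x)"
        if \<zeta>: "bump_alg \<zeta>" "\<And>x. x \<notin> cball a R \<Longrightarrow> \<zeta> x = 0" for \<zeta> k j
      proof -
        have "test_function (chart_img c) \<zeta>"
          by (rule test_functionI[OF \<zeta>(1) B(1,2)]) (use \<zeta>(2) in \<open>simp add: B_def\<close>)
        then have "(LBINT x. u c x $ k * partial j \<zeta> x) =
            - (LBINT x. (T c x $ k $ j - (\<Sum>i\<in>UNIV. christoffel g c k i j x * u c x $ i)) * \<zeta> x)"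
          using wn c(1) unfolding weak_nabla_def by blast
        moreover have "partial j \<zeta> x = 0" if "x \<notin> B" for x
          by (rule partial_eq_0_outside[where K = "cball a R"]) (use that \<zeta>(2) in \<open>auto simp: B_def\<close>)
        then have "u c x $ k * partial j \<zeta> x = ub k x * partial j \<zeta> x" for x
          by (cases "x \<in> B") (auto simp: ub_def)
        moreover have "(T c x $ k $ j - (\<Sum>i\<in>UNIV. christoffel g c k i j x * u c x $ i)) * \<zeta> x = db k j x * \<zeta> x" for x
          using \<zeta>(2)[of x] by (cases "x \<in> B") (auto simp: db_def tb_def sb_def ub_def B_def mult.commute)
        ultimately show ?thesis by simp
      qed
      \<comment> \<open>The integrand of the weak Jacobian identity for the pair u^k, u^j.\<close>
      define J where "J k j x = \<eta> x * (db k j x * db j k x - db k k x * db j j x)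
          + ub k x * (partial j \<eta> x * db j k x - partial k \<eta> x * db j j x)" for k j x
      have J0: "(LBINT x. J k j x) = 0" for k j
        unfolding J_def
        by (rule weak_jacobian_identity[where a = a, OF L_ub[of k] L_ub[of j] L_db L_db L_db L_db \<eta> _ r(2)], erule \<eta>_out)
          (intro conjI weak)
      have LL: "integrable lborel (\<lambda>x. A x * A' x)" if "L12 A" "L12 A'" for A A' :: "real^'n \<Rightarrow> real"
        by (rule integrable_mult_L2) (use that in \<open>auto simp: L12_def\<close>)
      have LLb: "integrable lborel (\<lambda>x. b x * (A x * A' x))" if "L12 A" "L12 A'" "bump_alg b" "\<And>x. \<bar>b x\<bar> \<le> mm"
        for A A' b :: "real^'n \<Rightarrow> real"
        using integrable_mult_bounded[OF LL[OF that(1,2)] _ that(4)] bump_alg_measurable[OF that(3)]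
        by (simp add: mult.commute)
      have Ji: "integrable lborel (J k j)" for k j
      proof -
        have e: "J k j = (\<lambda>x. \<eta> x * (db k j x * db j k x) - \<eta> x * (db k k x * db j j x)
            + partial j \<eta> x * (ub k x * db j k x) - partial k \<eta> x * (ub k x * db j j x))"
          by (simp add: fun_eq_iff J_def algebra_simps)
        show ?thesis
          unfolding e by (intro Bochner_Integration.integrable_diff Bochner_Integration.integrable_add
              LLb[OF L_db L_db \<eta> mm(1)] LLb[OF L_ub L_db bump_alg_partial[OF \<eta>] mm(2)])
      qed
      \<comment> \<open>The leading part of J with covariant in place of coordinate
        derivatives.\<close>
      define Z where "Z k j x = \<eta> x * (tb k j x * tb j k x - tb k k x * tb j j x)" for k j x
      have Zi: "integrable lborel (Z k j)" for k j
      proof -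
        have e: "Z k j = (\<lambda>x. \<eta> x * (tb k j x * tb j k x) - \<eta> x * (tb k k x * tb j j x))"
          by (simp add: fun_eq_iff Z_def algebra_simps)
        show ?thesis unfolding e by (intro Bochner_Integration.integrable_diff LLb[OF L_tb L_tb \<eta> mm(1)])
      qed
      define E where "E x = d * (indicator B x * (norm (T c x))\<^sup>2) + C * (indicator B x * (norm (u c x))\<^sup>2)" for x
      have Ei: "integrable lborel E" unfolding E_def using t2(1) u2(1) by simp
      have ZJ: "\<bar>Z k j x - J k j x\<bar> \<le> E x" for k j x
      proof (cases "x \<in> B")
        case True
        have s_le: "\<bar>sb k j x\<bar> \<le> M * norm (u c x)" for k j
        proof -
          have "\<bar>sb k j x\<bar> \<le> (\<Sum>i\<in>UNIV. \<bar>ub i x * (indicator B x * christoffel g c k i j x)\<bar>)"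
            unfolding sb_def by (rule sum_abs)
          also have "\<dots> \<le> (\<Sum>i\<in>(UNIV::'n set). norm (u c x) * G)"
            unfolding abs_mult[of "ub _ x"]
            by (intro sum_mono mult_mono G) (use component_le_norm_cart[of "u c x"] True in \<open>auto simp: ub_def\<close>)
          finally show ?thesis by (simp add: M_def mult_ac)
        qed
        have t_le': "\<bar>tb k j x\<bar> \<le> norm (T c x)" for k j using t_le True by (simp add: tb_def)
        have u_le: "\<bar>ub k x\<bar> \<le> norm (u c x)" using component_le_norm_cart True by (simp add: ub_def)
        have "\<bar>Z k j x - J k j x\<bar> \<le> d * (norm (T c x))\<^sup>2 + C * (norm (u c x))\<^sup>2"
          unfolding Z_def J_def db_def C_def
          by (rule jacobian_defect_bound[OF t_le' t_le' t_le' t_le' s_le s_le s_le s_le u_le mm(1) mm(2) mm(2) \<open>M \<ge> 0\<close> d])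
        then show ?thesis using True by (simp add: E_def)
      next
        case False
        then show ?thesis using \<eta>_outB[OF False] by (simp add: Z_def J_def E_def ub_def)
      qed
      \<comment> \<open>Since J has integral 0, only the defect Z - J counts.\<close>
      have Zb: "\<bar>(LBINT x. Z k j x)\<bar> \<le> (LBINT x. E x)" for k j
      proof -
        have "(LBINT x. Z k j x) = (LBINT x. Z k j x - J k j x)" using Zi Ji J0 by simp
        also have "\<bar>\<dots>\<bar> \<le> (LBINT x. \<bar>Z k j x - J k j x\<bar>)" by (rule integral_abs_bound)
        also have "\<dots> \<le> (LBINT x. E x)" by (rule integral_mono) (use Zi Ji Ei ZJ in auto)
        finally show ?thesis .
      qed
      let ?F = "\<lambda>x. indicator (chart_img c) x * (vol c x * (\<theta> (chart_inv c x) * (tr_sq T (chart_inv c x) - sq_tr T (chart_inv c x))))"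
      have "null_form \<theta> T
          = (LBINT x. ?F x)"
      proof (rule integral_chart[OF cpt c(1)])
        show "(\<lambda>p. \<theta> p * (tr_sq T p - sq_tr T p)) \<in> borel_measurable borel"
          using \<theta>_m trace_measurable[OF cpt tf] by simp
      qed (simp add: \<theta>_def)
      also have "\<dots> = (LBINT x. (\<Sum>k\<in>UNIV. \<Sum>j\<in>UNIV. Z k j x))"
      proof (rule Bochner_Integration.integral_cong[OF refl])
        fix x
        show "?F x
            = (\<Sum>k\<in>UNIV. \<Sum>j\<in>UNIV. Z k j x)"
        proof (cases "x \<in> B")
          case True
          have tr: "tr_sq T (chart_inv c x) = trace (T c x ** T c x)" "sq_tr T (chart_inv c x) = (trace (T c x))\<^sup>2"
            using scalar_trace_chart[OF tf c(1) inv(1)[OF True]] inv(2)[OF True] by (simp_all add: tr_sq_def sq_tr_def)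
          have "vol c x * \<theta> (chart_inv c x) = \<eta> x"
            using v(1) v(3)[OF True] inv[OF True] by (simp add: \<theta>_def)
          then have "?F x
              = \<eta> x * (trace (T c x ** T c x) - (trace (T c x))\<^sup>2)"
            using True B(2) by (auto simp: tr mult.assoc[symmetric])
          also have "trace (T c x ** T c x) - (trace (T c x))\<^sup>2
              = (\<Sum>k\<in>UNIV. \<Sum>j\<in>UNIV. T c x $ k $ j * T c x $ j $ k - T c x $ k $ k * T c x $ j $ j)"
            by (simp add: trace_def matrix_matrix_mult_def power2_eq_square sum_product sum_subtractf)
          also have "\<eta> x * \<dots> = (\<Sum>k\<in>UNIV. \<Sum>j\<in>UNIV. Z k j x)"
            using True by (simp add: Z_def tb_def sum_distrib_left)
          finally show ?thesis .
        next
          case False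
          then have "?F x = 0"
            using \<eta>_outB[OF False] chart_map_inv[OF c(1), of x] by (auto simp: \<theta>_def indicator_def)
          then show ?thesis using \<eta>_outB[OF False] by (simp add: Z_def)
        qed
      qed
      also have "\<dots> = (\<Sum>k\<in>UNIV. \<Sum>j\<in>UNIV. (LBINT x. Z k j x))"
        using Zi by (simp add: Bochner_Integration.integral_sum)
      finally have "\<bar>null_form \<theta> T\<bar> = \<bar>\<Sum>k\<in>UNIV. \<Sum>j\<in>UNIV. (LBINT x. Z k j x)\<bar>"
        by simp
      also have "\<dots> \<le> (\<Sum>k\<in>(UNIV::'n set). \<Sum>j\<in>(UNIV::'n set). (LBINT x. E x))"
        by (intro order_trans[OF sum_abs] sum_mono Zb)
      also have "\<dots> = N * (LBINT x. E x)" by (simp add: N_def)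
      also have "(LBINT x. E x) = d * (LBINT x. indicator B x * (norm (T c x))\<^sup>2) + C * (LBINT x. indicator B x * (norm (u c x))\<^sup>2)"
        unfolding E_def using t2(1) u2(1) by simp
      also have "N * \<dots> \<le> N * (d * (1 / (m0 * v0) * tf_energy T)
          + C * (1 / (m0 * v0) * vf_energy u))"
        using t2(2) u2(2) d C \<open>N > 0\<close> by (intro mult_left_mono add_mono) auto
      also have "\<dots> = \<delta> * tf_energy T + N * C / (m0 * v0) * vf_energy u"
      proof -
        have "N * d = \<delta> * (m0 * v0)" unfolding d_def using \<open>N > 0\<close> by simp
        then have "N * (d * (1 / (m0 * v0) * X)) = \<delta> * X" for X
          using m0(1) v(1) by (simp add: mult.assoc[symmetric])
        then show ?thesis by (simp add: distrib_left)
      qed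
      finally show ?thesis .
    qed
    then show ?thesis by blast
  qed
  have "0 < e0 / v1" using e0(1) v(2) by simp
  then show ?thesis
    unfolding local_weight_def using W \<theta>_m \<theta>_nonneg \<theta>_le \<theta>_W estimate by blast
qed

section \<open>Patching the local estimates\<close>

lemma integrable_traces:
  assumes cpt: "compact (UNIV :: 'a set)" and T: "tensor11_field atlas T"
    and N: "integrable density_M (tf_sq T)"
  shows "integrable density_M (tr_sq T)" "integrable density_M (sq_tr T)"
proof -
  note S = sets_riemannian_density[OF cpt]
  have m: "tr_sq T \<in> borel_measurable density_M" "sq_tr T \<in> borel_measurable density_M"
    using trace_measurable[OF cpt T] measurable_cong_sets[OF S refl] by blast+
  note b = inner_tf_trace[OF T]
  show "integrable density_M (tr_sq T)"
    by (rule Bochner_Integration.integrable_bound[OF N m(1)])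
      (use b(3,4) in \<open>auto intro!: AE_I2\<close>)
  show "integrable density_M (sq_tr T)"
    by (rule Bochner_Integration.integrable_bound[OF integrable_mult_right[OF N, where c = "real CARD('n)"] m(2)])
      (use b(3,5,6) in \<open>auto intro!: AE_I2\<close>)
qed

text \<open>The parameter \<kappa> treats both forms at once: 0 for the Killing form, 2/n for the
  conformal one. In both cases the integrand is half of a squared norm, which is the origin of the
  nonnegativity hypothesis.\<close>

lemma global_estimate:
  assumes cpt: "compact (UNIV :: 'a set)"
  shows "\<exists>\<alpha> \<mu>. \<alpha> > 0 \<and> (\<forall>u T \<kappa>. admissible u T \<longrightarrow> \<kappa> \<le> 1 \<longrightarrow>
      (\<forall>p. 0 \<le> tf_sq T p + tr_sq T p - \<kappa> * sq_tr T p) \<longrightarrow>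
      \<alpha> * (vf_energy u + tf_energy T)
      \<le> (\<integral>p. tf_sq T p + tr_sq T p - \<kappa> * sq_tr T p \<partial>density_M)
        + \<mu> * vf_energy u)"
proof -
  obtain W \<theta> m M where P: "\<And>p0. local_weight p0 (W p0) (\<theta> p0) (m p0) (M p0)"
    using local_estimate[OF cpt] by metis
  have loc: "open (W p0)" "p0 \<in> W p0" "0 < m p0" "\<theta> p0 \<in> borel_measurable borel"
    "0 \<le> \<theta> p0 p \<and> \<theta> p0 p \<le> M p0" "p \<in> W p0 \<Longrightarrow> m p0 \<le> \<theta> p0 p" for p0 p
    using P[of p0] by (simp_all add: local_weight_def)
  have est: "\<exists>K. \<forall>u T. admissible u T \<longrightarrow>
      \<bar>null_form (\<theta> p0) T\<bar>
        \<le> \<delta> * tf_energy T + K * vf_energy u"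
    if "\<delta> > 0" for p0 \<delta>
    using P[of p0] that unfolding local_weight_def by blast
  obtain F where F: "finite F" "UNIV = (\<Union>p\<in>F. W p)"
  proof (rule compactE_image[OF cpt, of UNIV W])
    show "UNIV \<subseteq> (\<Union>p\<in>UNIV. W p)" using loc(2) by blast
    show thesis if "finite C" "UNIV \<subseteq> (\<Union>p\<in>C. W p)" for C using that \<open>\<And>F. finite F \<Longrightarrow> UNIV = (\<Union>p\<in>F. W p) \<Longrightarrow> thesis\<close> by blast
  qed (rule loc(1))
  then have "F \<noteq> {}" by auto
  define m0 where "m0 = Min (m ` F)"
  have m0: "m0 > 0" "\<And>p0. p0 \<in> F \<Longrightarrow> m0 \<le> m p0"
    unfolding m0_def using F(1) \<open>F \<noteq> {}\<close> loc(3) by auto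
  \<comment> \<open>The summand 1 makes M0 visibly positive, so that one may divide by it.\<close>
  define M0 where "M0 = (\<Sum>p0\<in>F. M p0) + 1"
  have M_nonneg: "0 \<le> M p0" for p0 using loc(5)[of p0 p0] by linarith
  have M0: "M0 > 0" unfolding M0_def by (simp add: add_nonneg_pos sum_nonneg M_nonneg)
  define \<Theta> where "\<Theta> p = (\<Sum>p0\<in>F. \<theta> p0 p)" for p
  have \<Theta>_m: "\<Theta> \<in> borel_measurable borel" unfolding \<Theta>_def using loc(4) by (intro borel_measurable_sum)
  have \<Theta>_le: "\<Theta> p \<le> M0" for p
  proof -
    have "\<Theta> p \<le> (\<Sum>p0\<in>F. M p0)" unfolding \<Theta>_def using loc(5) by (intro sum_mono) blast
    then show ?thesis by (simp add: M0_def)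
  qed
  have \<Theta>_ge: "m0 \<le> \<Theta> p" for p
  proof -
    obtain p0 where p0: "p0 \<in> F" "p \<in> W p0" using F(2) by blast
    have "m0 \<le> \<theta> p0 p" using m0(2)[OF p0(1)] loc(6)[OF p0(2)] by simp
    also have "\<dots> \<le> \<Theta> p" unfolding \<Theta>_def using F(1) p0(1) loc(5) by (intro member_le_sum) auto
    finally show ?thesis .
  qed
  \<comment> \<open>The local errors, one for each element of F, then add up to m0 / 2 times the
    gradient energy, half of what the lower bound on \<Theta> provides.\<close>
  define \<delta> where "\<delta> = m0 / (2 * card F)"
  have cF: "real (card F) > 0" using F(1) \<open>F \<noteq> {}\<close> by (simp add: card_gt_0_iff)
  have \<delta>: "\<delta> > 0" unfolding \<delta>_def using m0(1) cF by simp
  obtain K where K: "\<And>p0 u T. admissible u T \<Longrightarrow>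
      \<bar>null_form (\<theta> p0) T\<bar>
        \<le> \<delta> * tf_energy T + K p0 * vf_energy u"
  proof -
    define PK where "PK p0 K \<longleftrightarrow> (\<forall>u T. admissible u T \<longrightarrow>
      \<bar>null_form (\<theta> p0) T\<bar>
        \<le> \<delta> * tf_energy T + K * vf_energy u)"
      for p0 K
    have "\<exists>K. PK p0 K" for p0 unfolding PK_def by (rule est[OF \<delta>])
    then obtain K where "\<And>p0. PK p0 (K p0)" by metis
    then show ?thesis by (intro that[of K]) (simp add: PK_def)
  qed
  define K0 where "K0 = (\<Sum>p0\<in>F. K p0)"
  show ?thesis
  \<comment> \<open>In the second witness, \<open>m0 / (2 * M0)\<close> pays for the L2 part of the
    H1 norm and \<open>K0 / M0\<close> for the local errors.\<close>
  proof (rule exI[of _ "m0 / (2 * M0)"], rule exI[of _ "m0 / (2 * M0) + K0 / M0"], intro conjI allI impI)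
    show "m0 / (2 * M0) > 0" using m0(1) M0 by simp
    fix u T \<kappa>
    assume adm: "admissible u T" and \<kappa>: "\<kappa> \<le> (1 :: real)"
      and "\<forall>p. 0 \<le> tf_sq T p + tr_sq T p - \<kappa> * sq_tr T p"
    then have Q_nonneg: "0 \<le> tf_sq T p + tr_sq T p - \<kappa> * sq_tr T p" for p by blast
    define U where "U = vf_energy u"
    define N where "N = tf_energy T"
    have T: "tensor11_field atlas T" and Ni: "integrable density_M (tf_sq T)"
      using adm by (auto simp: admissible_def weak_nabla_def)
    note tri = integrable_traces[OF cpt T Ni] and nonneg = inner_tf_trace[OF T]
    define Q where "Q p = tf_sq T p + tr_sq T p - \<kappa> * sq_tr T p" for p
    have Qi: "integrable density_M Q" unfolding Q_def using Ni tri by simp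
    have wi: "integrable density_M (\<lambda>p. w p * f p)"
      if "integrable density_M f" "w \<in> borel_measurable borel" "\<And>p. \<bar>w p\<bar> \<le> b" for f w :: "'a \<Rightarrow> real" and b
    proof -
      have "w \<in> borel_measurable density_M"
        using that(2) measurable_cong_sets[OF sets_riemannian_density[OF cpt] refl] by blast
      from integrable_mult_bounded[OF that(1) this that(3)] show ?thesis by (simp add: mult.commute)
    qed
    have \<theta>_abs: "\<bar>\<theta> p0 p\<bar> \<le> M p0" for p0 p using loc(5)[of p0 p] by simp
    have \<Theta>_abs: "\<bar>\<Theta> p\<bar> \<le> M0" for p using \<Theta>_le[of p] \<Theta>_ge[of p] m0(1) by simp
    have di: "integrable density_M (\<lambda>p. tr_sq T p - sq_tr T p)" using tri by simp
    have "\<bar>null_form \<Theta> T\<bar>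
        = \<bar>\<Sum>p0\<in>F. null_form (\<theta> p0) T\<bar>"
      unfolding \<Theta>_def sum_distrib_right
      by (subst Bochner_Integration.integral_sum) (auto intro: wi[OF di loc(4) \<theta>_abs])
    also have "\<dots> \<le> (\<Sum>p0\<in>F. \<delta> * N + K p0 * U)"
      unfolding N_def U_def by (intro order_trans[OF sum_abs] sum_mono K adm)
    also have "\<dots> = m0 / 2 * N + K0 * U"
      using cF by (simp add: sum.distrib K0_def sum_distrib_right \<delta>_def)
    finally have err: "- (m0 / 2 * N + K0 * U) \<le> null_form \<Theta> T"
      by linarith
    have "m0 * N + null_form \<Theta> T
        = (\<integral>p. m0 * tf_sq T p + \<Theta> p * (tr_sq T p - sq_tr T p) \<partial>density_M)"
      unfolding N_def using Ni wi[OF di \<Theta>_m \<Theta>_abs] by simp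
    also have "\<dots> \<le> (\<integral>p. M0 * Q p \<partial>density_M)"
    proof (rule integral_mono)
      show "integrable density_M (\<lambda>p. m0 * tf_sq T p + \<Theta> p * (tr_sq T p - sq_tr T p))"
        using Ni wi[OF di \<Theta>_m \<Theta>_abs] by simp
      show "integrable density_M (\<lambda>p. M0 * Q p)" using Qi by simp
      fix p
      \<comment> \<open>Pointwise, m0 |T|^2 is at most \<Theta> |T|^2, adding the nonnegative term
        with 1 - \<kappa> completes the integrand to \<Theta> Q, and nonnegativity of Q allows
        \<Theta> to be replaced by M0.\<close>
      have "m0 * tf_sq T p \<le> \<Theta> p * tf_sq T p"
        by (intro mult_right_mono \<Theta>_ge nonneg(3))
      moreover have "0 \<le> \<Theta> p * ((1 - \<kappa>) * sq_tr T p)"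
        using \<kappa> nonneg(5) \<Theta>_ge[of p] m0(1) by (intro mult_nonneg_nonneg) auto
      moreover have "\<Theta> p * Q p = \<Theta> p * tf_sq T p + \<Theta> p * (tr_sq T p - sq_tr T p) + \<Theta> p * ((1 - \<kappa>) * sq_tr T p)"
        unfolding Q_def by (simp add: algebra_simps)
      moreover have "\<Theta> p * Q p \<le> M0 * Q p"
        using Q_nonneg[of p] \<Theta>_le unfolding Q_def by (intro mult_right_mono)
      ultimately show "m0 * tf_sq T p + \<Theta> p * (tr_sq T p - sq_tr T p) \<le> M0 * Q p"
        by linarith
    qed
    also have "\<dots> = M0 * (\<integral>p. Q p \<partial>density_M)" by simp
    finally have "m0 / 2 * N \<le> M0 * (\<integral>p. Q p \<partial>density_M) + K0 * U" using err by linarith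
    then have "(m0 / 2 * N) / M0 \<le> (M0 * (\<integral>p. Q p \<partial>density_M) + K0 * U) / M0"
      using M0 by (intro divide_right_mono) auto
    also have "\<dots> = (\<integral>p. Q p \<partial>density_M) + K0 / M0 * U"
      using M0 by (simp add: add_divide_distrib)
    finally have "m0 / (2 * M0) * N \<le> (\<integral>p. Q p \<partial>density_M) + K0 / M0 * U"
      by simp
    then show "m0 / (2 * M0) * (vf_energy u + tf_energy T)
      \<le> (\<integral>p. tf_sq T p + tr_sq T p - \<kappa> * sq_tr T p \<partial>density_M)
        + (m0 / (2 * M0) + K0 / M0) * vf_energy u"
      unfolding Q_def U_def N_def by (simp only: distrib_left distrib_right)
  qed
qed

section \<open>Sobolev norms and the two bilinear forms\<close>

lemma H1_admissible:
  assumes "v \<in> H1 atlas g"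
  shows "admissible v (grad v)"
proof -
  have "\<exists>T. weak_nabla atlas g v T \<and> integrable density_M (tf_sq T)"
    using assms by (simp add: H1_def)
  then have "weak_nabla atlas g v (grad v) \<and> integrable density_M (tf_sq (grad v))"
    unfolding nabla_def by (rule someI_ex)
  then show ?thesis using assms by (simp add: admissible_def H1_def L2_def)
qed

lemma norms_squared:
  assumes "admissible v (grad v)"
  shows "(L2_norm atlas g v)\<^sup>2 = vf_energy v"
    and "(H1_norm atlas g v)\<^sup>2 = vf_energy v
      + tf_energy (grad v)"
proof -
  have v: "vector_field atlas v" and T: "tensor11_field atlas (grad v)"
    and i: "integrable density_M (vf_sq v)" "integrable density_M (tf_sq (grad v))"
    using assms by (auto simp: admissible_def weak_nabla_def)
  note nn = inner_vf_nonneg[OF v] inner_tf_trace(3)[OF T]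
  show "(L2_norm atlas g v)\<^sup>2 = vf_energy v"
    unfolding L2_norm_def using nn by (simp add: Bochner_Integration.integral_nonneg)
  show "(H1_norm atlas g v)\<^sup>2 = vf_energy v
      + tf_energy (grad v)"
    unfolding H1_norm_def using nn i by (simp add: Bochner_Integration.integral_nonneg)
qed

text \<open>The factor 1/2 in the forms cancels the 2 in \<open>inner_tf_trace\<close>.
  Nonnegativity of the integrand comes from |tr (T^2)| \<le> |T|^2 for the Killing form, and from
  the squared norm of \<open>C_tensor\<close> for the conformal form, where n \<ge> 2 ensures
  \<kappa> = 2/n \<le> 1.\<close>

lemma coercive_forms:
  assumes cpt: "compact (UNIV :: 'a set)"
  shows "coercive atlas g (a_K atlas g)"
    and "CARD('n) \<ge> 2 \<Longrightarrow> coercive atlas g (a_C atlas g)"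
proof -
  obtain \<alpha> \<mu> where \<alpha>: "\<alpha> > 0" and est: "\<forall>u T \<kappa>. admissible u T \<longrightarrow> \<kappa> \<le> 1 \<longrightarrow>
      (\<forall>p. 0 \<le> tf_sq T p + tr_sq T p - \<kappa> * sq_tr T p) \<longrightarrow>
      \<alpha> * (vf_energy u + tf_energy T)
      \<le> (\<integral>p. tf_sq T p + tr_sq T p - \<kappa> * sq_tr T p \<partial>density_M)
        + \<mu> * vf_energy u"
    using global_estimate[OF cpt] by (elim exE conjE)
  have coerciveI: "coercive atlas g a"
    if "\<kappa> \<le> 1" and "\<And>v p. v \<in> H1 atlas g \<Longrightarrow> 0 \<le> tf_sq (grad v) p
        + tr_sq (grad v) p - \<kappa> * sq_tr (grad v) p"
      and "\<And>v. v \<in> H1 atlas g \<Longrightarrow> a v v = (\<integral>p. tf_sq (grad v) p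
        + tr_sq (grad v) p - \<kappa> * sq_tr (grad v) p \<partial>density_M)" for a \<kappa>
    unfolding coercive_def
  proof (rule exI[of _ \<alpha>], rule conjI[OF \<alpha>], rule exI[of _ \<mu>], rule ballI)
    fix v assume v: "v \<in> H1 atlas g"
    note adm = H1_admissible[OF v]
    show "\<alpha> * (H1_norm atlas g v)\<^sup>2 \<le> a v v + \<mu> * (L2_norm atlas g v)\<^sup>2"
      unfolding norms_squared[OF adm] that(3)[OF v] by (rule est[rule_format, OF adm that(1) that(2)[OF v]])
  qed
  have T: "tensor11_field atlas (grad v)" if "v \<in> H1 atlas g" for v
    using H1_admissible[OF that] by (simp add: admissible_def weak_nabla_def)
  show "coercive atlas g (a_K atlas g)"
  proof (rule coerciveI[of 0])
    fix v assume v: "v \<in> H1 atlas g"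
    note b = inner_tf_trace[OF T[OF v]]
    show "0 \<le> tf_sq (grad v) p
        + tr_sq (grad v) p - 0 * sq_tr (grad v) p" for p
      using b(4)[of p] by simp
    have S: "S_tensor atlas g v = (\<lambda>c x. grad v c x + adjoint_g (g c x) (grad v c x))"
      by (simp add: fun_eq_iff S_tensor_def)
    have eq: "inner_tf atlas g (S_tensor atlas g v) (S_tensor atlas g v) p
        = 2 * (tf_sq (grad v) p + tr_sq (grad v) p)" for p
      unfolding S b(1) by simp
    show "a_K atlas g v v = (\<integral>p. tf_sq (grad v) p
        + tr_sq (grad v) p - 0 * sq_tr (grad v) p \<partial>density_M)"
      unfolding a_K_def eq integral_mult_right_zero by simp
  qed simp
  assume n: "CARD('n) \<ge> 2"
  define \<kappa> where "\<kappa> = 2 / real CARD('n)"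
  show "coercive atlas g (a_C atlas g)"
  proof (rule coerciveI[of \<kappa>])
    show "\<kappa> \<le> 1" unfolding \<kappa>_def using n by simp
    fix v assume v: "v \<in> H1 atlas g"
    note b = inner_tf_trace[OF T[OF v]]
    have C: "C_tensor atlas g v = (\<lambda>c x. grad v c x + adjoint_g (g c x) (grad v c x)
        - (2 / CARD('n) * trace (grad v c x)) *\<^sub>R mat 1)"
      by (simp add: fun_eq_iff C_tensor_def S_tensor_def divergence_def)
    have eq: "inner_tf atlas g (C_tensor atlas g v) (C_tensor atlas g v) p
        = 2 * (tf_sq (grad v) p
          + tr_sq (grad v) p - \<kappa> * sq_tr (grad v) p)" for p
      unfolding C b(2) \<kappa>_def by simp
    have nonneg: "0 \<le> inner_tf atlas g (C_tensor atlas g v) (C_tensor atlas g v) p" for p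
    proof -
      obtain c where c: "c \<in> atlas" "p \<in> chart_dom c" by (rule obtain_chart)
      have t: "trace (grad v d (chart_map d p)) = trace (grad v c (chart_map c p))"
        if "d \<in> atlas" "p \<in> chart_dom d" for d
        by (rule trace_similar[OF tensor_field_jac[OF T[OF v] c(1) that(1) c(2) that(2)] jac_invertible[OF c(1) that(1) c(2) that(2)]])
      have "inner_tf atlas g (C_tensor atlas g v) (C_tensor atlas g v) p = tensor_inner_g (g c (chart_map c p))
          (C_tensor atlas g v c (chart_map c p)) (C_tensor atlas g v c (chart_map c p))"
        by (rule inner_tf_chart[where A = "C_tensor atlas g v", OF c]) (simp only: C t symmetrized_jac[OF T[OF v] c])
      then show ?thesis using tensor_inner_nonneg[OF spd_at[OF c]] by simp
    qed
    show "0 \<le> tf_sq (grad v) p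
        + tr_sq (grad v) p - \<kappa> * sq_tr (grad v) p" for p
    proof -
      have "0 \<le> 2 * X \<Longrightarrow> 0 \<le> X" for X :: real by simp
      from this[OF nonneg[of p, unfolded eq]] show ?thesis .
    qed
    show "a_C atlas g v v = (\<integral>p. tf_sq (grad v) p
        + tr_sq (grad v) p - \<kappa> * sq_tr (grad v) p \<partial>density_M)"
      unfolding a_C_def eq integral_mult_right_zero by simp
  qed
qed

end

theorem theorem4p1:
  fixes atlas :: "('a::{t2_space,second_countable_topology}, 'n::finite) chart set"
    and g :: "('a, 'n, real^'n^'n) components"
  assumes "riemannian_manifold atlas g"
    and "compact (UNIV :: 'a set)"
  shows "coercive atlas g (a_K atlas g) \<and>
         (CARD('n) \<ge> 2 \<longrightarrow> coercive atlas g (a_C atlas g))"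
  using riemannian_manifold.coercive_forms[OF assms] by blast

end
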